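(* If $w_n<\tau$ (with $w_n=w_n(\sigma,\tau)$ defined in the context), then there exists a continuous threshold function $h:\mathbb{R}^n\to\mathbb{R}$ (that is, $h$ is continuous, strictly decreasing in each of its $n$ arguments, and symmetric in the sense defined in the context) that leads to a threshold policy equilibrium, i.e. such that the strategy profile $(1_{h(y_1)\ge0},\dots,1_{h(y_n)\ge0})$ is a Bayesian Nash equilibrium of the global game with noisy information sharing with $n$ agents and noise variances $\sigma^2,\tau^2$. Furthermore, $h$ can be numerically approximated with arbitrary precision, with respect to the $\mathcal L_\infty$ norm.
   Context: Global game with noisy information sharing. There are $n\ge2$ agents $[n]=\{1,\dots,n\}$, each with action set $\{0,1\}$ ($1$ = risky, $0$ = safe). Under action profile $\alpha\in\{0,1\}^n$ the utility of agent $i$ is $u_i(\alpha)=\alpha_i\big(\sum_{j=1}^n\alpha_j-\theta\big)$. The fundamental $\theta$ is uniformly distributed over $\mathbb{R}$ (non-informative, improper prior). Let $x_i=\theta+\xi_i$ for $i\in[n]$ and $y_{ji}=x_j+\zeta_{ji}$ for $j\ne i$, where $\xi_1,\dots,\xi_n$ are i.i.d. $\mathcal N(0,\sigma^2)$ and the $\zeta_{ji}$ are i.i.d. $\mathcal N(0,\tau^2)$, independent of the $\xi$'s (all noises independent of $\theta$), with $\sigma,\tau>0$. Agent $i$ observes $y_i=(x_i,\{y_{ji}\}_{j\in[n]\setminus\{i\}})\in\mathbb{R}^n$. Conditional laws given $y_i=u$ are the formal posteriors obtained from the flat prior by normalizing the joint density (they are proper Gaussian laws). A strategy of agent $i$ is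 a measurable $s_i:\mathbb{R}^n\to\{0,1\}$, applied to $y_i$; $1_{h(y_i)\ge0}$ denotes the strategy taking action $1$ if $h(y_i)\ge0$ and action $0$ if $h(y_i)<0$. A strategy $\tilde s$ is a best response of agent $i$ to $(s_j)_{j\ne i}$ if $\tilde s(u)=0$ whenever $1+E[\sum_{j\ne i}s_j(y_j)\mid y_i=u]<E[\theta\mid y_i=u]$, and $\tilde s(u)=1$ whenever $1+E[\sum_{j\ne i}s_j(y_j)\mid y_i=u]>E[\theta\mid y_i=u]$. A profile is a Bayesian Nash equilibrium if each $s_i$ is a best response to the others. Symmetry of $h:\mathbb{R}^n\to\mathbb{R}$: whenever $(x_i,\{y_{ji}\}_{j\in[n]\setminus\{i\}})$ is a root of $h$, every point obtained from it by permuting the coordinates $\{y_{ji}\}_{j\in[n]\setminus\{i\}}$ (all coordinates but the first) is also a root of $h$. Constants. For $m\ge1$: $\frac1{\eta_m^2}=\frac1{\sigma^2}+\frac{m-1}{\sigma^2+\tau^2}$, $a_m=\eta_m^2/\sigma^2$, $b_m=\eta_m^2/(\sigma^2+\tau^2)$. Further, $\frac1{\gamma_n^2}=\frac1{\tau^2}+\frac1{\eta_{n-1}^2+\sigma^2}$, $c_n=\gamma_n^2/(\eta_{n-1}^2+\sigma^2)$, $d_n=\gamma_n^2/\tau^2$, $e_n=\max\{c_na_{n-1},d_n,c_nb_{n-1}\}$, and $$w_n=\max\Big\{\tfrac{(n-1)(e_n(na_n+(n-2)b_n)+b_n)}{b_n^2},\ \tfrac{(n-1)\left(e_n(na_n+(n-2)b_n)(b_n+2a_n)+b_n^2\right)}{a_nb_n^2}\Big\}.$$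 The $\mathcal L_\infty$ norm is the supremum norm. *)

theory Defs
  imports "HOL-Probability.Probability" "HOL-Combinatorics.Permutations" "HOL-Library.Nat_Bijection"
begin

section \<open>Observations\<close>

text \<open>Agents are numbered from 0, so the set of agents is \<open>{..<n}\<close>. A point of n-dimensional
  space is a function on \<open>{..<n}\<close> (extended by \<open>undefined\<close>), with the product topology and the
  product Borel sigma-algebra.\<close>

abbreviation Rn :: "nat \<Rightarrow> (nat \<Rightarrow> real) set" where
  "Rn n \<equiv> PiE {..<n} (\<lambda>_. UNIV)"

text \<open>\<open>Private j\<close> is $x_j$ and \<open>Message j i\<close> is $y_{ji}$, the noisy copy of $x_j$ received by
  agent \<open>i\<close>. A state assigns a real value to every quantity.\<close>

datatype quantity = Fundamental | Private nat | Message nat nat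

type_synonym state = "quantity \<Rightarrow> real"

definition links :: "nat \<Rightarrow> (nat \<times> nat) set" where
  "links n = {(j, i). j < n \<and> i < n \<and> j \<noteq> i}"

definition hidden :: "nat \<Rightarrow> nat \<Rightarrow> quantity set" where
  "hidden n i = {Fundamental} \<union> Private ` ({..<n} - {i})
                 \<union> {Message j k | j k. (j, k) \<in> links n \<and> k \<noteq> i}"

text \<open>The observation vector of agent \<open>i\<close> has $x_i$ at position 0, followed by the messages of the
  other agents in increasing order of the sender. The functions \<open>sender i\<close> and \<open>msg_pos i\<close> are
  mutually inverse bijections between \<open>{1..<n}\<close> and \<open>{..<n} - {i}\<close>.\<close>

definition sender :: "nat \<Rightarrow> nat \<Rightarrow> nat" where
  "sender i p = (if p \<le> i then p - 1 else p)"

definition msg_pos :: "nat \<Rightarrow> nat \<Rightarrow> nat" where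
  "msg_pos i j = (if j < i then Suc j else j)"

definition obs :: "nat \<Rightarrow> nat \<Rightarrow> state \<Rightarrow> (nat \<Rightarrow> real)" where
  "obs n i \<omega> = (\<lambda>p\<in>{..<n}. if p = 0 then \<omega> (Private i) else \<omega> (Message (sender i p) i))"

text \<open>The state in which agent \<open>i\<close> observes \<open>u\<close> and all other quantities are given by \<open>w\<close>.\<close>

fun complete_state :: "nat \<Rightarrow> (nat \<Rightarrow> real) \<Rightarrow> state \<Rightarrow> state" where
  "complete_state i u w Fundamental = w Fundamental"
| "complete_state i u w (Private j) = (if j = i then u 0 else w (Private j))"
| "complete_state i u w (Message j k) = (if k = i then u (msg_pos i j) else w (Message j k))"

lemma sender_msg_pos: "j \<noteq> i \<Longrightarrow> sender i (msg_pos i j) = j"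
  by (auto simp: sender_def msg_pos_def)

lemma msg_pos_sender: "0 < p \<Longrightarrow> msg_pos i (sender i p) = p"
  by (auto simp: sender_def msg_pos_def)

lemma bij_betw_sender:
  assumes "i < n"
  shows "bij_betw (sender i) {1..<n} ({..<n} - {i})"
proof (rule bij_betw_byWitness[where f' = "msg_pos i"])
  show "\<forall>p\<in>{1..<n}. msg_pos i (sender i p) = p"
    by (simp add: msg_pos_sender)
  show "\<forall>j\<in>{..<n} - {i}. sender i (msg_pos i j) = j"
    by (simp add: sender_msg_pos)
  show "sender i ` {1..<n} \<subseteq> {..<n} - {i}"
    using assms by (auto simp: sender_def)
  show "msg_pos i ` ({..<n} - {i}) \<subseteq> {1..<n}"
    using assms by (auto simp: msg_pos_def)
qed

lemma obs_complete_state: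
  assumes "u \<in> Rn n"
  shows "obs n i (complete_state i u w) = u"
proof
  fix p
  show "obs n i (complete_state i u w) p = u p"
    using PiE_arb[OF assms, of p] by (cases "p < n") (simp_all add: obs_def msg_pos_sender)
qed

section \<open>Formal posteriors under the flat prior\<close>

text \<open>The density of $(\theta, x, y)$ with respect to Lebesgue measure; the flat prior contributes
  the constant factor 1.\<close>

definition joint_density :: "nat \<Rightarrow> real \<Rightarrow> real \<Rightarrow> state \<Rightarrow> real" where
  "joint_density n \<sigma> \<tau> \<omega> =
     (\<Prod>j<n. normal_density (\<omega> Fundamental) \<sigma> (\<omega> (Private j))) *
     (\<Prod>(j, i)\<in>links n. normal_density (\<omega> (Private j)) \<tau> (\<omega> (Message j i)))"

definition posterior :: "nat \<Rightarrow> real \<Rightarrow> real \<Rightarrow> nat \<Rightarrow> (nat \<Rightarrow> real) \<Rightarrow> state measure" where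
  "posterior n \<sigma> \<tau> i u =
     (let M = PiM (hidden n i) (\<lambda>_. lborel);
          f = (\<lambda>w. joint_density n \<sigma> \<tau> (complete_state i u w))
      in density M (\<lambda>w. ennreal (f w / (\<integral>w'. f w' \<partial>M))))"

definition cond_expectation ::
  "nat \<Rightarrow> real \<Rightarrow> real \<Rightarrow> nat \<Rightarrow> (nat \<Rightarrow> real) \<Rightarrow> (state \<Rightarrow> real) \<Rightarrow> real" where
  "cond_expectation n \<sigma> \<tau> i u g = (\<integral>w. g (complete_state i u w) \<partial>posterior n \<sigma> \<tau> i u)"

section \<open>The game\<close>

definition utility :: "nat \<Rightarrow> real \<Rightarrow> nat \<Rightarrow> (nat \<Rightarrow> nat) \<Rightarrow> real" where
  "utility n \<theta> i \<alpha> = real (\<alpha> i) * ((\<Sum>j<n. real (\<alpha> j)) - \<theta>)"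

definition strategy :: "nat \<Rightarrow> ((nat \<Rightarrow> real) \<Rightarrow> nat) \<Rightarrow> bool" where
  "strategy n s \<longleftrightarrow> s \<in> measurable (PiM {..<n} (\<lambda>_. borel)) (count_space {0, 1})"

definition expected_others ::
  "nat \<Rightarrow> real \<Rightarrow> real \<Rightarrow> nat \<Rightarrow> (nat \<Rightarrow> (nat \<Rightarrow> real) \<Rightarrow> nat) \<Rightarrow> (nat \<Rightarrow> real) \<Rightarrow> real" where
  "expected_others n \<sigma> \<tau> i s u =
     cond_expectation n \<sigma> \<tau> i u (\<lambda>\<omega>. \<Sum>j\<in>{..<n} - {i}. real (s j (obs n j \<omega>)))"

definition expected_fundamental :: "nat \<Rightarrow> real \<Rightarrow> real \<Rightarrow> nat \<Rightarrow> (nat \<Rightarrow> real) \<Rightarrow> real" where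
  "expected_fundamental n \<sigma> \<tau> i u = cond_expectation n \<sigma> \<tau> i u (\<lambda>\<omega>. \<omega> Fundamental)"

text \<open>The quantity \<open>1 + expected_others - expected_fundamental\<close> is the conditional expectation of the
  gain from the risky action over the safe one:\<close>

lemma utility_gain:
  assumes "i < n"
  shows "utility n \<theta> i (\<alpha>(i := 1)) - utility n \<theta> i (\<alpha>(i := 0))
           = 1 + (\<Sum>j\<in>{..<n} - {i}. real (\<alpha> j)) - \<theta>"
proof -
  have "(\<Sum>j<n. real ((\<alpha>(i := 1)) j)) = 1 + (\<Sum>j\<in>{..<n} - {i}. real (\<alpha> j))"
    using assms by (subst sum.remove[of _ i]) auto
  then show ?thesis
    by (simp add: utility_def)
qed

definition best_response ::
  "nat \<Rightarrow> real \<Rightarrow> real \<Rightarrow> nat \<Rightarrow> (nat \<Rightarrow> (nat \<Rightarrow> real) \<Rightarrow> nat) \<Rightarrow> ((nat \<Rightarrow> real) \<Rightarrow> nat) \<Rightarrow> bool" where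
  "best_response n \<sigma> \<tau> i s s' \<longleftrightarrow>
     (\<forall>u\<in>Rn n.
        (1 + expected_others n \<sigma> \<tau> i s u < expected_fundamental n \<sigma> \<tau> i u \<longrightarrow> s' u = 0) \<and>
        (1 + expected_others n \<sigma> \<tau> i s u > expected_fundamental n \<sigma> \<tau> i u \<longrightarrow> s' u = 1))"

definition bayesian_nash_equilibrium ::
  "nat \<Rightarrow> real \<Rightarrow> real \<Rightarrow> (nat \<Rightarrow> (nat \<Rightarrow> real) \<Rightarrow> nat) \<Rightarrow> bool" where
  "bayesian_nash_equilibrium n \<sigma> \<tau> s \<longleftrightarrow>
     (\<forall>i<n. strategy n (s i)) \<and> (\<forall>i<n. best_response n \<sigma> \<tau> i s (s i))"

section \<open>Threshold functions\<close>

definition threshold_strategy :: "((nat \<Rightarrow> real) \<Rightarrow> real) \<Rightarrow> (nat \<Rightarrow> real) \<Rightarrow> nat" where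
  "threshold_strategy h u = (if h u \<ge> 0 then 1 else 0)"

definition symmetric_roots :: "nat \<Rightarrow> ((nat \<Rightarrow> real) \<Rightarrow> real) \<Rightarrow> bool" where
  "symmetric_roots n h \<longleftrightarrow>
     (\<forall>u\<in>Rn n. \<forall>\<pi>. h u = 0 \<longrightarrow> \<pi> permutes {1..<n} \<longrightarrow> h (u \<circ> \<pi>) = 0)"

definition continuous_threshold_function :: "nat \<Rightarrow> ((nat \<Rightarrow> real) \<Rightarrow> real) \<Rightarrow> bool" where
  "continuous_threshold_function n h \<longleftrightarrow>
     continuous_on (Rn n) h \<and>
     (\<forall>u\<in>Rn n. \<forall>p<n. \<forall>t>u p. h (u(p := t)) < h u) \<and>
     symmetric_roots n h"

section \<open>Constants\<close>

definition eta2 :: "real \<Rightarrow> real \<Rightarrow> nat \<Rightarrow> real" where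
  "eta2 \<sigma> \<tau> m = 1 / (1 / \<sigma>\<^sup>2 + (real m - 1) / (\<sigma>\<^sup>2 + \<tau>\<^sup>2))"

definition coeff_a :: "real \<Rightarrow> real \<Rightarrow> nat \<Rightarrow> real" where
  "coeff_a \<sigma> \<tau> m = eta2 \<sigma> \<tau> m / \<sigma>\<^sup>2"

definition coeff_b :: "real \<Rightarrow> real \<Rightarrow> nat \<Rightarrow> real" where
  "coeff_b \<sigma> \<tau> m = eta2 \<sigma> \<tau> m / (\<sigma>\<^sup>2 + \<tau>\<^sup>2)"

definition gamma2 :: "real \<Rightarrow> real \<Rightarrow> nat \<Rightarrow> real" where
  "gamma2 \<sigma> \<tau> n = 1 / (1 / \<tau>\<^sup>2 + 1 / (eta2 \<sigma> \<tau> (n - 1) + \<sigma>\<^sup>2))"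

definition coeff_c :: "real \<Rightarrow> real \<Rightarrow> nat \<Rightarrow> real" where
  "coeff_c \<sigma> \<tau> n = gamma2 \<sigma> \<tau> n / (eta2 \<sigma> \<tau> (n - 1) + \<sigma>\<^sup>2)"

definition coeff_d :: "real \<Rightarrow> real \<Rightarrow> nat \<Rightarrow> real" where
  "coeff_d \<sigma> \<tau> n = gamma2 \<sigma> \<tau> n / \<tau>\<^sup>2"

definition coeff_e :: "real \<Rightarrow> real \<Rightarrow> nat \<Rightarrow> real" where
  "coeff_e \<sigma> \<tau> n =
     Max {coeff_c \<sigma> \<tau> n * coeff_a \<sigma> \<tau> (n - 1), coeff_d \<sigma> \<tau> n,
          coeff_c \<sigma> \<tau> n * coeff_b \<sigma> \<tau> (n - 1)}"

definition coeff_w :: "real \<Rightarrow> real \<Rightarrow> nat \<Rightarrow> real" where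
  "coeff_w \<sigma> \<tau> n =
     (let a = coeff_a \<sigma> \<tau> n; b = coeff_b \<sigma> \<tau> n; e = coeff_e \<sigma> \<tau> n; N = real n in
      max ((N - 1) * (e * (N * a + (N - 2) * b) + b) / b\<^sup>2)
          ((N - 1) * (e * (N * a + (N - 2) * b) * (b + 2 * a) + b\<^sup>2) / (a * b\<^sup>2)))"

section \<open>Numerical approximability\<close>

text \<open>The total recursive functions relative to a set of oracles, as unary functions on codes, with
  \<open>prod_encode\<close> as pairing function. Minimization is restricted to searches that always succeed.\<close>

inductive recursive_in :: "(nat \<Rightarrow> nat) set \<Rightarrow> (nat \<Rightarrow> nat) \<Rightarrow> bool" for \<Omega> where
  oracle_fun: "f \<in> \<Omega> \<Longrightarrow> recursive_in \<Omega> f"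
| zero_fun: "recursive_in \<Omega> (\<lambda>_. 0)"
| suc_fun: "recursive_in \<Omega> Suc"
| left_proj: "recursive_in \<Omega> (\<lambda>x. fst (prod_decode x))"
| right_proj: "recursive_in \<Omega> (\<lambda>x. snd (prod_decode x))"
| pairing: "recursive_in \<Omega> f \<Longrightarrow> recursive_in \<Omega> g
    \<Longrightarrow> recursive_in \<Omega> (\<lambda>x. prod_encode (f x, g x))"
| composition: "recursive_in \<Omega> f \<Longrightarrow> recursive_in \<Omega> g \<Longrightarrow> recursive_in \<Omega> (\<lambda>x. f (g x))"
| prim_recursion: "recursive_in \<Omega> f \<Longrightarrow> recursive_in \<Omega> g
    \<Longrightarrow> recursive_in \<Omega> (\<lambda>x. case prod_decode x of (y, m) \<Rightarrow>
          rec_nat (f y) (\<lambda>l r. g (prod_encode (y, prod_encode (l, r)))) m)"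
| minimization: "recursive_in \<Omega> f \<Longrightarrow> (\<And>y. \<exists>m. f (prod_encode (y, m)) = 0)
    \<Longrightarrow> recursive_in \<Omega> (\<lambda>y. LEAST m. f (prod_encode (y, m)) = 0)"

text \<open>A positive real number is made available to an algorithm through its binary expansion.\<close>

definition binary_oracle :: "real \<Rightarrow> nat \<Rightarrow> nat" where
  "binary_oracle r k = nat \<lfloor>2 ^ k * r\<rfloor>"

text \<open>The function evaluated by an algorithm \<open>F\<close> at accuracy level \<open>k\<close>: the coordinates of the
  argument are rounded down to \<open>p\<close> binary places, and \<open>F\<close> turns these integers into the numerator of a
  dyadic rational with denominator $2^k$.\<close>

definition finite_precision_eval ::
  "nat \<Rightarrow> (nat \<Rightarrow> nat) \<Rightarrow> nat \<Rightarrow> nat \<Rightarrow> (nat \<Rightarrow> real) \<Rightarrow> real" where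
  "finite_precision_eval n F p k u =
     of_int (int_decode (F (list_encode (k # map (\<lambda>q. int_encode \<lfloor>2 ^ p * u q\<rfloor>) [0..<n])))) / 2 ^ k"

text \<open>One algorithm, given the model parameters as oracles, produces for every \<open>k\<close> an approximation
  whose distance to \<open>h\<close> in the supremum norm over the whole space is at most $2^{-k}$. The required
  number \<open>P k\<close> of binary places of the argument is itself computable.\<close>

definition numerically_approximable ::
  "nat \<Rightarrow> real \<Rightarrow> real \<Rightarrow> ((nat \<Rightarrow> real) \<Rightarrow> real) \<Rightarrow> bool" where
  "numerically_approximable n \<sigma> \<tau> h \<longleftrightarrow>
     (\<exists>F P. recursive_in {binary_oracle \<sigma>, binary_oracle \<tau>} F \<and>
            recursive_in {binary_oracle \<sigma>, binary_oracle \<tau>} P \<and>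
            (\<forall>k. \<forall>u\<in>Rn n. \<bar>finite_precision_eval n F (P k) k u - h u\<bar> \<le> 1 / 2 ^ k))"

end

theory Submission
  imports Defs
begin

text \<open>The expected gain from the risky action at an observation u is
  1 + sum over the peers of P(h(peer's observation) \<ge> 0) - E[\<theta> | u], and an equilibrium threshold is a
  fixed point h of this operator. By Gaussian conditioning E[\<theta> | u] is a weighted mean of u whose
  weights are at least \<beta> = b_n, and a peer's observation is an affine image of independent Gaussian
  noise whose dependence on u is by weighted means, too. Hence the operator produces functions of slope
  at most -\<beta> in every coordinate. The peer's message from the observer carries noise of density at
  most 1/(\<tau> sqrt (2 pi)) that enters nowhere else, so a function of slope at most -\<beta> is smaller than r in
  modulus with probability at most 2r/(\<beta> \<tau> sqrt (2 pi)). Since w_n < \<tau> forces n - 1 < \<beta> \<tau>, the operator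
  contracts the supremum distance by a factor below 9/10, and its fixed point is Lipschitz.

  The same estimate shows that rounding the observations and replacing the noise by a discrete law
  changes the operator by O(1/K) on a grid of mesh 1/K. An algorithm iterates the discretized operator
  K times; by the contraction the accumulated error remains O(1/K) uniformly in u.\<close>

section \<open>Recursive functions\<close>

text \<open>A decision 1 if h \<ge> 0 is discontinuous in h; steepness restores stability. Two
  decision rules that disagree only where |h| \<le> r have probabilities within
  \<open>\<gamma>\<close> * r of each other. This one estimate, \<open>peer_prob_close\<close>,
  gives the contraction, the Lipschitz bound and the stability of the algorithm. The slope does not
  deteriorate under iteration: for decreasing h the peers' probabilities fall as u rises, so the
  slope of the posterior mean is kept whatever h is. Agents sort their messages differently. That
  one h serves all of them rests on full exchangeability of h, which is carried through the
  iteration and is stronger than the symmetry of the roots. Signs of computable reals are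
  undecidable. The algorithm therefore decides signs of integers only; a wrong decision can occur
  only where |h| is small, and such points have small probability. The iteration calls itself at
  many new arguments per level, which is no primitive recursion; all decisions of one level are
  therefore packed into the binary digits of one number.\<close>

abbreviation pfst :: "nat \<Rightarrow> nat" where "pfst x \<equiv> fst (prod_decode x)"
abbreviation psnd :: "nat \<Rightarrow> nat" where "psnd x \<equiv> snd (prod_decode x)"

definition decidable_in :: "(nat \<Rightarrow> nat) set \<Rightarrow> (nat \<Rightarrow> bool) \<Rightarrow> bool" where
  "decidable_in \<Omega> P \<longleftrightarrow> recursive_in \<Omega> (\<lambda>x. if P x then 1 else 0)"

text \<open>The rules are stated pointwise, with arbitrary recursive functions as arguments, so that
  recursiveness is proved by following the syntax of a term.\<close>

named_theorems rec_intros

lemma recursive_in_id [rec_intros]: "recursive_in \<Omega> (\<lambda>x. x)"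
  using pairing[OF left_proj right_proj, of \<Omega>] by simp

lemma recursive_in_const [rec_intros]: "recursive_in \<Omega> (\<lambda>_. c)"
  by (induction c) (auto intro: zero_fun composition[OF suc_fun])

lemma recursive_in_Suc [rec_intros]: "recursive_in \<Omega> f \<Longrightarrow> recursive_in \<Omega> (\<lambda>x. Suc (f x))"
  by (rule composition[OF suc_fun])

lemma recursive_in_pfst [rec_intros]: "recursive_in \<Omega> f \<Longrightarrow> recursive_in \<Omega> (\<lambda>x. pfst (f x))"
  by (rule composition[OF left_proj])

lemma recursive_in_psnd [rec_intros]: "recursive_in \<Omega> f \<Longrightarrow> recursive_in \<Omega> (\<lambda>x. psnd (f x))"
  by (rule composition[OF right_proj])

lemmas recursive_in_pair [rec_intros] = pairing

text \<open>\<open>recursive_in\<close> speaks of unary functions, so a curried function is shown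
  recursive on coded pairs once and is then available for arbitrary arguments.\<close>

lemma recursive_in_app2:
  assumes "recursive_in \<Omega> (\<lambda>x. F (pfst x) (psnd x))" "recursive_in \<Omega> f" "recursive_in \<Omega> g"
  shows "recursive_in \<Omega> (\<lambda>x. F (f x) (g x))"
  using composition[OF assms(1) pairing[OF assms(2,3)]] by simp

lemma recursive_in_app3:
  assumes "recursive_in \<Omega> (\<lambda>x. F (pfst x) (pfst (psnd x)) (psnd (psnd x)))"
    "recursive_in \<Omega> f" "recursive_in \<Omega> g" "recursive_in \<Omega> h"
  shows "recursive_in \<Omega> (\<lambda>x. F (f x) (g x) (h x))"
  using composition[OF assms(1) pairing[OF assms(2) pairing[OF assms(3,4)]]] by simp

lemma recursive_in_rec_nat [rec_intros]:
  assumes "recursive_in \<Omega> f" "recursive_in \<Omega> (\<lambda>x. g (pfst x) (pfst (psnd x)) (psnd (psnd x)))"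
    "recursive_in \<Omega> m"
  shows "recursive_in \<Omega> (\<lambda>x. rec_nat (f x) (g x) (m x))"
  using composition[OF prim_recursion[OF assms(1,2)] pairing[OF recursive_in_id assms(3)]]
  by simp

lemma recursive_in_Least [rec_intros]:
  assumes "recursive_in \<Omega> (\<lambda>x. f (pfst x) (psnd x))" "\<And>x. \<exists>m. f x m = 0"
  shows "recursive_in \<Omega> (\<lambda>x. LEAST m. f x m = 0)"
  using minimization[OF assms(1)] assms(2) by simp

lemma recursive_in_add [rec_intros]:
  assumes "recursive_in \<Omega> f" "recursive_in \<Omega> g"
  shows "recursive_in \<Omega> (\<lambda>x. f x + g x)"
proof -
  have eq: "rec_nat a (\<lambda>l r. Suc r) b = a + b" for a b by (induction b) auto
  have "recursive_in \<Omega> (\<lambda>x. rec_nat (f x) (\<lambda>l r. Suc r) (g x))"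
    by (intro rec_intros assms)
  then show ?thesis by (simp add: eq)
qed

lemma recursive_in_sum [rec_intros]:
  assumes "recursive_in \<Omega> (\<lambda>x. g (pfst x) (psnd x))" "recursive_in \<Omega> m"
  shows "recursive_in \<Omega> (\<lambda>x. \<Sum>i<m x. g x i)"
proof -
  have eq: "rec_nat 0 (\<lambda>l r. r + h l) b = (\<Sum>i<b. h i)" for h :: "nat \<Rightarrow> nat" and b
    by (induction b) auto
  have "recursive_in \<Omega> (\<lambda>x. g (pfst x) (pfst (psnd x)))"
    by (rule recursive_in_app2[OF assms(1)]) (intro rec_intros)+
  then have "recursive_in \<Omega> (\<lambda>x. rec_nat 0 (\<lambda>l r. r + g x l) (m x))"
    by (intro rec_intros assms)
  then show ?thesis by (simp add: eq)
qed

lemma recursive_in_mult [rec_intros]: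
  assumes "recursive_in \<Omega> f" "recursive_in \<Omega> g"
  shows "recursive_in \<Omega> (\<lambda>x. f x * g x)"
proof -
  have "recursive_in \<Omega> (\<lambda>x. \<Sum>i<g x. f x)"
    by (intro rec_intros composition[OF assms(1)] assms)
  then show ?thesis by (simp add: mult.commute)
qed

lemma recursive_in_prod [rec_intros]:
  assumes "recursive_in \<Omega> (\<lambda>x. g (pfst x) (psnd x))" "recursive_in \<Omega> m"
  shows "recursive_in \<Omega> (\<lambda>x. \<Prod>i<m x. g x i)"
proof -
  have eq: "rec_nat 1 (\<lambda>l r. r * h l) b = (\<Prod>i<b. h i)" for h :: "nat \<Rightarrow> nat" and b
    by (induction b) auto
  have "recursive_in \<Omega> (\<lambda>x. g (pfst x) (pfst (psnd x)))"
    by (rule recursive_in_app2[OF assms(1)]) (intro rec_intros)+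
  then have "recursive_in \<Omega> (\<lambda>x. rec_nat 1 (\<lambda>l r. r * g x l) (m x))"
    by (intro rec_intros assms)
  then show ?thesis unfolding eq .
qed

lemma recursive_in_power [rec_intros]:
  assumes "recursive_in \<Omega> f" "recursive_in \<Omega> g"
  shows "recursive_in \<Omega> (\<lambda>x. f x ^ g x)"
proof -
  have "recursive_in \<Omega> (\<lambda>x. \<Prod>i<g x. f x)"
    by (intro rec_intros composition[OF assms(1)] assms)
  then show ?thesis by simp
qed

lemma recursive_in_diff [rec_intros]:
  assumes "recursive_in \<Omega> f" "recursive_in \<Omega> g"
  shows "recursive_in \<Omega> (\<lambda>x. f x - g x)"
proof -
  have pred: "rec_nat 0 (\<lambda>l r. l) m = m - 1" for m by (cases m) auto
  have "recursive_in \<Omega> (\<lambda>x. rec_nat 0 (\<lambda>l r. l) x)"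
    by (intro rec_intros)
  then have "recursive_in \<Omega> (\<lambda>x. x - 1)" by (simp add: pred)
  from composition[OF this]
  have P: "recursive_in \<Omega> h \<Longrightarrow> recursive_in \<Omega> (\<lambda>x. h x - 1)" for h by simp
  have eq: "rec_nat a (\<lambda>l r. r - 1) b = a - b" for a b :: nat by (induction b) auto
  have "recursive_in \<Omega> (\<lambda>x. rec_nat (f x) (\<lambda>l r. r - 1) (g x))"
    by (intro rec_intros P assms)
  then show ?thesis unfolding eq .
qed

lemma decidable_in_le [rec_intros]:
  assumes "recursive_in \<Omega> f" "recursive_in \<Omega> g"
  shows "decidable_in \<Omega> (\<lambda>x. f x \<le> g x)"
proof -
  have "recursive_in \<Omega> (\<lambda>x. 1 - (f x - g x))"
    by (intro rec_intros assms)
  moreover have "(\<lambda>x. 1 - (f x - g x)) = (\<lambda>x. if f x \<le> g x then 1 else 0)" by auto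
  ultimately show ?thesis by (simp add: decidable_in_def)
qed

lemma decidable_in_less [rec_intros]:
  assumes "recursive_in \<Omega> f" "recursive_in \<Omega> g"
  shows "decidable_in \<Omega> (\<lambda>x. f x < g x)"
  using decidable_in_le[OF recursive_in_Suc[OF assms(1)] assms(2)] by (simp add: Suc_le_eq)

lemma recursive_in_if [rec_intros]:
  assumes "decidable_in \<Omega> P" "recursive_in \<Omega> f" "recursive_in \<Omega> g"
  shows "recursive_in \<Omega> (\<lambda>x. if P x then f x else g x)"
proof -
  have "recursive_in \<Omega> (\<lambda>x. (if P x then 1 else 0) * f x + (1 - (if P x then 1 else 0)) * g x)"
    by (intro rec_intros assms assms(1)[unfolded decidable_in_def])
  moreover have "(\<lambda>x. (if P x then 1 else 0) * f x + (1 - (if P x then 1 else 0)) * g x)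
      = (\<lambda>x. if P x then f x else g x)" by auto
  ultimately show ?thesis by simp
qed

lemma decidable_in_eq [rec_intros]:
  assumes "recursive_in \<Omega> f" "recursive_in \<Omega> g"
  shows "decidable_in \<Omega> (\<lambda>x. f x = g x)"
proof -
  have "recursive_in \<Omega> (\<lambda>x. if f x \<le> g x then if g x \<le> f x then 1 else 0 else 0)"
    by (intro rec_intros assms)
  moreover have "(\<lambda>x. if f x \<le> g x then if g x \<le> f x then 1 else 0 else 0::nat)
      = (\<lambda>x. if f x = g x then 1 else 0)" by auto
  ultimately show ?thesis by (simp add: decidable_in_def)
qed

text \<open>The quotient counts the positive multiples of d up to x. There are at most x of them, so
  a bounded sum computes it.\<close>

lemma div_eq_sum: "0 < d \<Longrightarrow> x div d = (\<Sum>i<x. if Suc i * d \<le> x then 1 else 0)" for x d :: nat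
proof -
  assume d: "0 < d"
  have iff: "Suc i * d \<le> x \<longleftrightarrow> i < x div d" for i
    using less_eq_div_iff_mult_less_eq[OF d, of "Suc i" x] by (simp add: Suc_le_eq)
  have "{i. i < x \<and> Suc i * d \<le> x} = {..<x div d}"
    unfolding iff using div_le_dividend[of x d] by (auto intro: less_le_trans simp del: div_le_dividend)
  then have "card {i. i < x \<and> Suc i * d \<le> x} = x div d" by simp
  moreover have "(\<Sum>i<x. if Suc i * d \<le> x then 1 else 0) = card {i. i < x \<and> Suc i * d \<le> x}"
    by (subst sum.If_cases) (auto intro!: arg_cong[where f = card])
  ultimately show ?thesis by simp
qed

lemma recursive_in_div [rec_intros]:
  assumes "recursive_in \<Omega> f" "recursive_in \<Omega> g"
  shows "recursive_in \<Omega> (\<lambda>x. f x div g x)"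
proof -
  have "recursive_in \<Omega> (\<lambda>x. if 0 < g x then (\<Sum>i<f x. if Suc i * g x \<le> f x then 1 else 0) else 0)"
    by (intro rec_intros assms composition[OF assms(1)] composition[OF assms(2)])
  moreover have "(\<lambda>x. if 0 < g x then (\<Sum>i<f x. if Suc i * g x \<le> f x then 1 else 0) else 0)
      = (\<lambda>x. f x div g x)"
    by (rule ext) (auto simp: div_eq_sum)
  ultimately show ?thesis by simp
qed

lemma recursive_in_mod [rec_intros]:
  assumes "recursive_in \<Omega> f" "recursive_in \<Omega> g"
  shows "recursive_in \<Omega> (\<lambda>x. f x mod g x)"
  unfolding modulo_nat_def by (intro rec_intros assms)

section \<open>Integer-valued recursive functions and coded integer vectors\<close>

text \<open>Integers are handled through their positive and negative parts, so that integer
  arithmetic reduces to addition and truncated subtraction of naturals.\<close>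

definition recursive_int_in :: "(nat \<Rightarrow> nat) set \<Rightarrow> (nat \<Rightarrow> int) \<Rightarrow> bool" where
  "recursive_int_in \<Omega> f \<longleftrightarrow> recursive_in \<Omega> (\<lambda>x. nat (f x)) \<and> recursive_in \<Omega> (\<lambda>x. nat (- f x))"

lemma recursive_in_nat [rec_intros]: "recursive_int_in \<Omega> f \<Longrightarrow> recursive_in \<Omega> (\<lambda>x. nat (f x))"
  by (simp add: recursive_int_in_def)

lemma recursive_int_in_of_nat [rec_intros]:
  "recursive_in \<Omega> f \<Longrightarrow> recursive_int_in \<Omega> (\<lambda>x. int (f x))"
  by (simp add: recursive_int_in_def zero_fun)

lemma recursive_int_in_uminus [rec_intros]:
  "recursive_int_in \<Omega> f \<Longrightarrow> recursive_int_in \<Omega> (\<lambda>x. - f x)"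
  by (simp add: recursive_int_in_def)

lemma recursive_int_in_diff_nat:
  assumes "recursive_in \<Omega> f" "recursive_in \<Omega> g"
  shows "recursive_int_in \<Omega> (\<lambda>x. int (f x) - int (g x))"
proof -
  have "nat (int a - int b) = a - b" "nat (- (int a - int b)) = b - a" for a b by auto
  then show ?thesis unfolding recursive_int_in_def by (auto intro!: rec_intros assms)
qed

lemma recursive_int_in_add [rec_intros]:
  assumes "recursive_int_in \<Omega> f" "recursive_int_in \<Omega> g"
  shows "recursive_int_in \<Omega> (\<lambda>x. f x + g x)"
proof -
  have "recursive_int_in \<Omega> (\<lambda>x. int (nat (f x) + nat (g x)) - int (nat (- f x) + nat (- g x)))"
    by (intro rec_intros recursive_int_in_diff_nat assms)
  moreover have "int (nat a + nat b) - int (nat (-a) + nat (-b)) = a + b" for a b by auto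
  ultimately show ?thesis by simp
qed

lemma recursive_int_in_diff [rec_intros]:
  assumes "recursive_int_in \<Omega> f" "recursive_int_in \<Omega> g"
  shows "recursive_int_in \<Omega> (\<lambda>x. f x - g x)"
  using recursive_int_in_add[OF assms(1) recursive_int_in_uminus[OF assms(2)]] by simp

lemma recursive_int_in_sum:
  assumes "\<And>i. i \<in> A \<Longrightarrow> recursive_int_in \<Omega> (f i)"
  shows "recursive_int_in \<Omega> (\<lambda>x. \<Sum>i\<in>A. f i x)"
proof (cases "finite A")
  case True
  then show ?thesis using assms
    by (induction A) (auto intro!: rec_intros intro: recursive_int_in_of_nat[OF zero_fun, simplified])
qed (simp add: recursive_int_in_of_nat[OF zero_fun, simplified])

lemma decidable_in_nonneg [rec_intros]:
  assumes "recursive_int_in \<Omega> f"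
  shows "decidable_in \<Omega> (\<lambda>x. 0 \<le> f x)"
proof -
  have "decidable_in \<Omega> (\<lambda>x. nat (- f x) \<le> 0)"
    by (intro rec_intros assms)
  then show ?thesis by simp
qed

lemma recursive_int_in_if [rec_intros]:
  assumes "decidable_in \<Omega> P" "recursive_int_in \<Omega> f" "recursive_int_in \<Omega> g"
  shows "recursive_int_in \<Omega> (\<lambda>x. if P x then f x else g x)"
proof -
  have "recursive_in \<Omega> (\<lambda>x. if P x then nat (f x) else nat (g x))"
    "recursive_in \<Omega> (\<lambda>x. if P x then nat (- f x) else nat (- g x))"
    by (intro rec_intros assms)+
  then show ?thesis
    unfolding recursive_int_in_def by (simp add: if_distrib cong: if_cong)
qed

text \<open>Integer division rounds towards minus infinity. For a negative dividend -k it is minus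
  the ceiling of k / d, that is minus (k + (d - 1)) div d.\<close>

lemma recursive_int_in_div_nat [rec_intros]:
  assumes "recursive_int_in \<Omega> f" "recursive_in \<Omega> g" "\<And>x. 0 < g x"
  shows "recursive_int_in \<Omega> (\<lambda>x. f x div int (g x))"
proof -
  have "recursive_int_in \<Omega> (\<lambda>x. if 0 \<le> f x then int (nat (f x) div g x)
      else - int ((nat (- f x) + (g x - 1)) div g x))"
    by (intro rec_intros assms)
  moreover have "(if 0 \<le> a then int (nat a div d) else - int ((nat (- a) + (d - 1)) div d)) = a div int d"
    if d: "0 < d" for a d
  proof (cases "0 \<le> a")
    case False
    then obtain k where k: "a = - int k" by (metis int_cases2 of_nat_0_le_iff)
    have "k \<le> (k + (d - 1)) div d * d" "(k + (d - 1)) div d * d < k + d"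
      using d div_mult_mod_eq[of "k + (d - 1)" d] mod_less_divisor[OF d, of "k + (d - 1)"] by linarith+
    then have "int k \<le> int ((k + (d - 1)) div d) * int d" "int ((k + (d - 1)) div d) * int d < int k + int d"
      by (metis of_nat_mult of_nat_mono, metis of_nat_add of_nat_less_iff of_nat_mult)
    then have "- int k div int d = - int ((k + (d - 1)) div d)"
      using d by (intro int_div_pos_eq[where r = "int ((k + (d - 1)) div d) * int d - int k"])
        (auto simp: algebra_simps)
    then show ?thesis using False k by simp
  qed (auto simp: zdiv_int)
  ultimately show ?thesis using assms(3) by simp
qed

lemma int_encode_conv: "int_encode i = (if 0 \<le> i then 2 * nat i else 2 * nat (- i - 1) + 1)"
  by (simp add: int_encode_def sum_encode_def)

lemma int_decode_conv: "int_decode k = (if k mod 2 = 0 then int (k div 2) else - int (Suc (k div 2)))"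
  by (auto simp: int_decode_def sum_decode_def even_iff_mod_2_eq_zero)

lemma recursive_in_int_encode [rec_intros]:
  assumes "recursive_int_in \<Omega> f"
  shows "recursive_in \<Omega> (\<lambda>x. int_encode (f x))"
proof -
  have "recursive_in \<Omega> (\<lambda>x. if 0 \<le> f x then 2 * nat (f x) else 2 * (nat (- f x) - 1) + 1)"
    by (intro rec_intros assms)
  moreover have "nat (- i - 1) = nat (- i) - 1" for i by auto
  ultimately show ?thesis unfolding int_encode_conv by presburger
qed

lemma recursive_int_in_int_decode [rec_intros]:
  assumes "recursive_in \<Omega> f"
  shows "recursive_int_in \<Omega> (\<lambda>x. int_decode (f x))"
  unfolding int_decode_conv by (intro rec_intros assms)

text \<open>\<open>list_encode\<close> maps x # xs to the successor of a pair code, hence the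
  decrement before every unpairing.\<close>

definition list_entry :: "nat \<Rightarrow> nat \<Rightarrow> nat" where
  "list_entry q c = pfst (((\<lambda>c. psnd (c - 1)) ^^ q) c - 1)"

lemma list_entry_list_encode: "q < length xs \<Longrightarrow> list_entry q (list_encode xs) = xs ! q"
  unfolding list_entry_def
proof (induction q arbitrary: xs)
  case 0
  then show ?case by (cases xs) auto
next
  case (Suc q)
  then show ?case by (cases xs) (auto simp: funpow_swap1 simp del: funpow.simps(2) One_nat_def intro!: Suc.IH simp: funpow_Suc_right)
qed

lemma recursive_in_list_entry [rec_intros]:
  assumes "recursive_in \<Omega> f"
  shows "recursive_in \<Omega> (\<lambda>x. list_entry q (f x))"
proof -
  have "recursive_in \<Omega> (\<lambda>x. ((\<lambda>c. psnd (c - 1)) ^^ q) (f x))"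
    by (induction q) (auto intro!: rec_intros assms)
  then show ?thesis unfolding list_entry_def by (intro rec_intros)
qed

lemma recursive_in_list_encode:
  assumes "\<And>i. i \<in> set is \<Longrightarrow> recursive_in \<Omega> (f i)"
  shows "recursive_in \<Omega> (\<lambda>x. list_encode (map (\<lambda>i. f i x) is))"
  using assms by (induction "is") (auto intro!: rec_intros)

definition vec_encode :: "nat \<Rightarrow> (nat \<Rightarrow> int) \<Rightarrow> nat" where
  "vec_encode n z = list_encode (map (\<lambda>q. int_encode (z q)) [0..<n])"

definition vec_decode :: "nat \<Rightarrow> nat \<Rightarrow> int" where
  "vec_decode c q = int_decode (list_entry q c)"

lemma vec_decode_encode: "q < n \<Longrightarrow> vec_decode (vec_encode n z) q = z q"
  by (simp add: vec_decode_def vec_encode_def list_entry_list_encode)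

lemma recursive_int_in_vec_decode [rec_intros]:
  "recursive_in \<Omega> f \<Longrightarrow> recursive_int_in \<Omega> (\<lambda>x. vec_decode (f x) q)"
  unfolding vec_decode_def by (intro rec_intros)

lemma recursive_in_vec_encode [rec_intros]:
  assumes "\<And>q. q < n \<Longrightarrow> recursive_int_in \<Omega> (\<lambda>x. z x q)"
  shows "recursive_in \<Omega> (\<lambda>x. vec_encode n (z x))"
  unfolding vec_encode_def by (rule recursive_in_list_encode) (auto intro!: rec_intros assms)

text \<open>Abstract form of the discretized best-response iteration. The number l counts the
  remaining levels, a node x has the B successors \<open>c x s\<close>, and its bit is 1 if the
  weighted bits of the successors reach the threshold. At height 0 every bit is 0: all peers play
  safe.\<close>

fun tree_bit :: "(nat \<Rightarrow> nat) \<Rightarrow> (nat \<Rightarrow> nat) \<Rightarrow> (nat \<Rightarrow> nat \<Rightarrow> nat) \<Rightarrow> nat \<Rightarrow> nat \<Rightarrow> nat \<Rightarrow> nat" where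
  "tree_bit thr wt c B 0 x = 0"
| "tree_bit thr wt c B (Suc l) x
     = (if thr x \<le> (\<Sum>s<B. wt s * tree_bit thr wt c B l (c x s)) then 1 else 0)"

lemma tree_bit_le: "tree_bit thr wt c B l x \<le> 1"
  by (cases l) auto

lemma binary_digit:
  fixes d :: "nat \<Rightarrow> nat"
  assumes "\<And>i. d i \<le> 1" "q < N"
  shows "(\<Sum>p<N. 2 ^ p * d p) div 2 ^ q mod 2 = d q"
  using assms
proof (induction q arbitrary: N d)
  case 0
  then obtain N' where "N = Suc N'" by (cases N) auto
  then have "(\<Sum>p<N. 2 ^ p * d p) = d 0 + 2 * (\<Sum>p<N'. 2 ^ p * d (Suc p))"
    by (simp only: sum.lessThan_Suc_shift) (simp add: sum_distrib_left mult.assoc)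
  then show ?case using 0(1)[of 0] by simp
next
  case (Suc q)
  then obtain N' where N': "N = Suc N'" by (cases N) auto
  then have eq: "(\<Sum>p<N. 2 ^ p * d p) = d 0 + 2 * (\<Sum>p<N'. 2 ^ p * d (Suc p))"
    by (simp only: sum.lessThan_Suc_shift) (simp add: sum_distrib_left mult.assoc)
  have "(\<Sum>p<N. 2 ^ p * d p) div 2 = (\<Sum>p<N'. 2 ^ p * d (Suc p))"
    unfolding eq using Suc.prems(1)[of 0] by simp
  then have "(\<Sum>p<N. 2 ^ p * d p) div 2 ^ Suc q = (\<Sum>p<N'. 2 ^ p * d (Suc p)) div 2 ^ q"
    by (simp add: div_mult2_eq)
  then show ?case using Suc.IH[of "\<lambda>i. d (Suc i)" N'] Suc.prems N' by simp
qed

lemma add_mult_power_less: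
  fixes p s B d :: nat
  assumes "p < B ^ d" "s < B"
  shows "p + s * B ^ d < B ^ Suc d"
proof -
  have "p + s * B ^ d < Suc s * B ^ d" using assms by simp
  also have "\<dots> \<le> B * B ^ d" using assms by (intro mult_right_mono) auto
  finally show ?thesis by simp
qed

lemma top_digit:
  fixes p s B d :: nat
  assumes "p < B ^ d" "s < B"
  shows "(p + s * B ^ d) div B ^ d mod B = s"
  using assms by (cases "B = 0") auto

lemma low_digit:
  fixes p s B d t :: nat
  assumes "t < d"
  shows "(p + s * B ^ d) div B ^ t mod B = p div B ^ t mod B"
proof (cases "B = 0")
  case False
  define e where "e = d - Suc t"
  have d: "d = Suc e + t" using assms by (simp add: e_def)
  have "p + s * B ^ d = p + B ^ t * (s * B ^ e * B)" by (simp add: d power_add ac_simps)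
  then have "(p + s * B ^ d) div B ^ t = p div B ^ t + s * B ^ e * B"
    using False by (simp only: div_mult_self2 power_not_zero) simp
  then show ?thesis by simp
qed (use assms in \<open>cases t; cases d; auto\<close>)

text \<open>A path of length d below the root is coded by its base-B digits, the first step being the
  lowest digit; the bits of all nodes at one depth are stored as the binary digits of one number.\<close>

lemma recursive_in_tree_bit:
  assumes thr: "recursive_in \<Omega> (\<lambda>x. thr (pfst x) (psnd x))"
    and wt: "recursive_in \<Omega> (\<lambda>x. wt (pfst x) (psnd x))"
    and c: "recursive_in \<Omega> (\<lambda>x. c (pfst x) (pfst (psnd x)) (psnd (psnd x)))"
    and B: "recursive_in \<Omega> B" and l: "recursive_in \<Omega> l" and x: "recursive_in \<Omega> x"
  shows "recursive_in \<Omega> (\<lambda>y. tree_bit (thr y) (wt y) (c y) (B y) (l y) (x y))"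
proof -
  define node where "node y d p = rec_nat (x y) (\<lambda>t r. c y r (p div B y ^ t mod B y)) d" for y d p
  \<comment> \<open>With d = l - Suc j, the number r holds the bits of height j for all nodes at
    depth Suc d. Successor s of node p has index p + s * B ^ d in that row, and the step computes
    the row at depth d from it.\<close>
  define step where "step y j r = (\<Sum>p<B y ^ (l y - Suc j). 2 ^ p *
      (if thr y (node y (l y - Suc j) p)
          \<le> (\<Sum>s<B y. wt y s * (r div 2 ^ (p + s * B y ^ (l y - Suc j)) mod 2)) then 1 else 0::nat))" for y j r
  define table where "table y j = rec_nat 0 (step y) j" for y j
  note comps = recursive_in_app2[OF thr] recursive_in_app2[OF wt] recursive_in_app3[OF c]
    composition[OF B] composition[OF l] composition[OF x]
  have node: "recursive_in \<Omega> (\<lambda>x. node (pfst x) (pfst (psnd x)) (psnd (psnd x)))"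
    unfolding node_def by (intro rec_intros comps)
  have "recursive_in \<Omega> (\<lambda>y. table y (l y))"
    unfolding table_def step_def
    by (intro rec_intros comps recursive_in_app3[OF node] l)
  moreover have "table y (l y) = tree_bit (thr y) (wt y) (c y) (B y) (l y) (x y)" for y
  proof -
    define bit where "bit = tree_bit (thr y) (wt y) (c y) (B y)"
    have node_Suc: "node y (Suc d) (p + s * B y ^ d) = c y (node y d p) s"
      if "p < B y ^ d" "s < B y" for d p s
    proof -
      have "node y t (p + s * B y ^ d) = node y t p" if "t \<le> d" for t
        using that by (induction t) (auto simp: node_def low_digit)
      from this[of d] show ?thesis using that by (simp add: node_def top_digit)
    qed
    have "table y j = (\<Sum>p<B y ^ (l y - j). 2 ^ p * bit j (node y (l y - j) p))" if "j \<le> l y" for j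
      using that
    proof (induction j)
      case 0
      then show ?case by (simp add: table_def bit_def)
    next
      case (Suc j)
      define d where "d = l y - Suc j"
      have d: "l y - j = Suc d" using Suc.prems by (auto simp: d_def)
      have IH: "table y j = (\<Sum>p<B y ^ Suc d. 2 ^ p * bit j (node y (Suc d) p))"
        using Suc by (simp add: d)
      have dig: "table y j div 2 ^ (p + s * B y ^ d) mod 2 = bit j (c y (node y d p) s)"
        if "p < B y ^ d" "s < B y" for p s
        unfolding IH by (subst binary_digit[OF _ add_mult_power_less[OF that]])
          (auto simp: node_Suc[OF that] bit_def tree_bit_le simp del: One_nat_def)
      have "table y (Suc j) = step y j (table y j)" by (simp add: table_def)
      also have "\<dots> = (\<Sum>p<B y ^ d. 2 ^ p * bit (Suc j) (node y d p))"
        unfolding step_def d_def[symmetric]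
        by (intro sum.cong refl) (simp add: dig bit_def)
      finally show ?case by (simp add: d_def)
    qed
    from this[of "l y"] show ?thesis by (simp add: bit_def node_def)
  qed
  ultimately show ?thesis by simp
qed

section \<open>Computable reals\<close>

text \<open>Reals are represented by almost homomorphisms: a function f with f k = k r + O(1). In this
  form a product is a composition, and multiplication of a large integer by r incurs only a bounded
  absolute error.\<close>

definition approximates :: "(nat \<Rightarrow> nat) \<Rightarrow> real \<Rightarrow> bool" where
  "approximates f r \<longleftrightarrow> (\<exists>C. \<forall>k. \<bar>real (f k) - real k * r\<bar> \<le> C)"

definition computable_real :: "(nat \<Rightarrow> nat) set \<Rightarrow> real \<Rightarrow> bool" where
  "computable_real \<Omega> r \<longleftrightarrow> (\<exists>f. recursive_in \<Omega> f \<and> approximates f r)"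

lemma approximatesI: "(\<And>k. \<bar>real (f k) - real k * r\<bar> \<le> C) \<Longrightarrow> approximates f r"
  by (auto simp: approximates_def)

lemma computable_real_add:
  assumes "computable_real \<Omega> r" "computable_real \<Omega> r'"
  shows "computable_real \<Omega> (r + r')"
proof -
  from assms obtain f g C D where f: "recursive_in \<Omega> f" "\<And>k. \<bar>real (f k) - real k * r\<bar> \<le> C"
    and g: "recursive_in \<Omega> g" "\<And>k. \<bar>real (g k) - real k * r'\<bar> \<le> D"
    unfolding computable_real_def approximates_def by metis
  have "\<bar>real (f k + g k) - real k * (r + r')\<bar> \<le> C + D" for k
    using f(2)[of k] g(2)[of k] by (simp add: algebra_simps abs_le_iff)
  then show ?thesis unfolding computable_real_def
    by (intro exI[of _ "\<lambda>k. f k + g k"] conjI recursive_in_add f(1) g(1) approximatesI)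
qed

lemma computable_real_mult:
  assumes "computable_real \<Omega> r" "computable_real \<Omega> r'"
  shows "computable_real \<Omega> (r * r')"
proof -
  from assms obtain f g C D where f: "recursive_in \<Omega> f" "\<And>k. \<bar>real (f k) - real k * r\<bar> \<le> C"
    and g: "recursive_in \<Omega> g" "\<And>k. \<bar>real (g k) - real k * r'\<bar> \<le> D"
    unfolding computable_real_def approximates_def by metis
  have "\<bar>real (f (g k)) - real k * (r * r')\<bar> \<le> C + D * \<bar>r\<bar>" for k
  proof -
    have "\<bar>real (g k) * r - real k * r' * r\<bar> \<le> D * \<bar>r\<bar>"
      using mult_right_mono[OF g(2)[of k], of "\<bar>r\<bar>"]
      by (simp add: abs_mult[symmetric] left_diff_distrib)
    then show ?thesis using f(2)[of "g k"] by (simp add: ac_simps abs_le_iff)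
  qed
  then show ?thesis unfolding computable_real_def
    using composition[OF f(1) g(1)] by (intro exI[of _ "\<lambda>k. f (g k)"] conjI approximatesI)
qed

text \<open>The approximation of 1 / r is a quasi-inverse of f: the least m with k \<le> f m. The
  search succeeds because f m grows like m * r, and minimality gives f (m - 1) < k, hence the upper
  bound.\<close>

lemma computable_real_inverse:
  assumes "computable_real \<Omega> r" "0 < r"
  shows "computable_real \<Omega> (1 / r)"
proof -
  from assms obtain f C where f: "recursive_in \<Omega> f" "\<And>k. \<bar>real (f k) - real k * r\<bar> \<le> C"
    unfolding computable_real_def approximates_def by metis
  define g where "g k = (LEAST m. k - f m = 0)" for k
  have ex: "\<exists>m. k - f m = 0" for k
  proof -
    obtain m :: nat where "(real k + C) / r < real m" using reals_Archimedean2 by blast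
    then have "real k + C < real m * r" using assms(2) by (simp add: field_simps)
    then have "real k \<le> real (f m)" using f(2)[of m] by linarith
    then show ?thesis by auto
  qed
  have g: "recursive_in \<Omega> g"
    unfolding g_def by (intro rec_intros composition[OF f(1)] ex)
  have "\<bar>real (g k) - real k * (1 / r)\<bar> \<le> C / r + 1" for k
  proof -
    have "k - f (g k) = 0" unfolding g_def using ex by (rule LeastI_ex)
    then have lo: "real k \<le> real (g k) * r + C" using f(2)[of "g k"] by (simp add: abs_le_iff)
    have hi: "(real (g k) - 1) * r \<le> real k + C"
    proof (cases "g k")
      case 0
      have "0 \<le> C" using f(2)[of 0] by linarith
      then show ?thesis using 0 assms(2) by simp
    next
      case (Suc m)
      then have "k - f m \<noteq> 0" using not_less_Least[of m "\<lambda>m. k - f m = 0"] by (simp add: g_def)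
      then have "real (f m) \<le> real k" by simp
      then show ?thesis using f(2)[of m] Suc by (simp add: abs_le_iff)
    qed
    show ?thesis using lo hi assms(2) by (simp add: abs_le_iff field_simps)
  qed
  then show ?thesis unfolding computable_real_def by (intro exI[of _ g] conjI g approximatesI)
qed

lemma computable_real_divide:
  assumes "computable_real \<Omega> r" "computable_real \<Omega> r'" "0 < r'"
  shows "computable_real \<Omega> (r / r')"
  using computable_real_mult[OF assms(1) computable_real_inverse[OF assms(2,3)]] by simp

text \<open>The value f (k * k) approximates the square of k * sqrt r with a bounded error C. Its
  integer square root is therefore off by at most sqrt C, plus 1 for rounding up.\<close>

lemma computable_real_sqrt:
  assumes "computable_real \<Omega> r" "0 \<le> r"
  shows "computable_real \<Omega> (sqrt r)"
proof -
  from assms obtain f C where f: "recursive_in \<Omega> f" "\<And>k. \<bar>real (f k) - real k * r\<bar> \<le> C"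
    unfolding computable_real_def approximates_def by metis
  define g where "g k = (LEAST m. f (k * k) - m * m = 0)" for k
  have ex: "\<exists>m. f (k * k) - m * m = 0" for k
    by (rule exI[of _ "f (k * k)"]) simp
  have g: "recursive_in \<Omega> g"
    unfolding g_def by (intro rec_intros composition[OF f(1)] ex)
  have C: "0 \<le> C" using f(2)[of 0] by linarith
  have "\<bar>real (g k) - real k * sqrt r\<bar> \<le> sqrt C + 1" for k
  proof -
    have sq: "(real k * sqrt r)\<^sup>2 = real (k * k) * r"
      using assms(2) by (simp add: power_mult_distrib power2_eq_square)
    have "f (k * k) - g k * g k = 0" unfolding g_def using ex by (rule LeastI_ex)
    then have "real (f (k * k)) \<le> real (g k * g k)"
      by (metis diff_is_0_eq of_nat_mono)
    then have "(real k * sqrt r)\<^sup>2 \<le> (real (g k))\<^sup>2 + C"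
      using f(2)[of "k * k"] unfolding sq by (simp add: abs_le_iff power2_eq_square)
    also have "\<dots> \<le> (real (g k) + sqrt C)\<^sup>2" using C by (simp add: power2_sum)
    finally have lo: "real k * sqrt r \<le> real (g k) + sqrt C"
      using C by (intro power2_le_imp_le[OF _ add_nonneg_nonneg]) auto
    have hi: "real (g k) - 1 \<le> real k * sqrt r + sqrt C"
    proof (cases "g k")
      case 0
      have "0 \<le> real k * sqrt r + sqrt C" using C assms(2) by simp
      then show ?thesis using 0 by simp
    next
      case (Suc m)
      then have "f (k * k) - m * m \<noteq> 0"
        using not_less_Least[of m "\<lambda>m. f (k * k) - m * m = 0"] by (simp add: g_def)
      then have "real (m * m) \<le> real (f (k * k))" by linarith
      then have "(real m)\<^sup>2 \<le> (real k * sqrt r)\<^sup>2 + C"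
        using f(2)[of "k * k"] unfolding sq by (simp add: abs_le_iff power2_eq_square)
      also have "\<dots> \<le> (real k * sqrt r + sqrt C)\<^sup>2" using C assms(2) by (simp add: power2_sum)
      finally have "real m \<le> real k * sqrt r + sqrt C"
        using C assms(2) by (intro power2_le_imp_le[OF _ add_nonneg_nonneg]) auto
      then show ?thesis using Suc by simp
    qed
    show ?thesis using lo hi C by (simp add: abs_le_iff)
  qed
  then show ?thesis unfolding computable_real_def by (intro exI[of _ g] conjI g approximatesI)
qed

text \<open>At argument k it suffices to read k binary places: the truncation error 1 / 2 ^ k is
  multiplied by k, and k \<le> 2 ^ k.\<close>

lemma computable_real_binary_oracle:
  assumes "binary_oracle r \<in> \<Omega>" "0 < r"
  shows "computable_real \<Omega> r"
proof -
  define f where "f k = k * binary_oracle r k div 2 ^ k" for k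
  have "recursive_in \<Omega> f"
    unfolding f_def by (intro rec_intros oracle_fun assms)
  moreover have "\<bar>real (f k) - real k * r\<bar> \<le> 2" for k
  proof -
    have "real (binary_oracle r k) = of_int \<lfloor>2 ^ k * r\<rfloor>"
      using assms(2) by (simp add: binary_oracle_def)
    then have o: "real (binary_oracle r k) \<le> 2 ^ k * r" "2 ^ k * r - 1 \<le> real (binary_oracle r k)"
      by linarith+
    have "real k * real (binary_oracle r k) \<le> real k * (2 ^ k * r)"
      "real k * (2 ^ k * r - 1) \<le> real k * real (binary_oracle r k)"
      using o by (auto intro: mult_left_mono)
    moreover have "real k \<le> 2 ^ k" using of_nat_less_two_power[of k, where 'a = real] by simp
    ultimately have q0: "real k * real (binary_oracle r k) \<le> real k * r * 2 ^ k"
      "(real k * r - 1) * 2 ^ k \<le> real k * real (binary_oracle r k)"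
      unfolding right_diff_distrib left_diff_distrib mult_1_right mult_1_left mult.assoc
        mult.commute[of r "2 ^ k"] by linarith+
    then have q: "real (k * binary_oracle r k) / 2 ^ k \<le> real k * r"
      "real k * r - 1 \<le> real (k * binary_oracle r k) / 2 ^ k"
      by (simp_all add: pos_divide_le_eq pos_le_divide_eq)
    have "real (f k) = of_int \<lfloor>real (k * binary_oracle r k) / real (2 ^ k)\<rfloor>"
      unfolding f_def floor_divide_of_nat_eq by simp
    then have "real (f k) \<le> real (k * binary_oracle r k) / 2 ^ k"
      "real (k * binary_oracle r k) / 2 ^ k - 1 \<le> real (f k)"
      by simp_all
    then show ?thesis using q by (simp add: abs_le_iff)
  qed
  ultimately show ?thesis unfolding computable_real_def by (intro exI[of _ f] conjI approximatesI)
qed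

definition odd_extension :: "(nat \<Rightarrow> nat) \<Rightarrow> int \<Rightarrow> int" where
  "odd_extension f z = (if 0 \<le> z then int (f (nat z)) else - int (f (nat (- z))))"

lemma odd_extension_approximates:
  assumes "approximates f r"
  obtains C where "\<And>z. \<bar>of_int (odd_extension f z) - of_int z * r\<bar> \<le> C"
proof -
  from assms obtain C where C: "\<And>k. \<bar>real (f k) - real k * r\<bar> \<le> C" by (auto simp: approximates_def)
  have "\<bar>of_int (odd_extension f z) - of_int z * r\<bar> \<le> C" for z
    using C[of "nat z"] C[of "nat (- z)"] by (auto simp: odd_extension_def abs_le_iff)
  then show thesis by (rule that)
qed

lemma recursive_int_in_odd_extension [rec_intros]:
  assumes "recursive_in \<Omega> f" "recursive_int_in \<Omega> z"
  shows "recursive_int_in \<Omega> (\<lambda>x. odd_extension f (z x))"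
  unfolding odd_extension_def by (intro rec_intros composition[OF assms(1)] assms(2))

section \<open>The posterior as an affine image of Gaussian white noise\<close>

lemma sets_PiM_lborel [measurable_cong]: "sets (PiM I (\<lambda>_. lborel)) = sets (PiM I (\<lambda>_. borel))"
  by (intro sets_PiM_cong) auto

abbreviation std_normal :: "real measure" where
  "std_normal \<equiv> density lborel (\<lambda>x. ennreal (std_normal_density x))"

definition std_noise :: "'i set \<Rightarrow> ('i \<Rightarrow> real) measure" where
  "std_noise I = PiM I (\<lambda>_. std_normal)"

lemma sets_std_noise [measurable_cong]: "sets (std_noise I) = sets (PiM I (\<lambda>_. borel))"
  unfolding std_noise_def by (intro sets_PiM_cong) auto

lemma space_std_noise [simp]: "space (std_noise I) = PiE I (\<lambda>_. UNIV)"
  by (simp add: std_noise_def space_PiM)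

lemma prob_space_std_normal: "prob_space std_normal"
  by (rule prob_space_normal_density) simp

lemma prob_space_std_noise: "prob_space (std_noise I)"
  unfolding std_noise_def by (intro prob_space_PiM prob_space_std_normal)

text \<open>The coordinates are independent and identically distributed, so every injective
  selection of them is again white noise. This serves to rename hidden quantities, to add a dummy
  coordinate and to permute peers.\<close>

lemma integral_std_noise_reindex:
  fixes g :: "('i \<Rightarrow> real) \<Rightarrow> real"
  assumes "inj_on f I" "f \<in> I \<rightarrow> K" and [measurable]: "g \<in> borel_measurable (PiM I (\<lambda>_. borel))"
  shows "(\<integral>\<omega>. g (\<lambda>k\<in>I. \<omega> (f k)) \<partial>std_noise K) = (\<integral>\<omega>. g \<omega> \<partial>std_noise I)"
proof -
  have [measurable]: "(\<lambda>\<omega>. \<lambda>k\<in>I. \<omega> (f k)) \<in> std_noise K \<rightarrow>\<^sub>M std_noise I"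
    using assms(2) by (auto intro!: measurable_restrict simp: std_noise_def Pi_iff)
  have "distr (std_noise K) (std_noise I) (\<lambda>\<omega>. \<lambda>k\<in>I. \<omega> (f k)) = std_noise I"
    unfolding std_noise_def by (rule distr_PiM_reindex) (use assms prob_space_std_normal in auto)
  moreover have "(\<integral>\<omega>. g \<omega> \<partial>distr (std_noise K) (std_noise I) (\<lambda>\<omega>. \<lambda>k\<in>I. \<omega> (f k)))
      = (\<integral>\<omega>. g (\<lambda>k\<in>I. \<omega> (f k)) \<partial>std_noise K)"
    by (rule integral_distr) measurable
  ultimately show ?thesis by simp
qed

lemma integral_std_noise_component:
  assumes "k \<in> I"
  shows "integrable (std_noise I) (\<lambda>e. e k)" "(\<integral>e. e k \<partial>std_noise I) = 0"
proof -
  have D: "distr (std_noise I) std_normal (\<lambda>\<omega>. \<omega> k) = std_normal"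
    unfolding std_noise_def by (rule distr_PiM_component) (use assms prob_space_std_normal in auto)
  have [measurable]: "(\<lambda>\<omega>. \<omega> k) \<in> std_noise I \<rightarrow>\<^sub>M std_normal"
    unfolding std_noise_def using assms by (intro measurable_component_singleton)
  have i: "integrable std_normal (\<lambda>x. x)" "(\<integral>x. x \<partial>std_normal) = 0"
    using integrable_normal_moment_nz_1[of 1 0] integral_normal_moment_nz_1[of 1 0]
    by (simp_all add: integrable_density integral_density)
  have "integrable (distr (std_noise I) std_normal (\<lambda>\<omega>. \<omega> k)) (\<lambda>x. x)"
    unfolding D by (rule i)
  then show "integrable (std_noise I) (\<lambda>e. e k)" by (rule integrable_distr[rotated]) fact
  have "(\<integral>e. e k \<partial>std_noise I) = (\<integral>x. x \<partial>distr (std_noise I) std_normal (\<lambda>\<omega>. \<omega> k))"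
    by (rule integral_distr[symmetric], fact) simp
  also have "\<dots> = 0" unfolding D by (rule i)
  finally show "(\<integral>e. e k \<partial>std_noise I) = 0" .
qed

lemma nn_integral_normal_density_affine:
  assumes [measurable]: "g \<in> borel_measurable borel" and "0 < s"
  shows "(\<integral>\<^sup>+y. g y * ennreal (normal_density m s y) \<partial>lborel) = (\<integral>\<^sup>+x. g (m + s * x) \<partial>std_normal)"
proof -
  have "(\<integral>\<^sup>+y. g y * ennreal (normal_density m s y) \<partial>lborel)
      = ennreal \<bar>s\<bar> * (\<integral>\<^sup>+x. g (m + s * x) * ennreal (normal_density m s (m + s * x)) \<partial>lborel)"
    using assms by (intro nn_integral_real_affine) auto
  also have "\<dots> = (\<integral>\<^sup>+x. ennreal \<bar>s\<bar> * (g (m + s * x) * ennreal (normal_density m s (m + s * x))) \<partial>lborel)"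
    by (rule nn_integral_cmult[symmetric]) measurable
  also have "\<dots> = (\<integral>\<^sup>+x. ennreal (std_normal_density x) * g (m + s * x) \<partial>lborel)"
  proof (intro nn_integral_cong)
    fix x
    have "\<bar>s\<bar> * normal_density m s (m + s * x) = std_normal_density x"
      using assms(2) by (simp add: normal_density_def std_normal_density_def real_sqrt_mult power_mult_distrib)
    then have "ennreal \<bar>s\<bar> * ennreal (normal_density m s (m + s * x)) = ennreal (std_normal_density x)"
      by (simp flip: ennreal_mult)
    then show "ennreal \<bar>s\<bar> * (g (m + s * x) * ennreal (normal_density m s (m + s * x)))
        = ennreal (std_normal_density x) * g (m + s * x)"
      by (metis mult.assoc mult.commute)
  qed
  also have "\<dots> = (\<integral>\<^sup>+x. g (m + s * x) \<partial>std_normal)"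
    by (rule nn_integral_density[symmetric]) measurable
  finally show ?thesis .
qed

text \<open>Conditional means without cyclic dependence: the head of the list is generated last, and
  its mean is a function of the tail alone.\<close>

fun triangular :: "('i \<Rightarrow> ('i \<Rightarrow> real) \<Rightarrow> real) \<Rightarrow> 'i list \<Rightarrow> bool" where
  "triangular \<mu> [] \<longleftrightarrow> True"
| "triangular \<mu> (k # ks) \<longleftrightarrow> \<mu> k \<in> borel_measurable (PiM (set ks) (\<lambda>_. borel)) \<and>
     (\<forall>w w'. (\<forall>k'\<in>set ks. w k' = w' k') \<longrightarrow> \<mu> k w = \<mu> k w') \<and> triangular \<mu> ks"

text \<open>Generates the quantities from white noise, starting at the end of the list. The start
  value \<open>\<lambda>_. undefined\<close> is the only point of the empty product, so the result
  is extensional over \<open>set ks\<close>.\<close>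

fun affine_noise :: "('i \<Rightarrow> ('i \<Rightarrow> real) \<Rightarrow> real) \<Rightarrow> ('i \<Rightarrow> real) \<Rightarrow> 'i list \<Rightarrow> ('i \<Rightarrow> real) \<Rightarrow> 'i \<Rightarrow> real" where
  "affine_noise \<mu> s [] e = (\<lambda>_. undefined)"
| "affine_noise \<mu> s (k # ks) e =
     (affine_noise \<mu> s ks e)(k := \<mu> k (affine_noise \<mu> s ks e) + s k * e k)"

lemma affine_noise_cong:
  "(\<And>k. k \<in> set ks \<Longrightarrow> e k = e' k) \<Longrightarrow> affine_noise \<mu> s ks e = affine_noise \<mu> s ks e'"
  by (induction ks) auto

lemma measurable_affine_noise:
  assumes "triangular \<mu> ks"
  shows "affine_noise \<mu> s ks \<in> PiM (set ks) (\<lambda>_. borel) \<rightarrow>\<^sub>M PiM (set ks) (\<lambda>_. borel)"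
  using assms
proof (induction ks)
  case Nil
  have "affine_noise \<mu> s [] = (\<lambda>e _. undefined)" by auto
  then show ?case by (auto simp: space_PiM intro!: measurable_const)
next
  case (Cons k ks)
  have res: "(\<lambda>e. restrict e (set ks)) \<in> PiM (set (k # ks)) (\<lambda>_. borel) \<rightarrow>\<^sub>M PiM (set ks) (\<lambda>_. borel)"
    by (rule measurable_restrict_subset) auto
  have "(\<lambda>e. affine_noise \<mu> s ks (restrict e (set ks)))
      \<in> PiM (set (k # ks)) (\<lambda>_. borel) \<rightarrow>\<^sub>M PiM (set ks) (\<lambda>_. borel)"
    by (intro measurable_compose[OF res] Cons.IH) (use Cons.prems in simp)
  also have "(\<lambda>e. affine_noise \<mu> s ks (restrict e (set ks))) = affine_noise \<mu> s ks"
    by (intro ext affine_noise_cong) auto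
  finally have aff: "affine_noise \<mu> s ks \<in> PiM (insert k (set ks)) (\<lambda>_. borel) \<rightarrow>\<^sub>M PiM (set ks) (\<lambda>_. borel)"
    by simp
  have "\<mu> k \<in> borel_measurable (PiM (set ks) (\<lambda>_. borel))" using Cons.prems by simp
  from measurable_compose[OF aff this]
  have [measurable]: "(\<lambda>e. \<mu> k (affine_noise \<mu> s ks e)) \<in> borel_measurable (PiM (insert k (set ks)) (\<lambda>_. borel))" .
  have "(\<lambda>e. (affine_noise \<mu> s ks e)(k := \<mu> k (affine_noise \<mu> s ks e) + s k * e k))
      \<in> PiM (insert k (set ks)) (\<lambda>_. borel) \<rightarrow>\<^sub>M PiM (insert k (set ks)) (\<lambda>_. borel)"
    by (rule measurable_fun_upd[where J = "set ks", OF _ aff]) auto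
  moreover have "affine_noise \<mu> s (k # ks) = (\<lambda>e. (affine_noise \<mu> s ks e)(k := \<mu> k (affine_noise \<mu> s ks e) + s k * e k))"
    by (rule ext) (simp only: affine_noise.simps)
  ultimately show ?case by (simp only: list.set)
qed

text \<open>Quantities generated after k do not enter the mean of k, so the equation by which k was
  generated still holds for the complete vector. Later formulas for the hidden quantities thus do
  not mention the order of the list.\<close>

lemma affine_noise_fixpoint:
  assumes "triangular \<mu> ks" "distinct ks" "k \<in> set ks"
  shows "affine_noise \<mu> s ks e k = \<mu> k (affine_noise \<mu> s ks e) + s k * e k"
  using assms
proof (induction ks)
  case (Cons k' ks)
  have indep: "\<mu> k'' ((affine_noise \<mu> s ks e)(k' := x)) = \<mu> k'' (affine_noise \<mu> s ks e)"
    if "k'' \<in> set (k' # ks)" for k'' x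
    using Cons.prems(1,2) that
  proof -
    \<comment> \<open>A mean ignores its own coordinate, too. This covers the case in which k'' is
      the coordinate k' that is being overwritten.\<close>
    have "triangular \<mu> xs \<Longrightarrow> k'' \<in> set xs \<Longrightarrow> (\<forall>k\<in>set xs - {k''}. w k = w' k) \<Longrightarrow>
        distinct xs \<Longrightarrow> \<mu> k'' w = \<mu> k'' w'" for xs w w'
    proof (induction xs)
      case (Cons y ys)
      show ?case
      proof (cases "k'' = y")
        case True
        then have "\<forall>k\<in>set ys. w k = w' k" using Cons.prems by auto
        then show ?thesis using Cons.prems(1) True by auto
      next
        case False
        then show ?thesis using Cons by auto
      qed
    qed simp
    note dep = this
    show ?thesis
    proof (cases "k'' = k'")
      case True
      then show ?thesis using Cons.prems(1,2) by (intro dep[of "k' # ks"]) auto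
    next
      case False
      then show ?thesis using Cons.prems(1,2) that by (intro dep[of ks]) auto
    qed
  qed
  show ?case
  proof (cases "k = k'")
    case True
    then show ?thesis using indep[of k'] by (simp del: fun_upd_apply add: fun_upd_same)
  next
    case False
    then have "affine_noise \<mu> s ks e k = \<mu> k (affine_noise \<mu> s ks e) + s k * e k" "k \<in> set ks"
      using Cons by auto
    then show ?thesis using indep[of k] False by (simp del: fun_upd_apply add: fun_upd_other)
  qed
qed simp

lemma triangular_cong:
  assumes "triangular \<mu> ks" "k \<in> set ks" "\<forall>k'\<in>set ks. w k' = w' k'"
  shows "\<mu> k w = \<mu> k w'"
  using assms
proof (induction ks)
  case (Cons y ys)
  then show ?case by (cases "k = y") auto
qed simp

lemma measurable_triangular_mean:
  assumes "triangular \<mu> (k # ks)"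
  shows "\<mu> k \<in> borel_measurable (PiM (insert k (set ks)) (\<lambda>_. borel))"
proof -
  have res: "(\<lambda>e. restrict e (set ks)) \<in> PiM (insert k (set ks)) (\<lambda>_. borel) \<rightarrow>\<^sub>M PiM (set ks) (\<lambda>_. borel)"
    by (rule measurable_restrict_subset) auto
  have "(\<lambda>w. \<mu> k (restrict w (set ks))) \<in> borel_measurable (PiM (insert k (set ks)) (\<lambda>_. borel))"
    using assms by (intro measurable_compose[OF res]) simp
  moreover have "\<mu> k w = \<mu> k (restrict w (set ks))" for w
    using assms unfolding triangular.simps by (elim conjE allE[of _ w] allE[of _ "restrict w (set ks)"]) simp
  ultimately show ?thesis by (simp cong: measurable_cong_simp del: restrict_apply)
qed

lemma measurable_triangular_density:
  assumes "triangular \<mu> ks" "distinct ks"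
  shows "(\<lambda>w. \<Prod>k\<in>set ks. normal_density (\<mu> k w) (s k) (w k)) \<in> borel_measurable (PiM (set ks) (\<lambda>_. borel))"
  using assms
proof (induction ks)
  case (Cons k ks)
  let ?d = "\<lambda>w. \<Prod>k\<in>set ks. normal_density (\<mu> k w) (s k) (w k)"
  have res: "(\<lambda>e. restrict e (set ks)) \<in> PiM (insert k (set ks)) (\<lambda>_. borel) \<rightarrow>\<^sub>M PiM (set ks) (\<lambda>_. borel)"
    by (rule measurable_restrict_subset) auto
  have [measurable]: "\<mu> k \<in> borel_measurable (PiM (insert k (set ks)) (\<lambda>_. borel))"
    using Cons.prems by (rule_tac measurable_triangular_mean) simp
  have "(\<lambda>w. ?d (restrict w (set ks))) \<in> borel_measurable (PiM (insert k (set ks)) (\<lambda>_. borel))"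
    using Cons by (intro measurable_compose[OF res]) simp
  moreover have "?d (restrict w (set ks)) = ?d w" for w
    using Cons.prems triangular_cong[of \<mu> ks _ "restrict w (set ks)" w] by (intro prod.cong) auto
  ultimately have "?d \<in> borel_measurable (PiM (insert k (set ks)) (\<lambda>_. borel))" by simp
  moreover have "(\<lambda>w. normal_density (\<mu> k w) (s k) (w k)) \<in> borel_measurable (PiM (insert k (set ks)) (\<lambda>_. borel))"
    unfolding normal_density_def by measurable
  ultimately show ?case using Cons.prems by simp
qed simp

text \<open>The head occurs in no mean, so Tonelli integrates it first; an affine substitution turns
  its density into standard noise, and the tail has the same form.\<close>

lemma nn_integral_triangular:
  assumes "triangular \<mu> ks" "distinct ks" and s: "\<And>k. 0 < s k"
    and "G \<in> borel_measurable (PiM (set ks) (\<lambda>_. borel))"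
  shows "(\<integral>\<^sup>+w. G w * (\<Prod>k\<in>set ks. ennreal (normal_density (\<mu> k w) (s k) (w k))) \<partial>PiM (set ks) (\<lambda>_. lborel))
       = (\<integral>\<^sup>+e. G (affine_noise \<mu> s ks e) \<partial>std_noise (set ks))"
  using assms(1,2,4)
proof (induction ks arbitrary: G)
  case Nil
  then show ?case
    by (simp add: std_noise_def PiM_empty nn_integral_count_space_finite)
next
  case (Cons k ks)
  interpret L: product_sigma_finite "\<lambda>_. lborel" by standard
  interpret P: product_sigma_finite "\<lambda>_. std_normal"
    by (simp add: product_sigma_finite_def prob_space_std_normal prob_space_imp_sigma_finite)
  let ?d = "\<lambda>w. \<Prod>k\<in>set ks. normal_density (\<mu> k w) (s k) (w k)"
  note tri = \<open>triangular \<mu> (k # ks)\<close>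
  have ksprops: "triangular \<mu> ks" "distinct ks" "k \<notin> set ks" "finite (set ks)"
    using Cons.prems by auto
  have [measurable]: "?d \<in> borel_measurable (PiM (set ks) (\<lambda>_. borel))"
    by (rule measurable_triangular_density) (use ksprops in auto)
  have [measurable]: "\<mu> k \<in> borel_measurable (PiM (set ks) (\<lambda>_. borel))"
    using tri by simp
  have indep0: "\<forall>w w'. (\<forall>k'\<in>set ks. w k' = w' k') \<longrightarrow> \<mu> k w = \<mu> k w'"
    using tri unfolding triangular.simps by (elim conjE)
  have dsplit: "(\<Prod>k\<in>set (k # ks). normal_density (\<mu> k w) (s k) (w k))
      = normal_density (\<mu> k w) (s k) (w k) * ?d w" for w
    using ksprops by simp
  have pe: "(\<Prod>k\<in>set (k # ks). ennreal (normal_density (\<mu> k w) (s k) (w k)))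
      = ennreal (normal_density (\<mu> k w) (s k) (w k) * ?d w)" for w
    by (subst prod_ennreal, simp) (simp only: dsplit)
  have [measurable]: "\<mu> k \<in> borel_measurable (PiM (insert k (set ks)) (\<lambda>_. borel))"
    using tri by (rule measurable_triangular_mean)
  have nd [measurable]: "(\<lambda>w. normal_density (\<mu> k w) (s k) (w k)) \<in> borel_measurable (PiM (insert k (set ks)) (\<lambda>_. borel))"
    unfolding normal_density_def by measurable
  have [measurable]: "(\<lambda>w. normal_density (\<mu> k w) (s k) (w k) * ?d w) \<in> borel_measurable (PiM (insert k (set ks)) (\<lambda>_. borel))"
    using measurable_triangular_density[OF Cons.prems(1,2), of s] unfolding dsplit by simp
    have [measurable]: "G \<in> borel_measurable (PiM (insert k (set ks)) (\<lambda>_. borel))" using Cons.prems(3) by simp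
    \<comment> \<open>\<open>?G\<close> is G with the head integrated out. The induction hypothesis
      is applied to it, which is why G is arbitrary in the induction.\<close>
    let ?G = "\<lambda>w. \<integral>\<^sup>+x. G (w(k := \<mu> k w + s k * x)) \<partial>std_normal"
    have mu_upd: "\<mu> k (w(k := y)) = \<mu> k w" for w y 
      by (rule indep0[rule_format]) (use ksprops(3) in auto)
    have d_upd: "?d (w(k := y)) = ?d w" for w y
      using ksprops triangular_cong[of \<mu> ks _ "w(k := y)" w] by (intro prod.cong) auto
    have upd: "(\<lambda>(w, y). w(k := y)) \<in> PiM (set ks) (\<lambda>_. borel) \<Otimes>\<^sub>M borel \<rightarrow>\<^sub>M PiM (insert k (set ks)) (\<lambda>_. borel)"
      using measurable_add_dim[of k "set ks" "\<lambda>_. borel"] by simp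
    have mG [measurable]: "?G \<in> borel_measurable (PiM (set ks) (\<lambda>_. borel))"
    proof -
      have "(\<lambda>(w, x). (w, \<mu> k w + s k * x)) \<in> PiM (set ks) (\<lambda>_. borel) \<Otimes>\<^sub>M borel \<rightarrow>\<^sub>M PiM (set ks) (\<lambda>_. borel) \<Otimes>\<^sub>M borel"
        by measurable
      from measurable_compose[OF measurable_compose[OF this upd]  \<open>G \<in> borel_measurable (PiM (insert k (set ks)) (\<lambda>_. borel))\<close>]
      have [measurable]: "(\<lambda>(w, x). G (w(k := \<mu> k w + s k * x))) \<in> borel_measurable (PiM (set ks) (\<lambda>_. borel) \<Otimes>\<^sub>M borel)"
        by (simp add: case_prod_beta')
      have "sigma_finite_measure std_normal" by (simp add: prob_space_std_normal prob_space_imp_sigma_finite)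
      then show ?thesis
        by (intro sigma_finite_measure.borel_measurable_nn_integral) measurable
    qed
    have "(\<integral>\<^sup>+w. G w * (\<Prod>k\<in>set (k # ks). ennreal (normal_density (\<mu> k w) (s k) (w k))) \<partial>PiM (set (k # ks)) (\<lambda>_. lborel))
        = (\<integral>\<^sup>+w. G w * ennreal (normal_density (\<mu> k w) (s k) (w k) * ?d w) \<partial>PiM (insert k (set ks)) (\<lambda>_. lborel))"
      by (simp only: pe, simp only: list.set)
    also have "\<dots> = (\<integral>\<^sup>+w. \<integral>\<^sup>+y. G (w(k := y)) * ennreal (normal_density (\<mu> k (w(k := y))) (s k) ((w(k := y)) k) * ?d (w(k := y)))
        \<partial>lborel \<partial>PiM (set ks) (\<lambda>_. lborel))"
      by (rule L.product_nn_integral_insert) (use ksprops in \<open>auto\<close>)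
    also have "\<dots> = (\<integral>\<^sup>+w. ?G w * ennreal (?d w) \<partial>PiM (set ks) (\<lambda>_. lborel))"
    proof (intro nn_integral_cong)
      fix w assume w: "w \<in> space (PiM (set ks) (\<lambda>_. lborel :: real measure))"
      have "(\<lambda>y. w(k := y)) \<in> borel \<rightarrow>\<^sub>M PiM (insert k (set ks)) (\<lambda>_. borel)"
        using measurable_component_update[of w "set ks" "\<lambda>_. borel" k] w ksprops by (simp add: space_PiM)
      then have [measurable]: "(\<lambda>y. G (w(k := y))) \<in> borel_measurable borel"
        by (rule measurable_compose) measurable
      have "(\<integral>\<^sup>+y. G (w(k := y)) * ennreal (normal_density (\<mu> k (w(k := y))) (s k) ((w(k := y)) k) * ?d (w(k := y))) \<partial>lborel)
          = (\<integral>\<^sup>+y. G (w(k := y)) * ennreal (normal_density (\<mu> k w) (s k) y) * ennreal (?d w) \<partial>lborel)"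
        by (intro nn_integral_cong) (simp only: mu_upd d_upd, simp add: ennreal_mult prod_nonneg mult.assoc)
      also have "\<dots> = (\<integral>\<^sup>+y. G (w(k := y)) * ennreal (normal_density (\<mu> k w) (s k) y) \<partial>lborel) * ennreal (?d w)"
        by (rule nn_integral_multc) measurable
      also have "\<dots> = ?G w * ennreal (?d w)"
        by (subst nn_integral_normal_density_affine) (use s in auto)
      finally show "(\<integral>\<^sup>+y. G (w(k := y)) * ennreal (normal_density (\<mu> k (w(k := y))) (s k) ((w(k := y)) k) * ?d (w(k := y))) \<partial>lborel) = ?G w * ennreal (?d w)" .
    qed
    also have "\<dots> = (\<integral>\<^sup>+w. ?G w * (\<Prod>k\<in>set ks. ennreal (normal_density (\<mu> k w) (s k) (w k))) \<partial>PiM (set ks) (\<lambda>_. lborel))"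
      by (simp add: prod_ennreal)
    also have "\<dots> = (\<integral>\<^sup>+e. ?G (affine_noise \<mu> s ks e) \<partial>std_noise (set ks))"
      by (rule Cons.IH[OF ksprops(1,2) mG])
    also have "\<dots> = (\<integral>\<^sup>+e. \<integral>\<^sup>+x. G (affine_noise \<mu> s (k # ks) (e(k := x))) \<partial>std_normal \<partial>std_noise (set ks))"
    proof -
      have "affine_noise \<mu> s ks (e(k := x)) = affine_noise \<mu> s ks e" for e x
        using ksprops by (intro affine_noise_cong) auto
      then show ?thesis by simp
    qed
    also have "\<dots> = (\<integral>\<^sup>+e. G (affine_noise \<mu> s (k # ks) e) \<partial>std_noise (set (k # ks)))"
      unfolding std_noise_def list.set
    proof (rule P.product_nn_integral_insert[symmetric])
      have "affine_noise \<mu> s (k # ks) \<in> PiM (insert k (set ks)) (\<lambda>_. borel) \<rightarrow>\<^sub>M PiM (insert k (set ks)) (\<lambda>_. borel)"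
        using measurable_affine_noise[of \<mu> "k # ks" s] tri by (simp del: affine_noise.simps)
      then have "(\<lambda>e. G (affine_noise \<mu> s (k # ks) e)) \<in> borel_measurable (PiM (insert k (set ks)) (\<lambda>_. borel))"
        by (rule measurable_compose) measurable
      then show "(\<lambda>e. G (affine_noise \<mu> s (k # ks) e)) \<in> borel_measurable (PiM (insert k (set ks)) (\<lambda>_. std_normal))"
        using sets_std_noise[of "insert k (set ks)"] by (simp add: std_noise_def cong: measurable_cong_sets)
    qed (use ksprops in auto)
    finally show ?case .
qed

section \<open>The posterior in the game\<close>

lemma finite_links [simp]: "finite (links n)"
  by (rule finite_subset[of _ "{..<n} \<times> {..<n}"]) (auto simp: links_def)

text \<open>Bayes' rule for one peer: the density of private signal x and message y given \<theta>
  becomes the marginal of y, of variance \<open>\<sigma>\<^sup>2 + \<tau>\<^sup>2\<close>, times the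
  law of x given \<theta> and y, whose mean is a weighted mean of \<theta> and y.\<close>

lemma normal_density_conditioning:
  assumes "0 < \<sigma>" "0 < \<tau>"
  shows "normal_density \<theta> \<sigma> x * normal_density x \<tau> y
       = normal_density \<theta> (sqrt (\<sigma>\<^sup>2 + \<tau>\<^sup>2)) y
         * normal_density (\<tau>\<^sup>2 / (\<sigma>\<^sup>2 + \<tau>\<^sup>2) * \<theta> + (1 - \<tau>\<^sup>2 / (\<sigma>\<^sup>2 + \<tau>\<^sup>2)) * y) (\<sigma> * \<tau> / sqrt (\<sigma>\<^sup>2 + \<tau>\<^sup>2)) x"
proof -
  define S T where "S = \<sigma>\<^sup>2" and "T = \<tau>\<^sup>2"
  have ST: "0 < S" "0 < T" using assms by (auto simp: S_def T_def)
  have sq: "(\<sigma> * \<tau> / sqrt (S + T))\<^sup>2 = S * T / (S + T)"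
    using ST by (simp add: power_divide power_mult_distrib S_def T_def)
  have mean: "x - (T / (S + T) * \<theta> + (1 - T / (S + T)) * y) = (T * (x - \<theta>) - S * (y - x)) / (S + T)"
  proof -
    have k: "1 - T / (S + T) = S / (S + T)" using ST by (simp add: field_simps)
    have "x - (T / (S + T) * \<theta> + S / (S + T) * y) = ((S + T) * x - (T * \<theta> + S * y)) / (S + T)"
      using ST by (simp add: add_divide_distrib diff_divide_distrib)
    then show ?thesis unfolding k by (simp add: algebra_simps)
  qed
  define p q where "p = x - \<theta>" and "q = y - x"
  \<comment> \<open>Completing the square in the two noises p and q; p + q is the total noise of the
    message.\<close>
  have "p\<^sup>2 / S + q\<^sup>2 / T = (p + q)\<^sup>2 / (S + T) + (T * p - S * q)\<^sup>2 / ((S + T) * (S * T))"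
  proof -
    have "(p\<^sup>2 * T + q\<^sup>2 * S) * (S + T) = (p + q)\<^sup>2 * (S * T) + (T * p - S * q)\<^sup>2"
      by (simp add: power2_eq_square algebra_simps)
    then have "(p\<^sup>2 * T + q\<^sup>2 * S) * (S + T) / ((S + T) * (S * T))
      = ((p + q)\<^sup>2 * (S * T) + (T * p - S * q)\<^sup>2) / ((S + T) * (S * T))" by simp
    moreover have "(p\<^sup>2 * T + q\<^sup>2 * S) * (S + T) / ((S + T) * (S * T)) = p\<^sup>2 / S + q\<^sup>2 / T"
      using ST by (simp add: add_divide_distrib)
    moreover have "((p + q)\<^sup>2 * (S * T) + (T * p - S * q)\<^sup>2) / ((S + T) * (S * T))
        = (p + q)\<^sup>2 / (S + T) + (T * p - S * q)\<^sup>2 / ((S + T) * (S * T))"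
      using ST by (simp add: add_divide_distrib)
    ultimately show ?thesis by simp
  qed
  also have "(T * p - S * q)\<^sup>2 / ((S + T) * (S * T)) = ((T * p - S * q) / (S + T))\<^sup>2 / (S * T / (S + T))"
  proof -
    have "X\<^sup>2 / (V * W) = (X / V)\<^sup>2 / (W / V)" if "0 < V" for X V W :: real
      using that by (simp add: power2_eq_square)
    from this[of "S + T"] show ?thesis using ST by simp
  qed
  finally have E: "(x - \<theta>)\<^sup>2 / S + (y - x)\<^sup>2 / T
      = (y - \<theta>)\<^sup>2 / (S + T) + ((T * (x - \<theta>) - S * (y - x)) / (S + T))\<^sup>2 / (S * T / (S + T))"
    by (simp add: p_def q_def)
  have half: "- A / (2 * B) = - (A / B) / 2" for A B :: real by simp
  have ex: "- (x - \<theta>)\<^sup>2 / (2 * S) + - (y - x)\<^sup>2 / (2 * T)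
      = - (y - \<theta>)\<^sup>2 / (2 * (S + T)) + - ((T * (x - \<theta>) - S * (y - x)) / (S + T))\<^sup>2 / (2 * (S * T / (S + T)))"
  proof -
    have "- a / 2 + - b / 2 = - c / 2 + - d / 2" if "a + b = c + d" for a b c d :: real
      using that by simp
    from this[OF E] show ?thesis unfolding half .
  qed
  have rt: "sqrt (2 * pi * S) * sqrt (2 * pi * T) = sqrt (2 * pi * (S + T)) * sqrt (2 * pi * (S * T / (S + T)))"
    unfolding real_sqrt_mult[symmetric] using ST by (simp add: field_simps)
  have "normal_density \<theta> \<sigma> x * normal_density x \<tau> y
      = 1 / (sqrt (2 * pi * S) * sqrt (2 * pi * T)) * exp (- (x - \<theta>)\<^sup>2 / (2 * S) + - (y - x)\<^sup>2 / (2 * T))"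
    by (simp add: normal_density_def S_def[symmetric] T_def[symmetric] exp_add[symmetric])
  also have "\<dots> = normal_density \<theta> (sqrt (S + T)) y
      * normal_density (T / (S + T) * \<theta> + (1 - T / (S + T)) * y) (\<sigma> * \<tau> / sqrt (S + T)) x"
    unfolding normal_density_def sq mean rt ex exp_add using ST by simp
  finally show ?thesis by (simp add: S_def T_def)
qed

text \<open>The product is read as a likelihood of the mean \<theta>: up to a factor C independent
  of \<theta>, only the number and the sum of the data matter.\<close>

lemma prod_normal_density_mean:
  assumes "finite P" "0 < s"
  obtains C where "0 < C"
    "\<And>\<theta>. (\<Prod>p\<in>P. normal_density \<theta> s (u p))
      = C * exp (- (real (card P) * \<theta>\<^sup>2 - 2 * \<theta> * (\<Sum>p\<in>P. u p)) / (2 * s\<^sup>2))"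
proof -
  have "\<exists>C>0. \<forall>\<theta>. (\<Prod>p\<in>P. normal_density \<theta> s (u p))
      = C * exp (- (real (card P) * \<theta>\<^sup>2 - 2 * \<theta> * (\<Sum>p\<in>P. u p)) / (2 * s\<^sup>2))"
    using assms(1)
  proof (induction P)
    case empty
    then show ?case by (intro exI[of _ 1]) simp
  next
    case (insert p P)
    then obtain C where C: "0 < C" "\<And>\<theta>. (\<Prod>p\<in>P. normal_density \<theta> s (u p))
      = C * exp (- (real (card P) * \<theta>\<^sup>2 - 2 * \<theta> * (\<Sum>p\<in>P. u p)) / (2 * s\<^sup>2))" by auto
    define D where "D = 1 / sqrt (2 * pi * s\<^sup>2) * exp (- (u p)\<^sup>2 / (2 * s\<^sup>2))"
    have "0 < D" using assms(2) by (simp add: D_def)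
    have nd: "normal_density \<theta> s (u p) = D * exp (- (\<theta>\<^sup>2 - 2 * \<theta> * u p) / (2 * s\<^sup>2))" for \<theta>
    proof -
      have "- (u p - \<theta>)\<^sup>2 / (2 * s\<^sup>2) = - (u p)\<^sup>2 / (2 * s\<^sup>2) + - (\<theta>\<^sup>2 - 2 * \<theta> * u p) / (2 * s\<^sup>2)"
        unfolding add_divide_distrib[symmetric] by (simp add: power2_eq_square algebra_simps)
      then show ?thesis unfolding normal_density_def D_def by (simp only: exp_add mult.assoc)
    qed
    have "(\<Prod>p\<in>insert p P. normal_density \<theta> s (u p))
        = (D * C) * exp (- (real (card (insert p P)) * \<theta>\<^sup>2 - 2 * \<theta> * (\<Sum>p\<in>insert p P. u p)) / (2 * s\<^sup>2))" for \<theta>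
    proof -
      have "- (real (card (insert p P)) * \<theta>\<^sup>2 - 2 * \<theta> * (\<Sum>p\<in>insert p P. u p)) / (2 * s\<^sup>2)
          = - (\<theta>\<^sup>2 - 2 * \<theta> * u p) / (2 * s\<^sup>2) + - (real (card P) * \<theta>\<^sup>2 - 2 * \<theta> * (\<Sum>p\<in>P. u p)) / (2 * s\<^sup>2)"
        unfolding add_divide_distrib[symmetric] using insert by (simp add: algebra_simps)
      then show ?thesis using insert C(2) nd by (simp only: exp_add) simp
    qed
    then show ?case using \<open>0 < C\<close> \<open>0 < D\<close> by (intro exI[of _ "D * C"]) auto
  qed
  then show thesis using that by blast
qed

section \<open>Constants of the game and conditional laws of the hidden quantities\<close>

locale global_game =
  fixes n :: nat and \<sigma> \<tau> :: real
  assumes n_ge: "2 \<le> n" and sigma_pos: "0 < \<sigma>" and tau_pos: "0 < \<tau>"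
begin

definition \<alpha> :: real where "\<alpha> = coeff_a \<sigma> \<tau> n"
definition \<beta> :: real where "\<beta> = coeff_b \<sigma> \<tau> n"
definition \<eta> :: real where "\<eta> = sqrt (eta2 \<sigma> \<tau> n)"
text \<open>Given the fundamental and the message of a peer, the private signal of the peer has a
  mean that gives weight \<open>\<kappa>\<close> to the fundamental and 1 - \<open>\<kappa>\<close>
  to the message, and standard deviation \<open>\<rho>\<close>.\<close>

definition \<kappa> :: real where "\<kappa> = \<tau>\<^sup>2 / (\<sigma>\<^sup>2 + \<tau>\<^sup>2)"
definition \<rho> :: real where "\<rho> = \<sigma> * \<tau> / sqrt (\<sigma>\<^sup>2 + \<tau>\<^sup>2)"

definition posterior_mean :: "(nat \<Rightarrow> real) \<Rightarrow> real" where
  "posterior_mean u = \<alpha> * u 0 + \<beta> * (\<Sum>p=1..<n. u p)"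

lemma eta2_pos: "0 < eta2 \<sigma> \<tau> n"
  unfolding eta2_def using n_ge sigma_pos by (intro divide_pos_pos add_pos_nonneg) auto

lemma constants_pos: "0 < \<alpha>" "0 < \<beta>" "0 < \<eta>" "0 < \<kappa>" "\<kappa> < 1" "0 < \<rho>"
  unfolding \<alpha>_def \<beta>_def \<eta>_def \<kappa>_def \<rho>_def coeff_a_def coeff_b_def
  using eta2_pos sigma_pos tau_pos by (auto intro!: divide_pos_pos add_pos_pos simp: add_pos_pos)

lemma beta_le_alpha: "\<beta> \<le> \<alpha>"
  unfolding \<alpha>_def \<beta>_def coeff_a_def coeff_b_def
  using eta2_pos sigma_pos by (intro divide_left_mono) (auto simp: add_pos_nonneg)

text \<open>Since the weights sum to 1, the posterior mean has Lipschitz constant 1 for the supremum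
  distance.\<close>

lemma alpha_beta_sum: "\<alpha> + (real n - 1) * \<beta> = 1"
proof -
  have "\<alpha> + (real n - 1) * \<beta> = eta2 \<sigma> \<tau> n * (1 / \<sigma>\<^sup>2 + (real n - 1) / (\<sigma>\<^sup>2 + \<tau>\<^sup>2))"
    by (simp add: \<alpha>_def \<beta>_def coeff_a_def coeff_b_def algebra_simps)
  also have "\<dots> = 1" using eta2_pos by (simp add: eta2_def)
  finally show ?thesis .
qed

text \<open>Precisions add: one datum of variance \<open>\<sigma>\<^sup>2\<close> and n - 1 data of
  variance \<open>\<sigma>\<^sup>2 + \<tau>\<^sup>2\<close> have total precision 1 /
  \<open>eta2 \<sigma> \<tau> n\<close>. Under the flat prior the likelihood of \<theta> is
  proportional to its posterior density.\<close>

lemma fundamental_density: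
  obtains C where "0 < C"
    "\<And>\<theta>. normal_density \<theta> \<sigma> (u 0) * (\<Prod>p=1..<n. normal_density \<theta> (sqrt (\<sigma>\<^sup>2 + \<tau>\<^sup>2)) (u p))
      = C * normal_density (posterior_mean u) \<eta> \<theta>"
proof -
  define V where "V = \<sigma>\<^sup>2 + \<tau>\<^sup>2"
  have V: "0 < V" using sigma_pos tau_pos by (simp add: V_def add_pos_pos)
  define E where "E = eta2 \<sigma> \<tau> n"
  have E: "0 < E" "1 / E = 1 / \<sigma>\<^sup>2 + (real n - 1) / V"
    using eta2_pos by (simp_all add: E_def) (simp add: eta2_def V_def)
  define S where "S = (\<Sum>p=1..<n. u p)"
  define m where "m = posterior_mean u"
  have mE: "m / E = u 0 / \<sigma>\<^sup>2 + S / V"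
    using E(1) by (simp add: m_def posterior_mean_def \<alpha>_def \<beta>_def coeff_a_def coeff_b_def E_def[symmetric] V_def[symmetric] S_def
        add_divide_distrib)
  obtain C0 where C0: "0 < C0" "\<And>\<theta>. (\<Prod>p\<in>{0::nat}. normal_density \<theta> \<sigma> (u p))
      = C0 * exp (- (real (card {0::nat}) * \<theta>\<^sup>2 - 2 * \<theta> * (\<Sum>p\<in>{0::nat}. u p)) / (2 * \<sigma>\<^sup>2))"
    by (rule prod_normal_density_mean[OF _ sigma_pos, of "{0::nat}" u]) auto
  obtain C1 where C1: "0 < C1" "\<And>\<theta>. (\<Prod>p=1..<n. normal_density \<theta> (sqrt V) (u p))
      = C1 * exp (- (real (card {1..<n}) * \<theta>\<^sup>2 - 2 * \<theta> * S) / (2 * (sqrt V)\<^sup>2))"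
    unfolding S_def by (rule prod_normal_density_mean[of "{1..<n}" "sqrt V" u]) (use V in auto)
  define D where "D = 1 / sqrt (2 * pi * E) * exp (- m\<^sup>2 / (2 * E))"
  have D: "0 < D" using E by (simp add: D_def)
  have "normal_density \<theta> \<sigma> (u 0) * (\<Prod>p=1..<n. normal_density \<theta> (sqrt V) (u p))
      = C0 * C1 / D * normal_density m \<eta> \<theta>" for \<theta>
  proof -
    have "- (\<theta> - m)\<^sup>2 / (2 * E) = - m\<^sup>2 / (2 * E) + (- \<theta>\<^sup>2 / 2 * (1 / E) + \<theta> * (m / E))"
      using E(1) by (simp add: power2_eq_square field_simps)
    moreover have "normal_density m \<eta> \<theta> = 1 / sqrt (2 * pi * E) * exp (- (\<theta> - m)\<^sup>2 / (2 * E))"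
      using E(1) by (simp add: normal_density_def \<eta>_def E_def[symmetric])
    ultimately have "normal_density m \<eta> \<theta> = D * exp (- \<theta>\<^sup>2 / 2 * (1 / E) + \<theta> * (m / E))"
      unfolding D_def by (simp only: exp_add mult.assoc)
    also have "- \<theta>\<^sup>2 / 2 * (1 / E) + \<theta> * (m / E)
        = - (\<theta>\<^sup>2 - 2 * \<theta> * u 0) / (2 * \<sigma>\<^sup>2) + - ((real n - 1) * \<theta>\<^sup>2 - 2 * \<theta> * S) / (2 * V)"
      unfolding E(2) mE using V sigma_pos by (simp add: field_simps)
    finally have nm: "normal_density m \<eta> \<theta> / D
        = exp (- (\<theta>\<^sup>2 - 2 * \<theta> * u 0) / (2 * \<sigma>\<^sup>2)) * exp (- ((real n - 1) * \<theta>\<^sup>2 - 2 * \<theta> * S) / (2 * V))"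
      using D by (simp only: exp_add) simp
    have "normal_density \<theta> \<sigma> (u 0) * (\<Prod>p=1..<n. normal_density \<theta> (sqrt V) (u p))
      = C0 * C1 * (exp (- (\<theta>\<^sup>2 - 2 * \<theta> * u 0) / (2 * \<sigma>\<^sup>2)) * exp (- ((real n - 1) * \<theta>\<^sup>2 - 2 * \<theta> * S) / (2 * V)))"
      using C0(2)[of \<theta>] C1(2)[of \<theta>] V n_ge by (simp add: of_nat_diff)
    then show ?thesis unfolding nm[symmetric] by simp
  qed
  then show thesis using C0(1) C1(1) D by (intro that[of "C0 * C1 / D"]) (auto simp: V_def m_def)
qed

text \<open>Means in the order of generation: fundamental, private signals, messages to agents other
  than i. A message sent by the observer i has the observed mean \<open>u 0\<close>.\<close>

definition hidden_mean :: "nat \<Rightarrow> (nat \<Rightarrow> real) \<Rightarrow> quantity \<Rightarrow> state \<Rightarrow> real" where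
  "hidden_mean i u k w = (case k of Fundamental \<Rightarrow> posterior_mean u
     | Private j \<Rightarrow> \<kappa> * w Fundamental + (1 - \<kappa>) * u (msg_pos i j)
     | Message j _ \<Rightarrow> if j = i then u 0 else w (Private j))"

definition hidden_sd :: "quantity \<Rightarrow> real" where
  "hidden_sd k = (case k of Fundamental \<Rightarrow> \<eta> | Private _ \<Rightarrow> \<rho> | Message _ _ \<Rightarrow> \<tau>)"

lemma hidden_sd_pos: "0 < hidden_sd k"
  using constants_pos tau_pos by (auto simp: hidden_sd_def split: quantity.split)

lemma finite_hidden: "finite (hidden n i)"
proof -
  have "{Message j k | j k. (j, k) \<in> links n \<and> k \<noteq> i} \<subseteq> case_prod Message ` links n" by force
  then have "finite {Message j k | j k. (j, k) \<in> links n \<and> k \<noteq> i}"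
    by (rule finite_subset) auto
  then show ?thesis by (simp add: hidden_def)
qed

text \<open>Each message received by i is paired with the private signal of its sender by
  \<open>normal_density_conditioning\<close>. The marginals left over depend on the fundamental only
  and are merged by \<open>fundamental_density\<close>; its factor depends on u, not on w.\<close>

lemma joint_density_factorization:
  assumes i: "i < n"
  obtains C where "0 < C"
    "\<And>w. joint_density n \<sigma> \<tau> (complete_state i u w)
      = C * (\<Prod>k\<in>hidden n i. normal_density (hidden_mean i u k w) (hidden_sd k) (w k))"
proof -
  obtain C where C: "0 < C" "\<And>\<theta>. normal_density \<theta> \<sigma> (u 0) * (\<Prod>p=1..<n. normal_density \<theta> (sqrt (\<sigma>\<^sup>2 + \<tau>\<^sup>2)) (u p))
      = C * normal_density (posterior_mean u) \<eta> \<theta>"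
    using fundamental_density[of u] by blast
  let ?J = "{..<n} - {i}"
  let ?L = "{(j, k). (j, k) \<in> links n \<and> k \<noteq> i}"
  have finL: "finite ?L" by (rule finite_subset[of _ "links n"]) auto
  have msgs: "{Message j k | j k. (j, k) \<in> links n \<and> k \<noteq> i} = case_prod Message ` ?L" by force
  have "joint_density n \<sigma> \<tau> (complete_state i u w)
      = C * (\<Prod>k\<in>hidden n i. normal_density (hidden_mean i u k w) (hidden_sd k) (w k))" for w
  proof -
    let ?\<theta> = "w Fundamental"
    let ?x = "\<lambda>j. if j = i then u 0 else w (Private j)"
    have "(\<Prod>j<n. normal_density ?\<theta> \<sigma> (?x j)) = normal_density ?\<theta> \<sigma> (u 0) * (\<Prod>j\<in>?J. normal_density ?\<theta> \<sigma> (w (Private j)))"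
      using i by (subst prod.remove[of _ i]) (auto intro!: prod.cong)
    moreover have "(\<Prod>(j, k)\<in>links n. normal_density (?x j) \<tau> (if k = i then u (msg_pos i j) else w (Message j k)))
        = (\<Prod>j\<in>?J. normal_density (w (Private j)) \<tau> (u (msg_pos i j)))
          * (\<Prod>(j, k)\<in>?L. normal_density (?x j) \<tau> (w (Message j k)))"
    proof -
      have L: "links n = (\<lambda>j. (j, i)) ` ?J \<union> ?L" using i by (auto simp: links_def)
      show ?thesis
        by (subst L, subst prod.union_disjoint)
          (auto simp: prod.reindex inj_on_def finL intro!: arg_cong2[where f = "(*)"] prod.cong)
    qed
    ultimately have "joint_density n \<sigma> \<tau> (complete_state i u w)
      = normal_density ?\<theta> \<sigma> (u 0)
        * (\<Prod>j\<in>?J. normal_density ?\<theta> \<sigma> (w (Private j)) * normal_density (w (Private j)) \<tau> (u (msg_pos i j)))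
        * (\<Prod>(j, k)\<in>?L. normal_density (?x j) \<tau> (w (Message j k)))"
      by (simp add: joint_density_def prod.distrib)
    also have "(\<Prod>j\<in>?J. normal_density ?\<theta> \<sigma> (w (Private j)) * normal_density (w (Private j)) \<tau> (u (msg_pos i j)))
      = (\<Prod>j\<in>?J. normal_density ?\<theta> (sqrt (\<sigma>\<^sup>2 + \<tau>\<^sup>2)) (u (msg_pos i j)))
        * (\<Prod>j\<in>?J. normal_density (hidden_mean i u (Private j) w) \<rho> (w (Private j)))"
      by (simp add: normal_density_conditioning[OF sigma_pos tau_pos] prod.distrib hidden_mean_def \<kappa>_def \<rho>_def)
    also have "(\<Prod>j\<in>?J. normal_density ?\<theta> (sqrt (\<sigma>\<^sup>2 + \<tau>\<^sup>2)) (u (msg_pos i j)))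
        = (\<Prod>p=1..<n. normal_density ?\<theta> (sqrt (\<sigma>\<^sup>2 + \<tau>\<^sup>2)) (u p))"
      by (rule prod.reindex_bij_betw[OF bij_betw_sender[OF i], symmetric, THEN trans])
        (auto simp: msg_pos_sender)
    finally have "joint_density n \<sigma> \<tau> (complete_state i u w)
      = (normal_density ?\<theta> \<sigma> (u 0) * (\<Prod>p=1..<n. normal_density ?\<theta> (sqrt (\<sigma>\<^sup>2 + \<tau>\<^sup>2)) (u p)))
        * (\<Prod>j\<in>?J. normal_density (hidden_mean i u (Private j) w) \<rho> (w (Private j)))
        * (\<Prod>(j, k)\<in>?L. normal_density (?x j) \<tau> (w (Message j k)))" by simp
    also have "\<dots> = C * (normal_density (posterior_mean u) \<eta> ?\<theta>
        * (\<Prod>j\<in>?J. normal_density (hidden_mean i u (Private j) w) \<rho> (w (Private j)))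
        * (\<Prod>(j, k)\<in>?L. normal_density (?x j) \<tau> (w (Message j k))))"
      unfolding C(2) by simp
    also have "(normal_density (posterior_mean u) \<eta> ?\<theta>
        * (\<Prod>j\<in>?J. normal_density (hidden_mean i u (Private j) w) \<rho> (w (Private j)))
        * (\<Prod>(j, k)\<in>?L. normal_density (?x j) \<tau> (w (Message j k))))
      = (\<Prod>k\<in>hidden n i. normal_density (hidden_mean i u k w) (hidden_sd k) (w k))"
      unfolding hidden_def msgs
      by (subst prod.union_disjoint, simp, simp add: finL, force, subst prod.union_disjoint, simp, simp, force)
        (auto simp: prod.reindex inj_on_def hidden_sd_def hidden_mean_def intro!: arg_cong2[where f = "(*)"] prod.cong)
    finally show ?thesis .
  qed
  with C(1) show thesis by (rule that)
qed

lemma triangular_hidden: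
  obtains ks where "distinct ks" "set ks = hidden n i" "triangular (hidden_mean i u) ks"
proof -
  obtain ps where ps: "distinct ps" "set ps = Private ` ({..<n} - {i})"
    using finite_distinct_list[of "Private ` ({..<n} - {i})"] by auto
  obtain ms where ms: "distinct ms" "set ms = {Message j k | j k. (j, k) \<in> links n \<and> k \<noteq> i}"
    using finite_distinct_list[of "{Message j k | j k. (j, k) \<in> links n \<and> k \<noteq> i}"] finite_hidden[of i]
    by (auto simp: hidden_def)
  have app: "triangular \<mu> (xs @ ys)"
    if "triangular \<mu> ys" "\<And>x Y. x \<in> set xs \<Longrightarrow> set ys \<subseteq> Y \<Longrightarrow> \<mu> x \<in> borel_measurable (PiM Y (\<lambda>_. borel))"
      "\<And>x w w'. x \<in> set xs \<Longrightarrow> \<forall>k\<in>set ys. w k = w' k \<Longrightarrow> \<mu> x w = \<mu> x w'"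
    for \<mu> :: "quantity \<Rightarrow> state \<Rightarrow> real" and xs ys
    using that
  proof (induction xs)
    case (Cons x xs)
    have "\<mu> x \<in> borel_measurable (PiM (set (xs @ ys)) (\<lambda>_. borel))" using Cons.prems by auto
    moreover have "\<forall>w w'. (\<forall>k\<in>set (xs @ ys). w k = w' k) \<longrightarrow> \<mu> x w = \<mu> x w'"
      using Cons.prems(3)[of x] by auto
    moreover have "triangular \<mu> (xs @ ys)" using Cons by auto
    ultimately show ?case by simp
  qed simp
  have "triangular (hidden_mean i u) (ms @ (ps @ [Fundamental]))"
  proof (intro app)
    show "triangular (hidden_mean i u) [Fundamental]" by (simp add: hidden_mean_def[abs_def])
  next
    fix x Y assume "x \<in> set ps" "set [Fundamental] \<subseteq> Y"
    then show "hidden_mean i u x \<in> borel_measurable (PiM Y (\<lambda>_. borel))"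
      using ps by (auto simp: hidden_mean_def[abs_def])
  next
    fix x and w w' :: state assume "x \<in> set ps" "\<forall>k\<in>set [Fundamental]. w k = w' k"
    then show "hidden_mean i u x w = hidden_mean i u x w'"
      using ps by (auto simp: hidden_mean_def)
  next
    fix x Y assume x: "x \<in> set ms" "set (ps @ [Fundamental]) \<subseteq> Y"
    then obtain j k where "x = Message j k" "j < n" using ms by (auto simp: links_def)
    then show "hidden_mean i u x \<in> borel_measurable (PiM Y (\<lambda>_. borel))"
      using x ps by (cases "j = i") (auto simp: hidden_mean_def[abs_def] intro!: measurable_component_singleton)
  next
    fix x and w w' :: state assume x: "x \<in> set ms" "\<forall>k\<in>set (ps @ [Fundamental]). w k = w' k"
    then obtain j k where "x = Message j k" "j < n" using ms by (auto simp: links_def)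
    then show "hidden_mean i u x w = hidden_mean i u x w'"
      using x ps by (auto simp: hidden_mean_def)
  qed
  moreover have "distinct (ms @ (ps @ [Fundamental]))" using ps ms by auto
  moreover have "set (ms @ (ps @ [Fundamental])) = hidden n i" using ps ms by (auto simp: hidden_def)
  ultimately show thesis using that by blast
qed

text \<open>The factor C cancels in the normalization, and the remaining product has integral 1 by
  the triangular formula for G = 1. Hence the posterior is the law of the generated vector.\<close>

lemma posterior_eq_distr:
  assumes i: "i < n" and ks: "distinct ks" "set ks = hidden n i" "triangular (hidden_mean i u) ks"
  shows "posterior n \<sigma> \<tau> i u
    = distr (std_noise (hidden n i)) (PiM (hidden n i) (\<lambda>_. borel)) (affine_noise (hidden_mean i u) hidden_sd ks)"
proof -
  let ?H = "hidden n i"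
  let ?M = "PiM ?H (\<lambda>_. lborel)"
  let ?p = "\<lambda>w. \<Prod>k\<in>?H. normal_density (hidden_mean i u k w) (hidden_sd k) (w k)"
  let ?A = "affine_noise (hidden_mean i u) hidden_sd ks"
  obtain C where C: "0 < C" "\<And>w. joint_density n \<sigma> \<tau> (complete_state i u w) = C * ?p w"
    using joint_density_factorization[OF i] by blast
  have mp: "?p \<in> borel_measurable (PiM ?H (\<lambda>_. borel))"
    using measurable_triangular_density[OF ks(3,1), of hidden_sd] unfolding ks(2) .
  then have [measurable]: "?p \<in> borel_measurable ?M" by measurable
  have mA: "?A \<in> PiM ?H (\<lambda>_. borel) \<rightarrow>\<^sub>M PiM ?H (\<lambda>_. borel)"
    using measurable_affine_noise[OF ks(3), of hidden_sd] unfolding ks(2) .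
  then have [measurable]: "?A \<in> std_noise ?H \<rightarrow>\<^sub>M PiM ?H (\<lambda>_. borel)" by measurable
  have nn: "0 \<le> ?p w" for w by (simp add: prod_nonneg)
  have tri: "(\<integral>\<^sup>+w. G w * ennreal (?p w) \<partial>?M) = (\<integral>\<^sup>+e. G (?A e) \<partial>std_noise ?H)"
    if "G \<in> borel_measurable (PiM ?H (\<lambda>_. borel))" for G
    using nn_integral_triangular[OF ks(3,1) hidden_sd_pos, of G] that unfolding ks(2)
    by (simp add: prod_ennreal)
  have "(\<integral>\<^sup>+w. ennreal (?p w) \<partial>?M) = 1"
    using tri[of "\<lambda>_. 1"] prob_space.emeasure_space_1[OF prob_space_std_noise, of ?H] by simp
  then have "(\<integral>w. ?p w \<partial>?M) = 1"
    using nn by (subst integral_eq_nn_integral) auto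
  then have dens: "posterior n \<sigma> \<tau> i u = density ?M (\<lambda>w. ennreal (?p w))"
    unfolding posterior_def Let_def C(2) using C(1) by simp
  show ?thesis
  proof (rule measure_eqI)
    show "sets (posterior n \<sigma> \<tau> i u) = sets (distr (std_noise ?H) (PiM ?H (\<lambda>_. borel)) ?A)"
      unfolding dens by (simp add: sets_PiM_lborel)
  next
    fix X assume "X \<in> sets (posterior n \<sigma> \<tau> i u)"
    then have [measurable]: "X \<in> sets (PiM ?H (\<lambda>_. borel))" by (simp add: dens sets_PiM_lborel)
    then have X': "X \<in> sets ?M" by (simp add: sets_PiM_lborel)
    have "emeasure (posterior n \<sigma> \<tau> i u) X = (\<integral>\<^sup>+w. indicator X w * ennreal (?p w) \<partial>?M)"
      unfolding dens using X' by (subst emeasure_density) (auto simp: mult.commute)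
    also have "\<dots> = (\<integral>\<^sup>+e. indicator X (?A e) \<partial>std_noise ?H)"
      by (rule tri) measurable
    also have "\<dots> = (\<integral>\<^sup>+w. indicator X w \<partial>distr (std_noise ?H) (PiM ?H (\<lambda>_. borel)) ?A)"
      by (subst nn_integral_distr) auto
    also have "\<dots> = emeasure (distr (std_noise ?H) (PiM ?H (\<lambda>_. borel)) ?A) X"
      by (rule nn_integral_indicator) simp
    finally show "emeasure (posterior n \<sigma> \<tau> i u) X = emeasure (distr (std_noise ?H) (PiM ?H (\<lambda>_. borel)) ?A) X" .
  qed
qed

text \<open>Convention for noise: e 0 drives the fundamental, e q with 0 < q < n the private signal
  of the sender at position q of u, and e (n + q) the message at position q of the peer's
  observation.\<close>

definition private_of :: "(nat \<Rightarrow> real) \<Rightarrow> (nat \<Rightarrow> real) \<Rightarrow> nat \<Rightarrow> real" where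
  "private_of u e q = \<kappa> * (posterior_mean u + \<eta> * e 0) + (1 - \<kappa>) * u q + \<rho> * e q"

text \<open>The observation of the agent whose message is at position p of u. The message that this agent
  receives from the observer of u is placed at position p as well, and the other messages are ordered
  as in u; this differs from the true order by a permutation.\<close>

definition peer_obs :: "nat \<Rightarrow> (nat \<Rightarrow> real) \<Rightarrow> (nat \<Rightarrow> real) \<Rightarrow> nat \<Rightarrow> real" where
  "peer_obs p u e q = (if q = 0 then private_of u e p
     else (if q = p then u 0 else private_of u e q) + \<tau> * e (n + q))"

abbreviation noise_space :: "(nat \<Rightarrow> real) measure" where
  "noise_space \<equiv> std_noise {..<2 * n}"

lemma measurable_peer_obs:
  assumes "p < n" "{..<2 * n} - {n} \<subseteq> I"
  shows "(\<lambda>e. restrict (peer_obs p u e) {..<n}) \<in> PiM I (\<lambda>_. borel) \<rightarrow>\<^sub>M PiM {..<n} (\<lambda>_. borel)"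
proof (rule measurable_restrict)
  fix q assume q: "q \<in> {..<n}"
  have [measurable]: "(\<lambda>e. e k) \<in> borel_measurable (PiM I (\<lambda>_. borel))" if "k < 2 * n" "k \<noteq> n" for k
    using that assms by (intro measurable_component_singleton) auto
  have "(\<lambda>e. private_of u e k) \<in> borel_measurable (PiM I (\<lambda>_. borel))" if "k < n" for k
    using that n_ge unfolding private_of_def by (intro borel_measurable_add borel_measurable_times borel_measurable_const) auto
  then show "(\<lambda>e. peer_obs p u e q) \<in> borel_measurable (PiM I (\<lambda>_. borel))"
    using q assms unfolding peer_obs_def
    by (cases "q = 0"; cases "q = p") (auto intro!: borel_measurable_add borel_measurable_times borel_measurable_const)
qed

lemma affine_noise_hidden:
  assumes "distinct ks" "set ks = hidden n i" "triangular (hidden_mean i u) ks"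
  shows "affine_noise (hidden_mean i u) hidden_sd ks e Fundamental = posterior_mean u + \<eta> * e Fundamental"
    "j < n \<Longrightarrow> j \<noteq> i \<Longrightarrow> affine_noise (hidden_mean i u) hidden_sd ks e (Private j)
       = \<kappa> * (posterior_mean u + \<eta> * e Fundamental) + (1 - \<kappa>) * u (msg_pos i j) + \<rho> * e (Private j)"
    "(j, k) \<in> links n \<Longrightarrow> k \<noteq> i \<Longrightarrow> affine_noise (hidden_mean i u) hidden_sd ks e (Message j k)
       = (if j = i then u 0 else affine_noise (hidden_mean i u) hidden_sd ks e (Private j)) + \<tau> * e (Message j k)"
proof -
  note fp = affine_noise_fixpoint[OF assms(3,1), unfolded assms(2)]
  show F: "affine_noise (hidden_mean i u) hidden_sd ks e Fundamental = posterior_mean u + \<eta> * e Fundamental"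
    by (subst fp) (auto simp: hidden_def hidden_mean_def hidden_sd_def)
  show "j < n \<Longrightarrow> j \<noteq> i \<Longrightarrow> affine_noise (hidden_mean i u) hidden_sd ks e (Private j)
       = \<kappa> * (posterior_mean u + \<eta> * e Fundamental) + (1 - \<kappa>) * u (msg_pos i j) + \<rho> * e (Private j)"
    by (subst fp) (auto simp: hidden_def hidden_mean_def hidden_sd_def F)
  show "(j, k) \<in> links n \<Longrightarrow> k \<noteq> i \<Longrightarrow> affine_noise (hidden_mean i u) hidden_sd ks e (Message j k)
       = (if j = i then u 0 else affine_noise (hidden_mean i u) hidden_sd ks e (Private j)) + \<tau> * e (Message j k)"
    by (subst fp) (auto simp: hidden_def hidden_mean_def hidden_sd_def)
qed

lemma cond_expectation_eq:
  assumes "i < n" "distinct ks" "set ks = hidden n i" "triangular (hidden_mean i u) ks"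
    and [measurable]: "(\<lambda>w. g (complete_state i u w)) \<in> borel_measurable (PiM (hidden n i) (\<lambda>_. borel))"
  shows "cond_expectation n \<sigma> \<tau> i u g
    = (\<integral>e. g (complete_state i u (affine_noise (hidden_mean i u) hidden_sd ks e)) \<partial>std_noise (hidden n i))"
proof -
  have "affine_noise (hidden_mean i u) hidden_sd ks \<in> PiM (hidden n i) (\<lambda>_. borel) \<rightarrow>\<^sub>M PiM (hidden n i) (\<lambda>_. borel)"
    using measurable_affine_noise[OF assms(4), of hidden_sd] unfolding assms(3) .
  then have [measurable]: "affine_noise (hidden_mean i u) hidden_sd ks \<in> std_noise (hidden n i) \<rightarrow>\<^sub>M PiM (hidden n i) (\<lambda>_. borel)"
    by measurable
  show ?thesis
    unfolding cond_expectation_def posterior_eq_distr[OF assms(1-4)] by (rule integral_distr) measurable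
qed

lemma expected_fundamental_eq:
  assumes i: "i < n"
  shows "expected_fundamental n \<sigma> \<tau> i u = posterior_mean u"
proof -
  obtain ks where ks: "distinct ks" "set ks = hidden n i" "triangular (hidden_mean i u) ks"
    by (rule triangular_hidden)
  have F: "Fundamental \<in> hidden n i" by (simp add: hidden_def)
  have "expected_fundamental n \<sigma> \<tau> i u
    = (\<integral>e. posterior_mean u + \<eta> * e Fundamental \<partial>std_noise (hidden n i))"
    unfolding expected_fundamental_def
    by (subst cond_expectation_eq[OF i ks]) (use F in \<open>auto simp: affine_noise_hidden[OF ks]\<close>)
  also have "\<dots> = posterior_mean u"
    using integral_std_noise_component[OF F] prob_space.prob_space[OF prob_space_std_noise[of "hidden n i"]]
      prob_space.emeasure_space_1[OF prob_space_std_noise[of "hidden n i"]]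
    by (subst Bochner_Integration.integral_add) (auto simp: prob_space_std_noise prob_space.finite_measure finite_measure.integrable_const)
  finally show ?thesis .
qed

text \<open>The observation of j is \<open>peer_obs\<close> up to a renaming of noise coordinates
  and a permutation of messages. The renaming does not matter because the noise is i.i.d., the
  permutation because g is symmetric.\<close>

lemma cond_expectation_peer:
  fixes g :: "(nat \<Rightarrow> real) \<Rightarrow> real"
  assumes i: "i < n" and j: "j < n" "j \<noteq> i"
    and g: "g \<in> borel_measurable (PiM {..<n} (\<lambda>_. borel))"
    and sym: "\<And>\<pi> v. \<pi> permutes {1..<n} \<Longrightarrow> g (v \<circ> \<pi>) = g v"
  shows "cond_expectation n \<sigma> \<tau> i u (\<lambda>\<omega>. g (obs n j \<omega>))
    = (\<integral>e. g (restrict (peer_obs (msg_pos i j) u e) {..<n}) \<partial>noise_space)"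
    "(\<lambda>w. g (obs n j (complete_state i u w))) \<in> borel_measurable (PiM (hidden n i) (\<lambda>_. borel))"
proof -
  let ?H = "hidden n i"
  obtain ks where ks: "distinct ks" "set ks = hidden n i" "triangular (hidden_mean i u) ks"
    by (rule triangular_hidden)
  have links: "(sender j r, j) \<in> links n" if "0 < r" "r < n" for r
    using that j by (auto simp: links_def sender_def)
  have "(\<lambda>w. obs n j (complete_state i u w)) \<in> PiM ?H (\<lambda>_. borel) \<rightarrow>\<^sub>M PiM {..<n} (\<lambda>_. borel)"
    unfolding obs_def
  proof (intro measurable_restrict)
    fix r assume "r \<in> {..<n}"
    then show "(\<lambda>w. if r = 0 then complete_state i u w (Private j)
        else complete_state i u w (Message (sender j r) j)) \<in> borel_measurable (PiM ?H (\<lambda>_. borel))"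
      using j links[of r] by (cases "r = 0") (auto simp: hidden_def intro!: measurable_component_singleton)
  qed
  then show meas: "(\<lambda>w. g (obs n j (complete_state i u w))) \<in> borel_measurable (PiM ?H (\<lambda>_. borel))"
    by (rule measurable_compose) (rule g)
  define p where "p = msg_pos i j"
  have p: "0 < p" "p < n" "sender i p = j"
    using i j by (auto simp: p_def sender_msg_pos) (auto simp: msg_pos_def)
  define K where "K = {..<2 * n} - {n}"
  \<comment> \<open>f names the hidden quantity driven by coordinate k. Coordinate n + p is given to
    the message from i to j: p is the position of j in u, and j sends no message to itself, so this
    place is free.\<close>
  define f where "f k = (if k = 0 then Fundamental else if k < n then Private (sender i k)
    else Message (if k - n = p then i else sender i (k - n)) j)" for k
  have sinj: "inj_on (sender i) {1..<n}" and simg: "sender i ` {1..<n} = {..<n} - {i}"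
    using bij_betw_sender[OF i] by (auto simp: bij_betw_def)
  have sender_ne: "sender i q < n" "sender i q \<noteq> i" if "0 < q" "q < n" for q
  proof -
    have "sender i q \<in> sender i ` {1..<n}" using that by (intro imageI) auto
    then show "sender i q < n" "sender i q \<noteq> i" unfolding simg by auto
  qed
  have sender_inj: "sender i q = sender i q' \<longleftrightarrow> q = q'" if "0 < q" "q < n" "0 < q'" "q' < n" for q q'
    using inj_on_eq_iff[OF sinj] that by auto
  have finj: "inj_on f K"
  proof (rule inj_onI)
    fix k k' assume k: "k \<in> K" "k' \<in> K" "f k = f k'"
    then have "k < n \<longleftrightarrow> k' < n" by (auto simp: f_def split: if_splits)
    show "k = k'"
    proof (cases "k < n")
      case True
      with k \<open>k < n \<longleftrightarrow> k' < n\<close> show ?thesis by (auto simp: f_def sender_inj split: if_splits)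
    next
      case False
      then have "0 < k - n" "k - n < n" "0 < k' - n" "k' - n < n"
        using k \<open>k < n \<longleftrightarrow> k' < n\<close> by (auto simp: K_def)
      moreover have "k - n = k' - n"
        using calculation k(3) False \<open>k < n \<longleftrightarrow> k' < n\<close> sender_ne[of "k - n"] sender_ne[of "k' - n"]
        by (auto simp: f_def sender_inj split: if_splits)
      ultimately show ?thesis by auto
    qed
  qed
  have fH: "f \<in> K \<rightarrow> ?H"
  proof
    fix k assume k: "k \<in> K"
    consider "k = 0" | "0 < k" "k < n" | "n < k" using k by (force simp: K_def)
    then show "f k \<in> ?H"
    proof cases
      case 3
      then have q: "0 < k - n" "k - n < n" using k by (auto simp: K_def)
      have "sender i (k - n) \<noteq> j" if "k - n \<noteq> p" using that p q sender_inj by metis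
      then show ?thesis using 3 q i j sender_ne[OF q] by (auto simp: f_def hidden_def links_def)
    qed (use sender_ne in \<open>auto simp: f_def hidden_def\<close>)
  qed
  \<comment> \<open>\<pi> maps a position in the observation of j to the position of the same sender
    in the observation of i, and the position of i itself to p.\<close>
  define \<pi> where "\<pi> r = (if r \<in> {1..<n} then if sender j r = i then p else msg_pos i (sender j r) else r)" for r
  have perm: "\<pi> permutes {1..<n}"
  proof (rule bij_imp_permutes)
    show "bij_betw \<pi> {1..<n} {1..<n}"
    proof (rule bij_betw_byWitness[where f' = "\<lambda>r. if r = p then msg_pos j i else msg_pos j (sender i r)"])
      show "\<forall>r\<in>{1..<n}. (if \<pi> r = p then msg_pos j i else msg_pos j (sender i (\<pi> r))) = r"
      proof
        fix r assume r: "r \<in> {1..<n}"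
        define k where "k = sender j r"
        have k: "k \<noteq> j" "msg_pos j k = r"
          using links[of r] r by (auto simp: k_def links_def msg_pos_sender)
        show "(if \<pi> r = p then msg_pos j i else msg_pos j (sender i (\<pi> r))) = r"
        proof (cases "k = i")
          case True
          then show ?thesis using r k by (auto simp: \<pi>_def k_def)
        next
          case False
          then have "\<pi> r = msg_pos i k" using r by (auto simp: \<pi>_def k_def)
          moreover have "msg_pos i k \<noteq> p" using False k p(3) sender_msg_pos[of k i] by auto
          ultimately show ?thesis using False k by (simp add: sender_msg_pos)
        qed
      qed
      show "\<forall>r\<in>{1..<n}. \<pi> (if r = p then msg_pos j i else msg_pos j (sender i r)) = r"
      proof
        fix r assume r: "r \<in> {1..<n}"
        have rng: "msg_pos j k \<in> {1..<n}" if "k < n" "k \<noteq> j" for k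
          using that j by (auto simp: msg_pos_def)
        show "\<pi> (if r = p then msg_pos j i else msg_pos j (sender i r)) = r"
        proof (cases "r = p")
          case True
          then show ?thesis using rng[of i] i j by (simp add: \<pi>_def sender_msg_pos)
        next
          case False
          have "0 < r" "r < n" using r by auto
          then have k: "sender i r < n" "sender i r \<noteq> i" "sender i r \<noteq> j"
            using sender_ne[of r] sender_inj[of r p] p False by auto
          then show ?thesis
            using rng[of "sender i r"] False \<open>0 < r\<close> by (simp add: \<pi>_def sender_msg_pos msg_pos_sender)
        qed
      qed
      show "\<pi> ` {1..<n} \<subseteq> {1..<n}"
        using p i by (auto simp: \<pi>_def msg_pos_def sender_def)
      show "(\<lambda>r. if r = p then msg_pos j i else msg_pos j (sender i r)) ` {1..<n} \<subseteq> {1..<n}"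
        using i j p by (auto simp: msg_pos_def sender_def split: if_splits)
    qed
    show "\<pi> x = x" if "x \<notin> {1..<n}" for x using that by (auto simp: \<pi>_def)
  qed
  let ?A = "affine_noise (hidden_mean i u) hidden_sd ks"
  have obs_eq: "obs n j (complete_state i u (?A e)) = restrict (peer_obs p u (\<lambda>k\<in>K. e (f k))) {..<n} \<circ> \<pi>" for e
  proof
    fix r
    have KI: "0 \<in> K" "\<And>q. 0 < q \<Longrightarrow> q < n \<Longrightarrow> q \<in> K" "\<And>q. 0 < q \<Longrightarrow> q < n \<Longrightarrow> n + q \<in> K"
      using n_ge by (auto simp: K_def)
    have priv: "?A e (Private k) = private_of u (\<lambda>k\<in>K. e (f k)) (msg_pos i k)" if k: "k < n" "k \<noteq> i" for k
    proof -
      have m: "0 < msg_pos i k" "msg_pos i k < n" using k i by (auto simp: msg_pos_def)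
      then show ?thesis
        using k KI m by (subst affine_noise_hidden[OF ks]) (auto simp: private_of_def f_def sender_msg_pos)
    qed
    consider "r = 0" | "0 < r" "r < n" | "n \<le> r" by linarith
    then show "obs n j (complete_state i u (?A e)) r = (restrict (peer_obs p u (\<lambda>k\<in>K. e (f k))) {..<n} \<circ> \<pi>) r"
    proof cases
      case 1
      then show ?thesis using n_ge j by (simp add: obs_def \<pi>_def peer_obs_def priv p_def)
    next
      case 2
      define k where "k = sender j r"
      have k: "k < n" "k \<noteq> j" using links[OF 2] by (auto simp: k_def links_def)
      have lhs: "obs n j (complete_state i u (?A e)) r = ?A e (Message k j)"
        using 2 j by (simp add: obs_def k_def)
      have A: "?A e (Message k j) = (if k = i then u 0 else ?A e (Private k)) + \<tau> * e (Message k j)"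
        using links[OF 2] j by (subst affine_noise_hidden(3)[OF ks]) (auto simp: k_def)
      have \<pi>r: "\<pi> r = (if k = i then p else msg_pos i k)" using 2 by (auto simp: \<pi>_def k_def)
      have rng: "0 < \<pi> r" "\<pi> r < n" using \<pi>r p k i by (auto simp: msg_pos_def)
      have "f (n + \<pi> r) = Message k j"
      proof (cases "k = i")
        case False
        then have "msg_pos i k \<noteq> p" using k j by (metis p(3) sender_msg_pos)
        then show ?thesis using \<pi>r rng False by (auto simp: f_def sender_msg_pos)
      qed (use \<pi>r rng in \<open>auto simp: f_def\<close>)
      moreover have "\<pi> r = p \<longleftrightarrow> k = i" using \<pi>r k j by (metis p(3) sender_msg_pos)
      ultimately show ?thesis
        unfolding lhs A using rng k \<pi>r KI by (auto simp: peer_obs_def priv)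
    next
      case 3
      then show ?thesis by (simp add: obs_def \<pi>_def)
    qed
  qed
  have mg: "(\<lambda>e. g (restrict (peer_obs p u e) {..<n})) \<in> borel_measurable (PiM I (\<lambda>_. borel))"
    if "K \<subseteq> I" for I
    using that unfolding K_def by (intro measurable_compose[OF measurable_peer_obs[OF p(2)] g])
  have "cond_expectation n \<sigma> \<tau> i u (\<lambda>\<omega>. g (obs n j \<omega>))
      = (\<integral>e. g (restrict (peer_obs p u (\<lambda>k\<in>K. e (f k))) {..<n}) \<partial>std_noise ?H)"
    by (subst cond_expectation_eq[OF i ks meas]) (simp add: obs_eq sym[OF perm])
  also have "\<dots> = (\<integral>e. g (restrict (peer_obs p u e) {..<n}) \<partial>std_noise K)"
    by (rule integral_std_noise_reindex[OF finj fH]) (rule mg, simp)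
  \<comment> \<open>Coordinate n is added as an independent dummy, so that the index set becomes an
    initial segment.\<close>
  also have "\<dots> = (\<integral>e. g (restrict (peer_obs p u (\<lambda>k\<in>K. e k)) {..<n}) \<partial>noise_space)"
    by (rule integral_std_noise_reindex[of "\<lambda>k. k", symmetric]) (auto simp: K_def intro: mg[unfolded K_def])
  also have "\<dots> = (\<integral>e. g (restrict (peer_obs p u e) {..<n}) \<partial>noise_space)"
  proof -
    have "restrict (peer_obs p u (\<lambda>k\<in>K. e k)) {..<n} = restrict (peer_obs p u e) {..<n}" for e
      using n_ge p(2) by (intro restrict_ext) (auto simp: peer_obs_def private_of_def K_def)
    then show ?thesis by simp
  qed
  finally show "cond_expectation n \<sigma> \<tau> i u (\<lambda>\<omega>. g (obs n j \<omega>))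
    = (\<integral>e. g (restrict (peer_obs (msg_pos i j) u e) {..<n}) \<partial>noise_space)"
    by (simp add: p_def)
qed

end

section \<open>The best-response operator\<close>

text \<open>A finite product of countable discrete spaces is discrete, so every F on it is
  measurable. This applies in particular to the decisions of the algorithm.\<close>

lemma measurable_grid:
  fixes F :: "('i \<Rightarrow> int) \<Rightarrow> real" and c :: real
  assumes "finite I"
  shows "(\<lambda>v. F (\<lambda>q\<in>I. \<lfloor>c * v q\<rfloor>)) \<in> borel_measurable (PiM I (\<lambda>_. borel))"
proof -
  have "(\<lambda>v. \<lambda>q\<in>I. \<lfloor>c * v q :: real\<rfloor>) \<in> PiM I (\<lambda>_. borel) \<rightarrow>\<^sub>M PiM I (\<lambda>_. count_space UNIV)"
    by (intro measurable_restrict measurable_compose[OF _ measurable_real_floor] borel_measurable_times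
        borel_measurable_const measurable_component_singleton)
  moreover have "F \<in> borel_measurable (PiM I (\<lambda>_. count_space UNIV))"
    using assms by (subst count_space_PiM_finite) (auto simp: measurable_def)
  ultimately show ?thesis by (rule measurable_compose)
qed

section \<open>Lipschitz, steep and exchangeable threshold functions\<close>

context global_game
begin

text \<open>The case r = 0 forces h to depend on the first n coordinates only. Functions on all of
  \<open>nat \<Rightarrow> real\<close> can then stand for functions on \<open>Rn n\<close>.\<close>

definition sup_lipschitz :: "real \<Rightarrow> ((nat \<Rightarrow> real) \<Rightarrow> real) \<Rightarrow> bool" where
  "sup_lipschitz L h \<longleftrightarrow> (\<forall>u v r. (\<forall>q<n. \<bar>u q - v q\<bar> \<le> r) \<longrightarrow> \<bar>h u - h v\<bar> \<le> L * r)"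

text \<open>A quantitative form of strict monotonicity. Unlike strict monotonicity it passes to
  pointwise limits, and it bounds the width of the layer where h is small.\<close>

definition steep :: "((nat \<Rightarrow> real) \<Rightarrow> real) \<Rightarrow> bool" where
  "steep h \<longleftrightarrow> (\<forall>u p t. p < n \<longrightarrow> u p < t \<longrightarrow> h (u(p := t)) \<le> h u - \<beta> * (t - u p))"

definition exchangeable :: "((nat \<Rightarrow> real) \<Rightarrow> real) \<Rightarrow> bool" where
  "exchangeable h \<longleftrightarrow> (\<forall>\<pi> u. \<pi> permutes {1..<n} \<longrightarrow> h (u \<circ> \<pi>) = h u)"

lemma sup_lipschitzD:
  "sup_lipschitz L h \<Longrightarrow> (\<And>q. q < n \<Longrightarrow> \<bar>u q - v q\<bar> \<le> r) \<Longrightarrow> \<bar>h u - h v\<bar> \<le> L * r"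
  by (simp add: sup_lipschitz_def)

lemma sup_lipschitz_cong: "sup_lipschitz L h \<Longrightarrow> (\<And>q. q < n \<Longrightarrow> u q = v q) \<Longrightarrow> h u = h v"
  unfolding sup_lipschitz_def by (drule spec[of _ u], drule spec[of _ v], drule spec[of _ 0]) auto

text \<open>h is the pointwise limit of its values at dyadic grid points, and these are measurable
  by \<open>measurable_grid\<close>.\<close>

lemma sup_lipschitz_measurable:
  assumes "sup_lipschitz L h"
  shows "h \<in> borel_measurable (PiM {..<n} (\<lambda>_. borel))"
proof (rule borel_measurable_LIMSEQ_real)
  define F where "F k z = h (\<lambda>q. of_int (z q) / 2 ^ k)" for k :: nat and z :: "nat \<Rightarrow> int"
  show "(\<lambda>v. F k (\<lambda>q\<in>{..<n}. \<lfloor>2 ^ k * v q :: real\<rfloor>)) \<in> borel_measurable (PiM {..<n} (\<lambda>_. borel))" for k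
    by (rule measurable_grid) simp
  fix v :: "nat \<Rightarrow> real"
  have bound: "\<bar>F k (\<lambda>q\<in>{..<n}. \<lfloor>2 ^ k * v q\<rfloor>) - h v\<bar> \<le> L * (1 / 2 ^ k)" for k
  proof -
    have "\<bar>of_int \<lfloor>2 ^ k * x\<rfloor> / 2 ^ k - x\<bar> \<le> 1 / 2 ^ k" for x :: real
    proof -
      have "of_int \<lfloor>2 ^ k * x\<rfloor> / 2 ^ k - x = (of_int \<lfloor>2 ^ k * x\<rfloor> - 2 ^ k * x) / 2 ^ k"
        by (simp add: diff_divide_distrib)
      also have "\<bar>\<dots>\<bar> = \<bar>of_int \<lfloor>2 ^ k * x\<rfloor> - 2 ^ k * x\<bar> / 2 ^ k" by (simp add: abs_divide)
      also have "\<dots> \<le> 1 / 2 ^ k" by (intro divide_right_mono) (linarith, simp)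
      finally show ?thesis .
    qed
    then show ?thesis unfolding F_def by (intro sup_lipschitzD[OF assms]) simp
  qed
  have "(\<lambda>k. L * (1 / 2 ^ k)) \<longlonglongrightarrow> 0"
    by (intro tendsto_mult_right_zero) (simp add: LIMSEQ_divide_realpow_zero)
  then have "(\<lambda>k. F k (\<lambda>q\<in>{..<n}. \<lfloor>2 ^ k * v q\<rfloor>) - h v) \<longlonglongrightarrow> 0"
    by (rule Lim_null_comparison[rotated]) (use bound in auto)
  then show "(\<lambda>k. F k (\<lambda>q\<in>{..<n}. \<lfloor>2 ^ k * v q\<rfloor>)) \<longlonglongrightarrow> h v"
    by (simp add: LIM_zero_iff)
qed

lemma sup_lipschitz_peer_obs_measurable:
  assumes "sup_lipschitz L h" "p < n"
  shows "(\<lambda>e. h (peer_obs p u e)) \<in> borel_measurable (PiM {..<2 * n} (\<lambda>_. borel))"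
proof -
  have "(\<lambda>e. h (restrict (peer_obs p u e) {..<n})) \<in> borel_measurable (PiM {..<2 * n} (\<lambda>_. borel))"
    by (intro measurable_compose[OF measurable_peer_obs sup_lipschitz_measurable[OF assms(1)]] assms(2)) auto
  moreover have "h (restrict (peer_obs p u e) {..<n}) = h (peer_obs p u e)" for e
    by (rule sup_lipschitz_cong[OF assms(1)]) simp
  ultimately show ?thesis by simp
qed

lemma sup_lipschitz_continuous_on:
  assumes "sup_lipschitz L h"
  shows "continuous_on A h"
  unfolding continuous_on_def
proof (intro ballI tendstoI)
  fix u and \<epsilon> :: real assume \<epsilon>: "0 < \<epsilon>"
  define \<delta> where "\<delta> = \<epsilon> / (\<bar>L\<bar> + 1)"
  have \<delta>: "0 < \<delta>" using \<epsilon> by (auto simp: \<delta>_def intro!: divide_pos_pos)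
  have "\<forall>\<^sub>F v in at u within A. dist (v q) (u q) < \<delta>" for q
  proof -
    have "continuous_on UNIV (\<lambda>v :: nat \<Rightarrow> real. v q)" by (rule continuous_on_product_coordinates)
    then have "((\<lambda>v. v q) \<longlongrightarrow> u q) (at u within A)"
      by (meson continuous_on_def iso_tuple_UNIV_I tendsto_within_subset top_greatest)
    then show ?thesis using \<delta> by (rule tendstoD)
  qed
  then have "\<forall>\<^sub>F v in at u within A. \<forall>q\<in>{..<n}. dist (v q) (u q) < \<delta>"
    by (intro eventually_ball_finite) auto
  then show "\<forall>\<^sub>F v in at u within A. dist (h v) (h u) < \<epsilon>"
  proof eventually_elim
    case (elim v)
    then have "\<bar>h v - h u\<bar> \<le> L * \<delta>"
      by (intro sup_lipschitzD[OF assms]) (auto simp: dist_real_def less_imp_le)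
    also have "\<dots> < (\<bar>L\<bar> + 1) * \<delta>" using \<delta> by (intro mult_strict_right_mono) auto
    also have "\<dots> = \<epsilon>" by (simp add: \<delta>_def)
    finally show ?case by (simp add: dist_real_def)
  qed
qed

text \<open>The coordinates are raised one after the other; w k has the first k of them
  raised.\<close>

lemma steep_antimono:
  assumes h: "steep h" and L: "sup_lipschitz L h" and uv: "\<And>q. q < n \<Longrightarrow> u q \<le> v q"
  shows "h v \<le> h u"
proof -
  define w where "w k = (\<lambda>q. if q < k then v q else u q)" for k
  have "h (w k) \<le> h u" if "k \<le> n" for k
    using that
  proof (induction k)
    case (Suc k)
    have eq: "w (Suc k) = (w k)(k := v k)" by (auto simp: w_def)
    have "h (w (Suc k)) \<le> h (w k)"
    proof (cases "u k = v k")
      case True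
      then have "w (Suc k) = w k" by (auto simp: w_def less_Suc_eq)
      then show ?thesis by simp
    next
      case False
      then have "w k k < v k" using uv[of k] Suc.prems by (simp add: w_def)
      moreover from this have "0 \<le> \<beta> * (v k - w k k)" using constants_pos(2) by simp
      ultimately show ?thesis
        using h Suc.prems unfolding eq steep_def by (metis Suc_le_eq diff_ge_0_iff_ge diff_le_eq le_add_same_cancel1 order_trans)
    qed
    then show ?case using Suc by simp
  qed (simp add: w_def)
  from this[of n] have "h (w n) \<le> h u" by simp
  also have "h (w n) = h v" by (rule sup_lipschitz_cong[OF L]) (simp add: w_def)
  finally show ?thesis .
qed

lemma posterior_mean_le:
  assumes "\<And>q. q < n \<Longrightarrow> u q \<le> v q + r"
  shows "posterior_mean u \<le> posterior_mean v + r"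
proof -
  have "posterior_mean u \<le> \<alpha> * (v 0 + r) + \<beta> * (\<Sum>p=1..<n. v p + r)"
    unfolding posterior_mean_def using assms constants_pos n_ge
    by (intro add_mono mult_left_mono sum_mono) auto
  also have "\<dots> = posterior_mean v + (\<alpha> + (real n - 1) * \<beta>) * r"
    using n_ge by (simp add: posterior_mean_def sum.distrib of_nat_diff algebra_simps)
  finally show ?thesis by (simp add: alpha_beta_sum)
qed

lemma posterior_mean_lipschitz:
  assumes "\<And>q. q < n \<Longrightarrow> \<bar>u q - v q\<bar> \<le> r"
  shows "\<bar>posterior_mean u - posterior_mean v\<bar> \<le> r"
  using posterior_mean_le[of u v r] posterior_mean_le[of v u r] assms by (force simp: abs_le_iff)

lemma posterior_mean_update:
  assumes "p < n" "u p \<le> t"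
  shows "posterior_mean u + \<beta> * (t - u p) \<le> posterior_mean (u(p := t))"
proof (cases "p = 0")
  case True
  have "\<beta> * (t - u p) \<le> \<alpha> * (t - u p)"
    using assms(2) beta_le_alpha by (intro mult_right_mono) auto
  then show ?thesis using True by (simp add: posterior_mean_def algebra_simps)
next
  case False
  then have "p \<in> {1..<n}" using assms by auto
  then have "(\<Sum>q=1..<n. (u(p := t)) q) = (\<Sum>q=1..<n. u q) + (t - u p)"
    by (simp add: sum.remove[of _ p])
  then have "\<beta> * (\<Sum>q=1..<n. (u(p := t)) q) = \<beta> * (\<Sum>q=1..<n. u q) + \<beta> * (t - u p)"
    by (simp only: distrib_left)
  moreover have "(u(p := t)) 0 = u 0" using False by simp
  ultimately show ?thesis unfolding posterior_mean_def by (simp del: fun_upd_apply add: add.assoc)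
qed

text \<open>Each coordinate of the peer's observation is noise plus a weighted mean of u with total
  weight 1. The one-sided form with slack r gives monotonicity for r = 0, and the Lipschitz bound
  when used in both directions.\<close>

lemma peer_obs_le:
  assumes "\<And>q. q < n \<Longrightarrow> u q \<le> v q + r" "p < n" "q < n"
  shows "peer_obs p u e q \<le> peer_obs p v e q + r"
proof -
  have "private_of u e q \<le> private_of v e q + r" if "q < n" for q
  proof -
    have "\<kappa> * posterior_mean u + (1 - \<kappa>) * u q \<le> \<kappa> * (posterior_mean v + r) + (1 - \<kappa>) * (v q + r)"
      using posterior_mean_le[OF assms(1)] assms(1)[OF that] constants_pos
      by (intro add_mono mult_left_mono) auto
    then show ?thesis by (simp add: private_of_def algebra_simps)
  qed
  then show ?thesis using assms n_ge by (auto simp: peer_obs_def)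
qed

lemma peer_obs_lipschitz:
  assumes "\<And>q. q < n \<Longrightarrow> \<bar>u q - v q\<bar> \<le> r" "p < n" "q < n"
  shows "\<bar>peer_obs p u e q - peer_obs p v e q\<bar> \<le> r"
  using peer_obs_le[of u v r p q e] peer_obs_le[of v u r p q e] assms by (force simp: abs_le_iff)

section \<open>Probabilities of the peers' decisions\<close>

definition peer_prob :: "((nat \<Rightarrow> real) \<Rightarrow> real) \<Rightarrow> nat \<Rightarrow> (nat \<Rightarrow> real) \<Rightarrow> real" where
  "peer_prob h p u = (\<integral>e. of_bool (0 \<le> h (peer_obs p u e)) \<partial>noise_space)"

definition gain :: "((nat \<Rightarrow> real) \<Rightarrow> real) \<Rightarrow> (nat \<Rightarrow> real) \<Rightarrow> real" where
  "gain h u = 1 + (\<Sum>p=1..<n. peer_prob h p u) - posterior_mean u"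

definition \<gamma> :: real where "\<gamma> = 2 / (\<beta> * \<tau> * sqrt (2 * pi))"

lemma gamma_nonneg: "0 \<le> \<gamma>"
  using constants_pos tau_pos by (simp add: \<gamma>_def)

lemma finite_measure_noise: "finite_measure noise_space"
  using prob_space_std_noise by (rule prob_space.finite_measure)

lemma integrable_of_bool:
  assumes "Measurable.pred (PiM {..<2 * n} (\<lambda>_. borel)) P"
  shows "integrable noise_space (\<lambda>e. of_bool (P e) :: real)"
proof (rule finite_measure.integrable_const_bound[OF finite_measure_noise, of _ 1])
  show "(\<lambda>e. of_bool (P e) :: real) \<in> borel_measurable noise_space"
    using assms by measurable
qed auto

lemma integral_of_bool_bounds:
  "0 \<le> (\<integral>e. of_bool (P e) \<partial>noise_space :: real)" "(\<integral>e. of_bool (P e) \<partial>noise_space) \<le> (1::real)"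
proof -
  show "0 \<le> (\<integral>e. of_bool (P e) \<partial>noise_space :: real)" by (rule integral_nonneg_AE) auto
  interpret prob_space noise_space by (rule prob_space_std_noise)
  show "(\<integral>e. of_bool (P e) \<partial>noise_space) \<le> (1::real)"
    \<comment> \<open>If P is not measurable, the integral is 0 by convention.\<close>
    by (cases "integrable noise_space (\<lambda>e. of_bool (P e) :: real)")
      (auto intro!: integral_le_const simp: not_integrable_integral_eq)
qed

text \<open>The message from the observer of u carries noise that is independent of everything else, so
  the peer's observation has density at most 1/(\<tau> sqrt (2 pi)) in this direction; a function of slope at
  least \<beta> is small only on a short interval of it.\<close>

lemma anticoncentration:
  assumes h: "steep h" and L: "sup_lipschitz L h" and p: "p \<in> {1..<n}" and r: "0 \<le> r"
  shows "(\<integral>e. of_bool (\<bar>h (peer_obs p u e)\<bar> \<le> r) \<partial>noise_space) \<le> \<gamma> * r"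
proof -
  interpret P: product_sigma_finite "\<lambda>_. std_normal"
    by (simp add: product_sigma_finite_def prob_space_std_normal prob_space_imp_sigma_finite)
  define I where "I = {..<2 * n} - {n + p}"
  have I: "{..<2 * n} = insert (n + p) I" "n + p \<notin> I" "finite I" using p by (auto simp: I_def)
  have mh [measurable]: "(\<lambda>e. h (peer_obs p u e)) \<in> borel_measurable (PiM {..<2 * n} (\<lambda>_. borel))"
    using sup_lipschitz_peer_obs_measurable[OF L] p by simp
  let ?f = "\<lambda>e. indicator {e. \<bar>h (peer_obs p u e)\<bar> \<le> r} e :: ennreal"
  have mf: "?f \<in> borel_measurable (PiM {..<2 * n} (\<lambda>_. borel))"
    by (rule borel_measurable_indicator') measurable
  \<comment> \<open>x fixes all noise coordinates except n + p, which is integrated alone.\<close>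
  have inner: "(\<integral>\<^sup>+y. ?f (x(n + p := y)) \<partial>std_normal) \<le> ennreal (\<gamma> * r)" for x
  proof -
    define \<phi> where "\<phi> y = h (peer_obs p u (x(n + p := y)))" for y
    have upd: "peer_obs p u (x(n + p := y)) q = ((peer_obs p u x)(p := u 0 + \<tau> * y)) q" if "q < n" for y q
      using p that by (auto simp: peer_obs_def private_of_def)
    have \<phi>: "\<phi> y = h ((peer_obs p u x)(p := u 0 + \<tau> * y))" for y
      unfolding \<phi>_def by (rule sup_lipschitz_cong[OF L upd])
    have dec: "\<phi> y' \<le> \<phi> y - \<beta> * \<tau> * (y' - y)" if "y < y'" for y y'
    proof -
      define w where "w = (peer_obs p u x)(p := u 0 + \<tau> * y)"
      have w: "w p = u 0 + \<tau> * y" "w(p := u 0 + \<tau> * y') = (peer_obs p u x)(p := u 0 + \<tau> * y')"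
        by (simp_all add: w_def)
      have "w p < u 0 + \<tau> * y'" unfolding w using that tau_pos by simp
      then have "h (w(p := u 0 + \<tau> * y')) \<le> h w - \<beta> * (u 0 + \<tau> * y' - w p)"
        using h p unfolding steep_def by simp
      then show ?thesis unfolding w by (simp add: \<phi> w_def[symmetric] algebra_simps)
    qed
    define A where "A = {y. \<bar>\<phi> y\<bar> \<le> r}"
    \<comment> \<open>On A the values of \<phi> differ by at most 2 * r while \<phi> falls at rate
      at least \<beta> * \<tau>, so A has diameter at most l and lies in an interval of length
      l.\<close>
    define l where "l = 2 * r / (\<beta> * \<tau>)"
    have bt: "0 < \<beta> * \<tau>" using constants_pos tau_pos by simp
    have l: "0 \<le> l" using r bt by (simp add: l_def)
    have close: "y' \<le> y + l" if "y \<in> A" "y' \<in> A" for y y'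
    proof (cases "y < y'")
      case True
      have "\<beta> * \<tau> * (y' - y) \<le> 2 * r" using dec[OF True] that by (auto simp: A_def)
      then have "y' - y \<le> l" using bt by (simp add: l_def pos_le_divide_eq mult.commute)
      then show ?thesis by simp
    qed (use l in auto)
    obtain a where a: "A \<subseteq> {a..a + l}"
    proof (cases "A = {}")
      case False
      then obtain y0 where y0: "y0 \<in> A" by auto
      have bdd: "bdd_below A"
        using close y0 by (intro bdd_belowI[of _ "y0 - l"]) (force simp: algebra_simps)
      have "y - l \<le> Inf A" if "y \<in> A" for y
        using close[OF _ that] False by (intro cInf_greatest) (auto simp: algebra_simps)
      then have "A \<subseteq> {Inf A..Inf A + l}" using bdd by (force intro: cInf_lower)
      then show thesis by (rule that)
    qed auto
    have "(\<integral>\<^sup>+y. ?f (x(n + p := y)) \<partial>std_normal) \<le> (\<integral>\<^sup>+y. indicator {a..a + l} y \<partial>std_normal)"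
      using a by (intro nn_integral_mono) (auto simp: A_def \<phi>_def split: split_indicator)
    also have "\<dots> = (\<integral>\<^sup>+y. ennreal (std_normal_density y) * indicator {a..a + l} y \<partial>lborel)"
      by (subst nn_integral_density) auto
    also have "\<dots> \<le> (\<integral>\<^sup>+y. ennreal (1 / sqrt (2 * pi)) * indicator {a..a + l} y \<partial>lborel)"
      by (intro nn_integral_mono mult_right_mono ennreal_leI) (auto simp: std_normal_density_def divide_right_mono)
    also have "\<dots> = ennreal (1 / sqrt (2 * pi)) * ennreal l"
      using l by (subst nn_integral_cmult_indicator) auto
    also have "\<dots> = ennreal (\<gamma> * r)"
      using l by (subst ennreal_mult[symmetric]) (auto simp: \<gamma>_def l_def ac_simps)
    finally show ?thesis .
  qed
  have "(\<integral>\<^sup>+e. ?f e \<partial>noise_space) = (\<integral>\<^sup>+x. \<integral>\<^sup>+y. ?f (x(n + p := y)) \<partial>std_normal \<partial>std_noise I)"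
    unfolding std_noise_def I(1)
  proof (rule P.product_nn_integral_insert[OF I(3,2)])
    show "?f \<in> borel_measurable (PiM (insert (n + p) I) (\<lambda>_. std_normal))"
      using mf sets_std_noise[of "{..<2 * n}"] unfolding I(1) std_noise_def by (simp cong: measurable_cong_sets)
  qed
  also have "\<dots> \<le> (\<integral>\<^sup>+x. ennreal (\<gamma> * r) \<partial>std_noise I)"
    by (intro nn_integral_mono inner)
  also have "\<dots> = ennreal (\<gamma> * r)"
    using prob_space.emeasure_space_1[OF prob_space_std_noise, of I] by simp
  finally have "(\<integral>\<^sup>+e. ?f e \<partial>noise_space) \<le> ennreal (\<gamma> * r)" .
  moreover have "(\<integral>\<^sup>+e. ?f e \<partial>noise_space) = ennreal (\<integral>e. of_bool (\<bar>h (peer_obs p u e)\<bar> \<le> r) \<partial>noise_space)"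
  proof (subst nn_integral_eq_integral[symmetric])
    show "integrable noise_space (\<lambda>e. of_bool (\<bar>h (peer_obs p u e)\<bar> \<le> r) :: real)"
      by (rule integrable_of_bool) measurable
    show "(\<integral>\<^sup>+e. ?f e \<partial>noise_space) = (\<integral>\<^sup>+e. ennreal (of_bool (\<bar>h (peer_obs p u e)\<bar> \<le> r)) \<partial>noise_space)"
      by (intro nn_integral_cong) (auto split: split_indicator)
  qed auto
  ultimately show ?thesis using gamma_nonneg r by (simp add: ennreal_le_iff)
qed

text \<open>The set of disagreement lies in the layer |h| \<le> r, which
  \<open>anticoncentration\<close> bounds. P is left arbitrary because the competing decision may
  come from another observation u, another threshold function or the algorithm.\<close>

lemma peer_prob_close:
  assumes h: "steep h" and L: "sup_lipschitz L h" and p: "p \<in> {1..<n}" and r: "0 \<le> r"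
    and P: "Measurable.pred (PiM {..<2 * n} (\<lambda>_. borel)) P"
    and diff: "\<And>e. (0 \<le> h (peer_obs p u e)) \<noteq> P e \<Longrightarrow> \<bar>h (peer_obs p u e)\<bar> \<le> r"
  shows "\<bar>peer_prob h p u - (\<integral>e. of_bool (P e) \<partial>noise_space)\<bar> \<le> \<gamma> * r"
proof -
  have mh [measurable]: "(\<lambda>e. h (peer_obs p u e)) \<in> borel_measurable (PiM {..<2 * n} (\<lambda>_. borel))"
    using sup_lipschitz_peer_obs_measurable[OF L] p by simp
  have i1: "integrable noise_space (\<lambda>e. of_bool (0 \<le> h (peer_obs p u e)) :: real)"
    by (rule integrable_of_bool) measurable
  have i2: "integrable noise_space (\<lambda>e. of_bool (P e) :: real)" by (rule integrable_of_bool) fact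
  have "peer_prob h p u - (\<integral>e. of_bool (P e) \<partial>noise_space)
    = (\<integral>e. of_bool (0 \<le> h (peer_obs p u e)) - of_bool (P e) \<partial>noise_space)"
    unfolding peer_prob_def by (rule Bochner_Integration.integral_diff[symmetric, OF i1 i2])
  also have "\<bar>\<dots>\<bar> \<le> (\<integral>e. \<bar>of_bool (0 \<le> h (peer_obs p u e)) - of_bool (P e)\<bar> \<partial>noise_space)"
    by (rule integral_abs_bound)
  also have "\<dots> \<le> (\<integral>e. of_bool (\<bar>h (peer_obs p u e)\<bar> \<le> r) \<partial>noise_space)"
  proof (rule integral_mono)
    show "integrable noise_space (\<lambda>e. \<bar>of_bool (0 \<le> h (peer_obs p u e)) - of_bool (P e)\<bar> :: real)"
      using i1 i2 by simp
    show "integrable noise_space (\<lambda>e. of_bool (\<bar>h (peer_obs p u e)\<bar> \<le> r) :: real)"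
      by (rule integrable_of_bool) measurable
    show "\<bar>of_bool (0 \<le> h (peer_obs p u e)) - of_bool (P e)\<bar> \<le> (of_bool (\<bar>h (peer_obs p u e)\<bar> \<le> r) :: real)" for e
      using diff[of e] by (cases "P e"; cases "0 \<le> h (peer_obs p u e)") auto
  qed
  also have "\<dots> \<le> \<gamma> * r" by (rule anticoncentration[OF h L p r])
  finally show ?thesis .
qed

text \<open>Coupling by the same noise e: a larger u raises every coordinate of the peer's
  observation and so lowers h there.\<close>

lemma peer_prob_antimono:
  assumes h: "steep h" and L: "sup_lipschitz L h" and p: "p < n"
    and uv: "\<And>q. q < n \<Longrightarrow> u q \<le> v q"
  shows "peer_prob h p v \<le> peer_prob h p u"
  unfolding peer_prob_def
proof (rule integral_mono)
  have [measurable]: "(\<lambda>e. h (peer_obs p u e)) \<in> borel_measurable (PiM {..<2 * n} (\<lambda>_. borel))" for u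
    using sup_lipschitz_peer_obs_measurable[OF L p] .
  have int: "integrable noise_space (\<lambda>e. of_bool (0 \<le> h (peer_obs p u e)) :: real)" for u
    by (rule integrable_of_bool) measurable
  show "integrable noise_space (\<lambda>e. of_bool (0 \<le> h (peer_obs p v e)) :: real)"
    "integrable noise_space (\<lambda>e. of_bool (0 \<le> h (peer_obs p u e)) :: real)"
    by (rule int)+
  have "h (peer_obs p v e) \<le> h (peer_obs p u e)" for e
    using peer_obs_le[of u v 0 p _ e] uv p by (intro steep_antimono[OF h L]) auto
  then show "(of_bool (0 \<le> h (peer_obs p v e)) :: real) \<le> of_bool (0 \<le> h (peer_obs p u e))" for e
    by (auto intro: order_trans)
qed

lemma posterior_mean_permute:
  assumes "\<pi> permutes {1..<n}"
  shows "posterior_mean (u \<circ> \<pi>) = posterior_mean u"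
proof -
  have "\<pi> 0 = 0" using assms by (rule permutes_not_in) simp
  moreover have "(\<Sum>p=1..<n. u (\<pi> p)) = (\<Sum>p=1..<n. u p)"
    using sum.permute[OF assms, of u] by (simp add: o_def)
  ultimately show ?thesis by (simp add: posterior_mean_def)
qed

text \<open>Permuting the messages in u renames the peers. The noise of private signals and messages
  is renamed along, and the new order within the peer's observation is absorbed by exchangeability
  of h.\<close>

lemma peer_prob_permute:
  assumes \<pi>: "\<pi> permutes {1..<n}" and ex: "exchangeable h" and L: "sup_lipschitz L h" and p: "p \<in> {1..<n}"
  shows "peer_prob h p (u \<circ> \<pi>) = peer_prob h (\<pi> p) u"
proof -
  define f where "f k = (if k < n then \<pi> k else n + \<pi> (k - n))" for k
  have \<pi>0: "\<pi> 0 = 0" using \<pi> by (rule permutes_not_in) simp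
  have \<pi>n: "\<pi> q < n" "\<pi> q = 0 \<longleftrightarrow> q = 0" if "q < n" for q
    using permutes_in_image[OF \<pi>, of q] that \<pi>0 n_ge by (cases "q = 0"; auto)+
  have \<pi>i: "\<pi> q = \<pi> q' \<longleftrightarrow> q = q'" for q q' using permutes_inj[OF \<pi>] by (auto dest: injD)
  have finj: "inj_on f {..<2 * n}"
  proof (rule inj_onI)
    fix k k' assume k: "k \<in> {..<2 * n}" "k' \<in> {..<2 * n}" "f k = f k'"
    then have "k < n \<longleftrightarrow> k' < n" using \<pi>n(1)[of k] \<pi>n(1)[of k'] by (auto simp: f_def split: if_splits)
    then show "k = k'" using k \<pi>i by (cases "k < n") (auto simp: f_def)
  qed
  have frng: "f \<in> {..<2 * n} \<rightarrow> {..<2 * n}"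
  proof
    fix k assume k: "k \<in> {..<2 * n}"
    show "f k \<in> {..<2 * n}"
    proof (cases "k < n")
      case True
      then show ?thesis using \<pi>n(1)[of k] by (simp add: f_def)
    next
      case False
      then have "k - n < n" using k by auto
      then show ?thesis using \<pi>n(1)[of "k - n"] False by (simp add: f_def)
    qed
  qed
  have [measurable]: "(\<lambda>e. h (peer_obs p (u \<circ> \<pi>) e)) \<in> borel_measurable (PiM {..<2 * n} (\<lambda>_. borel))"
    using sup_lipschitz_peer_obs_measurable[OF L] p by simp
  have "peer_prob h p (u \<circ> \<pi>) = (\<integral>e. of_bool (0 \<le> h (peer_obs p (u \<circ> \<pi>) (\<lambda>k\<in>{..<2 * n}. e (f k)))) \<partial>noise_space)"
    unfolding peer_prob_def by (rule integral_std_noise_reindex[OF finj frng, symmetric]) measurable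
  also have "\<dots> = peer_prob h (\<pi> p) u"
    unfolding peer_prob_def
  proof (intro Bochner_Integration.integral_cong refl)
    fix e :: "nat \<Rightarrow> real"
    have "h (peer_obs p (u \<circ> \<pi>) (\<lambda>k\<in>{..<2 * n}. e (f k))) = h (peer_obs (\<pi> p) u e \<circ> \<pi>)"
    proof (rule sup_lipschitz_cong[OF L])
      fix q assume q: "q < n"
      have priv: "private_of (u \<circ> \<pi>) (\<lambda>k\<in>{..<2 * n}. e (f k)) q = private_of u e (\<pi> q)" if "q < n" for q
        using that n_ge by (simp add: private_of_def posterior_mean_permute[OF \<pi>] f_def \<pi>0)
      show "peer_obs p (u \<circ> \<pi>) (\<lambda>k\<in>{..<2 * n}. e (f k)) q = (peer_obs (\<pi> p) u e \<circ> \<pi>) q"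
        using q p \<pi>n[OF q] by (auto simp: peer_obs_def priv \<pi>0 \<pi>i) (auto simp: f_def)
    qed
    also have "\<dots> = h (peer_obs (\<pi> p) u e)" using ex \<pi> by (simp add: exchangeable_def)
    finally show "of_bool (0 \<le> h (peer_obs p (u \<circ> \<pi>) (\<lambda>k\<in>{..<2 * n}. e (f k))))
        = (of_bool (0 \<le> h (peer_obs (\<pi> p) u e)) :: real)" by simp
  qed
  finally show ?thesis .
qed

end

section \<open>The equilibrium threshold\<close>

locale contracting_game = global_game +
  assumes w_less: "coeff_w \<sigma> \<tau> n < \<tau>"
begin

text \<open>The first member of the maximum in \<open>coeff_w\<close> is (n - 1) / \<beta> plus a
  term that contains the factor \<open>coeff_e\<close> and is nonnegative.\<close>

lemma beta_tau: "real n - 1 < \<beta> * \<tau>"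
proof -
  define e where "e = coeff_e \<sigma> \<tau> n"
  have "0 \<le> coeff_d \<sigma> \<tau> n"
  proof -
    have "0 < eta2 \<sigma> \<tau> (n - 1)"
      unfolding eta2_def using n_ge sigma_pos by (intro divide_pos_pos add_pos_nonneg) (auto simp: of_nat_diff)
    then show ?thesis by (simp add: coeff_d_def gamma2_def)
  qed
  then have e: "0 \<le> e" by (simp add: e_def coeff_e_def le_max_iff_disj)
  have "(real n - 1) * \<beta> / \<beta>\<^sup>2 \<le> (real n - 1) * (e * (real n * \<alpha> + (real n - 2) * \<beta>) + \<beta>) / \<beta>\<^sup>2"
    using e constants_pos n_ge by (intro divide_right_mono mult_left_mono) auto
  also have "\<dots> \<le> coeff_w \<sigma> \<tau> n"
    by (simp add: coeff_w_def Let_def \<alpha>_def \<beta>_def e_def)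
  also have "\<dots> < \<tau>" by (rule w_less)
  finally have "(real n - 1) / \<beta> < \<tau>" using constants_pos(2) by (simp add: power2_eq_square)
  then show ?thesis using constants_pos by (simp add: pos_divide_less_eq mult.commute)
qed

text \<open>The product is below 2 / sqrt (2 * pi), about 0.8. The value 9/10 is a convenient
  rational bound for which pi > 3 is precise enough.\<close>

lemma gamma_contracts: "(real n - 1) * \<gamma> \<le> 9 / 10"
proof -
  have bt: "0 < \<beta> * \<tau>" using constants_pos tau_pos by simp
  have "(20 / 9)\<^sup>2 \<le> 2 * pi" using pi_gt3 by (simp add: power2_eq_square)
  then have s: "20 / 9 \<le> sqrt (2 * pi)" by (rule real_le_rsqrt)
  have "(real n - 1) * \<gamma> = (real n - 1) / (\<beta> * \<tau>) * (2 / sqrt (2 * pi))" by (simp add: \<gamma>_def)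
  also have "\<dots> \<le> 1 * (2 / sqrt (2 * pi))"
    using beta_tau bt by (intro mult_right_mono) auto
  also have "\<dots> \<le> 2 / (20 / 9)" using s by (simp only: mult_1_left, intro divide_left_mono) auto
  finally show ?thesis by simp
qed

lemma sum_gamma_le:
  assumes "\<And>p. p \<in> {1..<n} \<Longrightarrow> \<bar>f p - g p\<bar> \<le> \<gamma> * r" "0 \<le> r"
  shows "\<bar>(\<Sum>p=1..<n. f p) - (\<Sum>p=1..<n. g p)\<bar> \<le> 9 / 10 * r"
proof -
  have "\<bar>(\<Sum>p=1..<n. f p) - (\<Sum>p=1..<n. g p)\<bar> \<le> (\<Sum>p=1..<n. \<bar>f p - g p\<bar>)"
    unfolding sum_subtractf[symmetric] by (rule sum_abs)
  also have "\<dots> \<le> (\<Sum>p=1..<n. \<gamma> * r)" by (intro sum_mono assms)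
  also have "\<dots> = (real n - 1) * \<gamma> * r" using n_ge by (simp add: of_nat_diff)
  also have "\<dots> \<le> 9 / 10 * r" using gamma_contracts assms(2) by (rule mult_right_mono)
  finally show ?thesis .
qed

text \<open>The constant 10 is the solution of L = 9/10 * L + 1: the peers contribute 9/10 * L and
  the posterior mean contributes 1, so the class is invariant under \<open>gain\<close>.\<close>

definition admissible :: "((nat \<Rightarrow> real) \<Rightarrow> real) \<Rightarrow> bool" where
  "admissible h \<longleftrightarrow> sup_lipschitz 10 h \<and> steep h \<and> exchangeable h"

lemma admissible_gain:
  assumes "admissible h"
  shows "admissible (gain h)"
proof -
  have L: "sup_lipschitz 10 h" and st: "steep h" and ex: "exchangeable h"
    using assms by (auto simp: admissible_def)
  have "sup_lipschitz 10 (gain h)"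
    unfolding sup_lipschitz_def
  proof (intro allI impI)
    fix u v :: "nat \<Rightarrow> real" and r assume uv: "\<forall>q<n. \<bar>u q - v q\<bar> \<le> r"
    then have r: "0 \<le> r" using n_ge by (meson abs_ge_zero order_trans less_le_trans zero_less_numeral)
    have "\<bar>peer_prob h p u - peer_prob h p v\<bar> \<le> \<gamma> * (10 * r)" if p: "p \<in> {1..<n}" for p
      unfolding peer_prob_def[of h p v]
    proof (rule peer_prob_close[OF st L p])
      have [measurable]: "(\<lambda>e. h (peer_obs p v e)) \<in> borel_measurable (PiM {..<2 * n} (\<lambda>_. borel))"
        using sup_lipschitz_peer_obs_measurable[OF L] p by simp
      show "Measurable.pred (PiM {..<2 * n} (\<lambda>_. borel)) (\<lambda>e. 0 \<le> h (peer_obs p v e))" by measurable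
      \<comment> \<open>Different signs at observations at distance at most r force both values of h
        to be at most 10 * r in modulus.\<close>
      fix e assume "(0 \<le> h (peer_obs p u e)) \<noteq> (0 \<le> h (peer_obs p v e))"
      moreover have "\<forall>q<n. \<bar>peer_obs p u e q - peer_obs p v e q\<bar> \<le> r"
        using uv p by (intro allI impI peer_obs_lipschitz) auto
      then have "\<bar>h (peer_obs p u e) - h (peer_obs p v e)\<bar> \<le> 10 * r"
        by (intro sup_lipschitzD[OF L]) simp
      ultimately show "\<bar>h (peer_obs p u e)\<bar> \<le> 10 * r" by auto
    qed (use r in auto)
    then have "\<bar>(\<Sum>p=1..<n. peer_prob h p u) - (\<Sum>p=1..<n. peer_prob h p v)\<bar> \<le> 9 / 10 * (10 * r)"
      using r by (intro sum_gamma_le) auto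
    moreover have "\<bar>posterior_mean u - posterior_mean v\<bar> \<le> r"
      using uv by (intro posterior_mean_lipschitz) auto
    ultimately show "\<bar>gain h u - gain h v\<bar> \<le> 10 * r" unfolding gain_def by linarith
  qed
  moreover have "steep (gain h)"
    unfolding steep_def
  proof (intro allI impI)
    fix u :: "nat \<Rightarrow> real" and p t assume p: "p < n" "u p < t"
    \<comment> \<open>The peers can only become less likely to act, so the slope comes entirely from
      the posterior mean.\<close>
    have "(\<Sum>p'=1..<n. peer_prob h p' (u(p := t))) \<le> (\<Sum>p'=1..<n. peer_prob h p' u)"
      using p by (intro sum_mono peer_prob_antimono[OF st L]) auto
    then show "gain h (u(p := t)) \<le> gain h u - \<beta> * (t - u p)"
      using posterior_mean_update[of p u t] p by (simp add: gain_def del: fun_upd_apply)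
  qed
  moreover have "exchangeable (gain h)"
    unfolding exchangeable_def
  proof (intro allI impI)
    fix u :: "nat \<Rightarrow> real" and \<pi> assume \<pi>: "\<pi> permutes {1..<n}"
    have "(\<Sum>p=1..<n. peer_prob h p (u \<circ> \<pi>)) = (\<Sum>p=1..<n. peer_prob h (\<pi> p) u)"
      by (intro sum.cong refl peer_prob_permute[OF \<pi> ex L]) simp
    also have "\<dots> = (\<Sum>p=1..<n. peer_prob h p u)"
      using sum.permute[OF \<pi>, of "\<lambda>p. peer_prob h p u"] by (simp add: o_def)
    finally show "gain h (u \<circ> \<pi>) = gain h u"
      by (simp add: gain_def posterior_mean_permute[OF \<pi>])
  qed
  ultimately show ?thesis by (simp add: admissible_def)
qed

text \<open>Where h and h' differ in sign, |h| is at most their distance r. The posterior mean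
  cancels.\<close>

lemma gain_contracts:
  assumes h: "steep h" "sup_lipschitz L h" and h': "sup_lipschitz L' h'"
    and r: "\<And>v. \<bar>h v - h' v\<bar> \<le> r"
  shows "\<bar>gain h u - gain h' u\<bar> \<le> 9 / 10 * r"
proof -
  have r0: "0 \<le> r" using r[of undefined] by linarith
  have "\<bar>peer_prob h p u - peer_prob h' p u\<bar> \<le> \<gamma> * r" if p: "p \<in> {1..<n}" for p
    unfolding peer_prob_def[of h']
  proof (rule peer_prob_close[OF h p r0])
    have [measurable]: "(\<lambda>e. h' (peer_obs p u e)) \<in> borel_measurable (PiM {..<2 * n} (\<lambda>_. borel))"
      using sup_lipschitz_peer_obs_measurable[OF h'] p by simp
    show "Measurable.pred (PiM {..<2 * n} (\<lambda>_. borel)) (\<lambda>e. 0 \<le> h' (peer_obs p u e))" by measurable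
    show "\<bar>h (peer_obs p u e)\<bar> \<le> r" if "(0 \<le> h (peer_obs p u e)) \<noteq> (0 \<le> h' (peer_obs p u e))" for e
      using that r[of "peer_obs p u e"] by auto
  qed
  then have "\<bar>(\<Sum>p=1..<n. peer_prob h p u) - (\<Sum>p=1..<n. peer_prob h' p u)\<bar> \<le> 9 / 10 * r"
    using r0 by (intro sum_gamma_le) auto
  then show ?thesis by (simp add: gain_def)
qed

text \<open>The functions are unbounded, so the supremum distance need not be finite. Iteration
  starts at minus the posterior mean, which \<open>gain\<close> moves by at most n; from there the
  steps shrink geometrically and all properties pass to the limit.\<close>

lemma gain_fixpoint:
  obtains h where "admissible h" "\<And>u. gain h u = h u"
proof -
  define H where "H l = (gain ^^ l) (\<lambda>u. - posterior_mean u)" for l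
  have H_Suc: "H (Suc l) = gain (H l)" for l by (simp add: H_def)
  have "admissible (H 0)"
    unfolding admissible_def H_def funpow_0
  proof (intro conjI)
    show "sup_lipschitz 10 (\<lambda>u. - posterior_mean u)"
      unfolding sup_lipschitz_def
    proof (intro allI impI)
      fix u v :: "nat \<Rightarrow> real" and r assume uv: "\<forall>q<n. \<bar>u q - v q\<bar> \<le> r"
      then have "\<bar>posterior_mean u - posterior_mean v\<bar> \<le> r" by (intro posterior_mean_lipschitz) auto
      then show "\<bar>- posterior_mean u - - posterior_mean v\<bar> \<le> 10 * r" by linarith
    qed
    show "steep (\<lambda>u. - posterior_mean u)"
      unfolding steep_def using posterior_mean_update by (smt (verit) less_imp_le)
    show "exchangeable (\<lambda>u. - posterior_mean u)"
      unfolding exchangeable_def by (simp add: posterior_mean_permute)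
  qed
  then have adm: "admissible (H l)" for l
    by (induction l) (auto simp: H_Suc intro: admissible_gain)
  have step: "\<bar>H l u - H (Suc l) u\<bar> \<le> (9 / 10) ^ l * real n" for l u
  proof (induction l arbitrary: u)
    case 0
    have pp: "0 \<le> peer_prob (H 0) p u" "peer_prob (H 0) p u \<le> 1" for p
      unfolding peer_prob_def by (rule integral_of_bool_bounds)+
    have "0 \<le> (\<Sum>p=1..<n. peer_prob (H 0) p u)" by (intro sum_nonneg pp)
    moreover have "(\<Sum>p=1..<n. peer_prob (H 0) p u) \<le> (\<Sum>p=1..<n. 1)" by (intro sum_mono pp)
    moreover have "H 0 u = - posterior_mean u" by (simp add: H_def)
    ultimately show ?case using n_ge unfolding H_Suc gain_def by (simp add: of_nat_diff)
  next
    case (Suc l)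
    show ?case
      using gain_contracts[of "H l" 10 10 "H (Suc l)", OF _ _ _ Suc] adm[of l] adm[of "Suc l"]
      unfolding H_Suc by (simp add: admissible_def mult.assoc)
  qed
  \<comment> \<open>Partial sums of the geometric series; the factor 10 is 1 / (1 - 9/10).\<close>
  have far: "\<bar>H l u - H (l + k) u\<bar> \<le> (9 / 10) ^ l * (10 * real n) * (1 - (9 / 10) ^ k)" for l k u
  proof (induction k)
    case (Suc k)
    have "\<bar>H l u - H (l + Suc k) u\<bar> \<le> \<bar>H l u - H (l + k) u\<bar> + \<bar>H (l + k) u - H (Suc (l + k)) u\<bar>"
      by simp
    also have "\<dots> \<le> (9 / 10) ^ l * (10 * real n) * (1 - (9 / 10) ^ k) + (9 / 10) ^ (l + k) * real n"
      by (intro add_mono Suc step)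
    also have "\<dots> = (9 / 10) ^ l * (10 * real n) * (1 - (9 / 10) ^ Suc k)"
      by (simp add: power_add algebra_simps)
    finally show ?case .
  qed simp
  have far': "\<bar>H l u - H (l + k) u\<bar> \<le> (9 / 10) ^ l * (10 * real n)" for l k u
    by (rule order_trans[OF far mult_left_le]) auto
  have null: "(\<lambda>l. (9 / 10) ^ l * c) \<longlonglongrightarrow> 0" for c :: real
    by (intro tendsto_mult_left_zero LIMSEQ_power_zero) simp
  have "Cauchy (\<lambda>l. H l u)" for u
  proof (rule metric_CauchyI)
    fix \<epsilon> :: real assume "0 < \<epsilon>"
    then obtain M where M: "\<And>l. l \<ge> M \<Longrightarrow> (9 / 10) ^ l * (10 * real n) < \<epsilon> / 2"
      using order_tendstoD(2)[OF null, of "\<epsilon> / 2" "10 * real n"] by (auto simp: eventually_sequentially)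
    have "dist (H l u) (H l' u) < \<epsilon>" if "l \<ge> M" "l' \<ge> M" for l l'
      using far'[of M u "l - M"] far'[of M u "l' - M"] M[of M] that by (simp add: dist_real_def)
    then show "\<exists>M. \<forall>m\<ge>M. \<forall>n\<ge>M. dist (H m u) (H n u) < \<epsilon>" by blast
  qed
  then have "\<exists>h. \<forall>u. (\<lambda>l. H l u) \<longlonglongrightarrow> h u"
    by (intro choice allI) (auto simp: Cauchy_convergent_iff convergent_def)
  then obtain h where h: "\<And>u. (\<lambda>l. H l u) \<longlonglongrightarrow> h u" by auto
  have "admissible h"
    unfolding admissible_def
  proof (intro conjI)
    show "sup_lipschitz 10 h"
      unfolding sup_lipschitz_def
    proof (intro allI impI)
      fix u v :: "nat \<Rightarrow> real" and r assume uv: "\<forall>q<n. \<bar>u q - v q\<bar> \<le> r"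
      have "(\<lambda>l. \<bar>H l u - H l v\<bar>) \<longlonglongrightarrow> \<bar>h u - h v\<bar>" by (intro tendsto_intros h)
      then show "\<bar>h u - h v\<bar> \<le> 10 * r"
        by (rule Lim_bounded[where M = 0]) (use adm uv in \<open>auto simp: admissible_def sup_lipschitz_def\<close>)
    qed
    show "steep h"
      unfolding steep_def
    proof (intro allI impI)
      fix u :: "nat \<Rightarrow> real" and p t assume p: "p < n" "u p < t"
      have "(\<lambda>l. H l u - \<beta> * (t - u p)) \<longlonglongrightarrow> h u - \<beta> * (t - u p)" by (intro tendsto_intros h)
      then show "h (u(p := t)) \<le> h u - \<beta> * (t - u p)"
        by (rule LIMSEQ_le[OF h]) (use adm p in \<open>auto simp: admissible_def steep_def\<close>)
    qed
    show "exchangeable h"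
      unfolding exchangeable_def
    proof (intro allI impI)
      fix u :: "nat \<Rightarrow> real" and \<pi> assume \<pi>: "\<pi> permutes {1..<n}"
      have "(\<lambda>l. H l (u \<circ> \<pi>)) = (\<lambda>l. H l u)" using adm \<pi> by (auto simp: admissible_def exchangeable_def)
      then show "h (u \<circ> \<pi>) = h u" using h[of "u \<circ> \<pi>"] h[of u] by (simp add: LIMSEQ_unique)
    qed
  qed
  moreover have "gain h u = h u" for u
  proof -
    have hl: "\<bar>h v - H l v\<bar> \<le> (9 / 10) ^ l * (10 * real n)" for v l
    proof -
      have "(\<lambda>k. \<bar>H l v - H (l + k) v\<bar>) \<longlonglongrightarrow> \<bar>H l v - h v\<bar>"
        using LIMSEQ_ignore_initial_segment[OF h[of v], of l] by (intro tendsto_intros) (simp add: add.commute)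
      then have "\<bar>H l v - h v\<bar> \<le> (9 / 10) ^ l * (10 * real n)"
        by (rule Lim_bounded[where M = 0]) (use far' in auto)
      then show ?thesis by linarith
    qed
    have "\<bar>gain h u - H (Suc l) u\<bar> \<le> (9 / 10) ^ l * (9 * real n)" for l
      using gain_contracts[of h 10 10 "H l", OF _ _ _ hl] \<open>admissible h\<close> adm[of l]
      unfolding H_Suc by (simp add: admissible_def ac_simps)
    then have "(\<lambda>l. gain h u - H (Suc l) u) \<longlonglongrightarrow> 0"
      by (intro Lim_null_comparison[OF _ null[of "9 * real n"]]) auto
    moreover have "(\<lambda>l. gain h u - H (Suc l) u) \<longlonglongrightarrow> gain h u - h u"
      by (intro tendsto_intros LIMSEQ_Suc h)
    ultimately show ?thesis using LIMSEQ_unique by fastforce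
  qed
  ultimately show thesis by (rule that)
qed

end

section \<open>From a fixed point to an equilibrium\<close>

context global_game
begin

lemma expected_others_eq:
  assumes i: "i < n" and L: "sup_lipschitz L h" and ex: "exchangeable h"
  shows "expected_others n \<sigma> \<tau> i (\<lambda>i. threshold_strategy h) u = (\<Sum>p=1..<n. peer_prob h p u)"
proof -
  let ?H = "hidden n i"
  let ?J = "{..<n} - {i}"
  let ?g = "\<lambda>v. real (threshold_strategy h v)"
  obtain ks where ks: "distinct ks" "set ks = hidden n i" "triangular (hidden_mean i u) ks"
    by (rule triangular_hidden)
  have [measurable]: "h \<in> borel_measurable (PiM {..<n} (\<lambda>_. borel))"
    by (rule sup_lipschitz_measurable[OF L])
  have g: "?g \<in> borel_measurable (PiM {..<n} (\<lambda>_. borel))" "\<And>\<pi> v. \<pi> permutes {1..<n} \<Longrightarrow> ?g (v \<circ> \<pi>) = ?g v"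
    using ex unfolding threshold_strategy_def exchangeable_def by (measurable, auto)
  have peer: "cond_expectation n \<sigma> \<tau> i u (\<lambda>\<omega>. ?g (obs n j \<omega>)) = peer_prob h (msg_pos i j) u"
    "(\<lambda>w. ?g (obs n j (complete_state i u w))) \<in> borel_measurable (PiM ?H (\<lambda>_. borel))"
    if "j \<in> ?J" for j
  proof -
    have "cond_expectation n \<sigma> \<tau> i u (\<lambda>\<omega>. ?g (obs n j \<omega>))
        = (\<integral>e. ?g (restrict (peer_obs (msg_pos i j) u e) {..<n}) \<partial>noise_space)"
      using that by (intro cond_expectation_peer(1)[OF i _ _ g]) auto
    also have "\<dots> = peer_prob h (msg_pos i j) u"
      unfolding peer_prob_def
    proof (intro Bochner_Integration.integral_cong refl)
      fix e :: "nat \<Rightarrow> real"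
      have "h (restrict (peer_obs (msg_pos i j) u e) {..<n}) = h (peer_obs (msg_pos i j) u e)"
        by (rule sup_lipschitz_cong[OF L]) simp
      then show "?g (restrict (peer_obs (msg_pos i j) u e) {..<n}) = of_bool (0 \<le> h (peer_obs (msg_pos i j) u e))"
        by (simp add: threshold_strategy_def)
    qed
    finally show "cond_expectation n \<sigma> \<tau> i u (\<lambda>\<omega>. ?g (obs n j \<omega>)) = peer_prob h (msg_pos i j) u" .
    show "(\<lambda>w. ?g (obs n j (complete_state i u w))) \<in> borel_measurable (PiM ?H (\<lambda>_. borel))"
      using that by (intro cond_expectation_peer(2)[OF i _ _ g]) auto
  qed
  let ?A = "affine_noise (hidden_mean i u) hidden_sd ks"
  have "?A \<in> PiM ?H (\<lambda>_. borel) \<rightarrow>\<^sub>M PiM ?H (\<lambda>_. borel)"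
    using measurable_affine_noise[OF ks(3), of hidden_sd] unfolding ks(2) .
  then have mA: "?A \<in> std_noise ?H \<rightarrow>\<^sub>M PiM ?H (\<lambda>_. borel)" by measurable
  have "expected_others n \<sigma> \<tau> i (\<lambda>i. threshold_strategy h) u
      = (\<integral>e. (\<Sum>j\<in>?J. ?g (obs n j (complete_state i u (?A e)))) \<partial>std_noise ?H)"
    unfolding expected_others_def
    by (rule cond_expectation_eq[OF i ks]) (intro borel_measurable_sum peer)
  also have "\<dots> = (\<Sum>j\<in>?J. \<integral>e. ?g (obs n j (complete_state i u (?A e))) \<partial>std_noise ?H)"
  proof (rule Bochner_Integration.integral_sum)
    fix j assume "j \<in> ?J"
    then have "(\<lambda>e. ?g (obs n j (complete_state i u (?A e)))) \<in> borel_measurable (std_noise ?H)"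
      by (intro measurable_compose[OF mA] peer)
    then show "integrable (std_noise ?H) (\<lambda>e. ?g (obs n j (complete_state i u (?A e))))"
      by (rule finite_measure.integrable_const_bound[OF prob_space.finite_measure[OF prob_space_std_noise], of _ 1, rotated])
        (auto simp: threshold_strategy_def)
  qed
  also have "\<dots> = (\<Sum>j\<in>?J. peer_prob h (msg_pos i j) u)"
    by (intro sum.cong refl, subst peer(1)[symmetric]) (auto intro!: cond_expectation_eq[OF i ks, symmetric] peer)
  also have "\<dots> = (\<Sum>p=1..<n. peer_prob h p u)"
    by (rule sum.reindex_bij_betw[OF bij_betw_sender[OF i], symmetric, THEN trans]) (auto simp: msg_pos_sender)
  finally show ?thesis .
qed

text \<open>At a fixed point, h u is the conditional expectation of the gain from the risky action,
  and its sign prescribes the best response.\<close>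

lemma threshold_equilibrium:
  assumes L: "sup_lipschitz L h" and ex: "exchangeable h" and fp: "\<And>u. gain h u = h u"
  shows "bayesian_nash_equilibrium n \<sigma> \<tau> (\<lambda>i. threshold_strategy h)"
  unfolding bayesian_nash_equilibrium_def
proof (intro conjI allI impI)
  have [measurable]: "h \<in> borel_measurable (PiM {..<n} (\<lambda>_. borel))"
    by (rule sup_lipschitz_measurable[OF L])
  show "strategy n (threshold_strategy h)"
    unfolding strategy_def threshold_strategy_def by measurable
next
  fix i assume i: "i < n"
  show "best_response n \<sigma> \<tau> i (\<lambda>i. threshold_strategy h) (threshold_strategy h)"
    unfolding best_response_def expected_others_eq[OF i L ex] expected_fundamental_eq[OF i]
    using fp by (auto simp: threshold_strategy_def gain_def[abs_def] algebra_simps not_less)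
qed

lemma steep_continuous_threshold_function:
  assumes L: "sup_lipschitz L h" and ex: "exchangeable h" and st: "steep h"
  shows "continuous_threshold_function n h"
  unfolding continuous_threshold_function_def symmetric_roots_def
proof (intro conjI ballI allI impI)
  show "continuous_on (Rn n) h" by (rule sup_lipschitz_continuous_on[OF L])
  fix u :: "nat \<Rightarrow> real" and p t assume p: "p < n" "u p < t"
  then have "h (u(p := t)) \<le> h u - \<beta> * (t - u p)" using st by (auto simp: steep_def)
  moreover have "0 < \<beta> * (t - u p)" using p constants_pos by simp
  ultimately show "h (u(p := t)) < h u" by linarith
next
  fix u :: "nat \<Rightarrow> real" and \<pi> assume "h u = 0" "\<pi> permutes {1..<n}"
  then show "h (u \<circ> \<pi>) = 0" using ex by (simp add: exchangeable_def)
qed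

end

section \<open>Discretized Gaussian noise\<close>

text \<open>The normal law is approximated on the grid of mesh 1/K by the weights
  $(1 - y^2 / (2 N))^N$ with $N = 2 K^2$, which are integers after scaling by a common factor.\<close>

definition noise_weight :: "nat \<Rightarrow> nat \<Rightarrow> nat" where
  "noise_weight K d = (d * (4 * K\<^sup>2 - d)) ^ (2 * K\<^sup>2)"

definition noise_value :: "nat \<Rightarrow> nat \<Rightarrow> int" where
  "noise_value K d = int d - int (2 * K\<^sup>2)"

definition noise_total :: "nat \<Rightarrow> nat" where
  "noise_total K = (\<Sum>d<4 * K\<^sup>2. noise_weight K d)"

definition grid_mean :: "nat \<Rightarrow> (int \<Rightarrow> real) \<Rightarrow> real" where
  "grid_mean K G = (\<Sum>d<4 * K\<^sup>2. real (noise_weight K d) * G (noise_value K d)) / real (noise_total K)"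

lemma noise_total_pos: "1 \<le> K \<Longrightarrow> 0 < noise_total K"
  unfolding noise_total_def
  by (rule sum_pos2[where i = "2 * K\<^sup>2"]) (auto simp: noise_weight_def)

text \<open>Put s = t / N. Above, 1 - s \<le> exp (- s). Below, (1 - s) * exp s \<ge> (1 - s) * (1 +
  s), and Bernoulli bounds the N-th power by 1 - N * s * s, which is 1 minus the relative error
  claimed. For t > N that relative error exceeds 1 and the claim is trivial.\<close>

lemma exp_minus_power_le:
  fixes t :: real and N :: nat
  assumes t: "0 \<le> t" and N: "1 \<le> N"
  shows "\<bar>exp (- t) - max 0 (1 - t / real N) ^ N\<bar> \<le> exp (- t) * (t\<^sup>2 / real N)"
proof (cases "t \<le> real N")
  case True
  define s where "s = t / real N"
  have s: "0 \<le> s" "s \<le> 1" "t = real N * s" using t N True by (auto simp: s_def)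
  have e: "exp (- t) = exp (- s) ^ N" by (simp add: s(3) exp_of_nat_mult[symmetric])
  have "1 - s \<le> exp (- s)" using exp_ge_add_one_self[of "- s"] by simp
  then have up: "(1 - s) ^ N \<le> exp (- t)" unfolding e using s by (intro power_mono) auto
  have "(1 - s) * exp s \<ge> (1 - s) * (1 + s)" using exp_ge_add_one_self[of s] s by (intro mult_left_mono) auto
  then have "(1 - s\<^sup>2) ^ N \<le> ((1 - s) * exp s) ^ N"
    using s by (intro power_mono) (auto simp: power2_eq_square algebra_simps mult_le_one)
  moreover have "1 - real N * s\<^sup>2 \<le> (1 - s\<^sup>2) ^ N"
    using Bernoulli_inequality[of "- s\<^sup>2" N] s by (simp add: power_le_one)
  ultimately have "1 - real N * s\<^sup>2 \<le> (1 - s) ^ N * exp t"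
    by (simp add: power_mult_distrib exp_of_nat_mult[symmetric] s(3))
  then have *: "(1 - real N * s\<^sup>2) * exp (- t) \<le> (1 - s) ^ N * exp t * exp (- t)" by (intro mult_right_mono) auto
  have lo: "exp (- t) - exp (- t) * (real N * s\<^sup>2) \<le> (1 - s) ^ N"
  proof -
    have "exp t * exp (- t) = 1" by (simp add: exp_add[symmetric])
    then have "(1 - s) ^ N * exp t * exp (- t) = (1 - s) ^ N" by (simp only: mult.assoc mult_1_right)
    moreover have "exp (- t) - exp (- t) * (real N * s\<^sup>2) = (1 - real N * s\<^sup>2) * exp (- t)"
      by (simp add: algebra_simps)
    ultimately show ?thesis using * by (simp only:)
  qed
  have "real N * s\<^sup>2 = t\<^sup>2 / real N" using N by (simp add: s_def power2_eq_square)
  moreover have "max 0 (1 - t / real N) = 1 - s" using s(1,2) by (simp add: s_def[symmetric])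
  ultimately show ?thesis using up lo by simp
next
  case False
  then have "1 * 1 \<le> t * (t / real N)" using N by (intro mult_mono) auto
  then have "1 \<le> t\<^sup>2 / real N" by (simp add: power2_eq_square)
  moreover have "max 0 (1 - t / real N) = 0" using False N by (simp add: max_def)
  moreover have "0 ^ N = (0 :: real)" using N by simp
  ultimately have "\<bar>exp (- t) - max 0 (1 - t / real N) ^ N\<bar> = exp (- t) * 1" by (simp only:) simp
  also have "\<dots> \<le> exp (- t) * (t\<^sup>2 / real N)" using \<open>1 \<le> t\<^sup>2 / real N\<close> by (intro mult_left_mono) auto
  finally show ?thesis .
qed

lemma abs_exp_diff_le:
  fixes a b :: real
  assumes "c \<le> a" "c \<le> b"
  shows "\<bar>exp (- a) - exp (- b)\<bar> \<le> \<bar>a - b\<bar> * exp (- c)"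
proof -
  have le: "\<bar>exp (- a) - exp (- b)\<bar> \<le> \<bar>a - b\<bar> * exp (- c)" if "a \<le> b" "c \<le> a" for a b :: real
  proof -
    have "1 - (b - a) \<le> exp (- (b - a))" using exp_ge_add_one_self[of "- (b - a)"] by linarith
    then have "exp (- a) * (1 - (b - a)) \<le> exp (- a) * exp (- (b - a))" by (intro mult_left_mono) auto
    also have "\<dots> = exp (- b)" by (simp add: exp_add[symmetric])
    finally have "exp (- a) - exp (- b) \<le> (b - a) * exp (- a)" by (simp add: algebra_simps)
    also have "\<dots> \<le> (b - a) * exp (- c)" using that by (intro mult_left_mono) auto
    finally show ?thesis using that by simp
  qed
  show ?thesis using le[of a b] le[of b a] assms by (cases "a \<le> b") (auto simp: abs_minus_commute)
qed

text \<open>The bound keeps a Gaussian factor of variance 4, so that it can be integrated over the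
  line; the rest of the exponent absorbs polynomial factors. Moving x to the grid point y
  contributes 6, replacing the exponential by a power contributes 32.\<close>

lemma density_error:
  fixes x y :: real
  assumes K: "1 \<le> K" and xy: "0 \<le> x - y" "x - y \<le> 1 / real K"
  shows "\<bar>exp (- x\<^sup>2 / 2) - max 0 (1 - y\<^sup>2 / 2 / real (2 * K\<^sup>2)) ^ (2 * K\<^sup>2)\<bar> \<le> 38 / real K * exp (- x\<^sup>2 / 8)"
proof -
  have K1: "1 / real K \<le> 1" "real K \<le> real (2 * K\<^sup>2)"
    using K by (auto simp: power2_eq_square simp flip: of_nat_mult)
  have e2: "exp (1 / 2 :: real) \<le> 2"
    using exp_half_le2 by simp
  have "x\<^sup>2 \<le> 2 * y\<^sup>2 + 2 * (x - y)\<^sup>2"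
    using zero_le_power2[of "2 * y - x"] by (simp add: power2_eq_square algebra_simps)
  moreover have "(x - y)\<^sup>2 \<le> 1" using xy K1 by (simp add: power_le_one)
  ultimately have y2: "x\<^sup>2 / 2 - 1 \<le> y\<^sup>2" by simp
  have "\<bar>exp (- (x\<^sup>2 / 2)) - exp (- (y\<^sup>2 / 2))\<bar> \<le> \<bar>x\<^sup>2 / 2 - y\<^sup>2 / 2\<bar> * exp (- (x\<^sup>2 / 4 - 1 / 2))"
    using y2 zero_le_power2[of x] by (intro abs_exp_diff_le) linarith+
  also have "\<bar>x\<^sup>2 / 2 - y\<^sup>2 / 2\<bar> = (x - y) * (\<bar>x + y\<bar> / 2)"
  proof -
    have "x\<^sup>2 / 2 - y\<^sup>2 / 2 = (x - y) * ((x + y) / 2)" by (simp add: power2_eq_square algebra_simps)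
    then have "\<bar>x\<^sup>2 / 2 - y\<^sup>2 / 2\<bar> = \<bar>x - y\<bar> * \<bar>(x + y) / 2\<bar>" by (simp only: abs_mult)
    moreover have "\<bar>x - y\<bar> = x - y" "\<bar>(x + y) / 2\<bar> = \<bar>x + y\<bar> / 2" using xy by auto
    ultimately show ?thesis by (simp only:)
  qed
  also have "(x - y) * (\<bar>x + y\<bar> / 2) \<le> 1 / real K * (3 * exp (x\<^sup>2 / 8))"
  proof (intro mult_mono)
    have "0 \<le> (\<bar>x\<bar> - 4)\<^sup>2" by simp
    then have "\<bar>x\<bar> \<le> 2 + x\<^sup>2 / 8" by (simp add: power2_eq_square algebra_simps)
    moreover have "1 + x\<^sup>2 / 8 \<le> exp (x\<^sup>2 / 8)" by (rule exp_ge_add_one_self)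
    moreover have "\<bar>x + y\<bar> / 2 \<le> \<bar>x\<bar> + 1" using xy(1) order_trans[OF xy(2) K1(1)] by (auto simp: abs_if)
    moreover have "0 \<le> x\<^sup>2 / 8" by simp
    ultimately show "\<bar>x + y\<bar> / 2 \<le> 3 * exp (x\<^sup>2 / 8)" by linarith
  qed (use xy in auto)
  also have "1 / real K * (3 * exp (x\<^sup>2 / 8)) * exp (- (x\<^sup>2 / 4 - 1 / 2)) = 3 / real K * exp (1 / 2) * exp (- x\<^sup>2 / 8)"
    by (simp add: exp_add[symmetric] mult.assoc)
  also have "\<dots> \<le> 3 / real K * 2 * exp (- x\<^sup>2 / 8)"
    using e2 by (intro mult_right_mono mult_left_mono) auto
  finally have 1: "\<bar>exp (- (x\<^sup>2 / 2)) - exp (- (y\<^sup>2 / 2))\<bar> \<le> 6 / real K * exp (- x\<^sup>2 / 8)"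
    by (simp add: mult_right_mono)
  define t where "t = y\<^sup>2 / 2"
  have t0: "0 \<le> t" by (simp add: t_def)
  have "\<bar>exp (- t) - max 0 (1 - t / real (2 * K\<^sup>2)) ^ (2 * K\<^sup>2)\<bar> \<le> exp (- t) * (t\<^sup>2 / real (2 * K\<^sup>2))"
    using K by (intro exp_minus_power_le t0) (simp add: power2_eq_square)
  also have "\<dots> \<le> exp (- t) * (16 * exp (t / 2) / real K)"
  proof (intro mult_left_mono frac_le)
    have "(t / 4)\<^sup>2 \<le> exp (t / 4) ^ 2"
    proof (rule power_mono)
      show "t / 4 \<le> exp (t / 4)" using exp_ge_add_one_self[of "t / 4"] by linarith
    qed (use t0 in simp)
    also have "exp (t / 4) ^ 2 = exp (t / 2)" by (simp add: exp_double[symmetric])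
    finally show "t\<^sup>2 \<le> 16 * exp (t / 2)" by (simp add: power2_eq_square)
  qed (use K K1 in auto)
  also have "\<dots> = 16 / real K * exp (- (t / 2))" by (simp add: exp_add[symmetric])
  also have "\<dots> \<le> 16 / real K * (exp (1 / 2) * exp (- x\<^sup>2 / 8))"
    using y2 unfolding exp_add[symmetric] by (intro mult_left_mono) (auto simp: t_def)
  also have "\<dots> \<le> 16 / real K * (2 * exp (- x\<^sup>2 / 8))"
    using e2 by (intro mult_left_mono mult_right_mono) auto
  finally have "\<bar>exp (- (y\<^sup>2 / 2)) - max 0 (1 - y\<^sup>2 / 2 / real (2 * K\<^sup>2)) ^ (2 * K\<^sup>2)\<bar> \<le> 32 / real K * exp (- x\<^sup>2 / 8)"
    by (simp add: t_def)
  with 1 have "\<bar>exp (- (x\<^sup>2 / 2)) - max 0 (1 - y\<^sup>2 / 2 / real (2 * K\<^sup>2)) ^ (2 * K\<^sup>2)\<bar>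
      \<le> 6 / real K * exp (- x\<^sup>2 / 8) + 32 / real K * exp (- x\<^sup>2 / 8)" by linarith
  also have "\<dots> = 38 / real K * exp (- x\<^sup>2 / 8)"
    by (simp add: distrib_right[symmetric] add_divide_distrib[symmetric])
  finally show ?thesis by simp
qed

lemma integral_floor_step:
  fixes c :: "int \<Rightarrow> real" and K :: nat
  assumes K: "1 \<le> K" and c: "\<And>z. z \<notin> {- m..<m} \<Longrightarrow> c z = 0"
  shows "integrable lborel (\<lambda>x. c \<lfloor>real K * x\<rfloor>)"
    "(\<integral>x. c \<lfloor>real K * x\<rfloor> \<partial>lborel) = (\<Sum>z\<in>{- m..<m}. c z) / real K"
proof -
  let ?I = "\<lambda>z. {of_int z / real K..<(of_int z + 1) / real K}"
  have "c \<lfloor>real K * x\<rfloor> = (\<Sum>z\<in>{- m..<m}. c z * indicator (?I z) x)" for x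
  proof -
    have "indicator (?I z) x = (if z = \<lfloor>real K * x\<rfloor> then 1 else 0 :: real)" for z
    proof -
      have "x \<in> ?I z \<longleftrightarrow> of_int z \<le> real K * x \<and> real K * x < of_int z + 1"
        using K by (simp add: pos_divide_le_eq pos_less_divide_eq mult.commute)
      also have "\<dots> \<longleftrightarrow> \<lfloor>real K * x\<rfloor> = z" by (simp add: floor_eq_iff)
      finally show ?thesis by (auto simp: indicator_def)
    qed
    then have "(\<Sum>z\<in>{- m..<m}. c z * indicator (?I z) x) = (\<Sum>z\<in>{- m..<m}. if z = \<lfloor>real K * x\<rfloor> then c z else 0)"
      by (intro sum.cong) auto
    also have "\<dots> = c \<lfloor>real K * x\<rfloor>" using c by (simp add: sum.delta)
    finally show ?thesis by simp
  qed
  note eq = this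
  have int: "integrable lborel (\<lambda>x. c z * indicator (?I z) x)" for z
    by (intro integrable_mult_right integrable_real_indicator) (simp_all add: divide_right_mono)
  then show "integrable lborel (\<lambda>x. c \<lfloor>real K * x\<rfloor>)"
    unfolding eq by (intro Bochner_Integration.integrable_sum)
  have "(\<integral>x. c \<lfloor>real K * x\<rfloor> \<partial>lborel) = (\<Sum>z\<in>{- m..<m}. \<integral>x. c z * indicator (?I z) x \<partial>lborel)"
    unfolding eq by (rule Bochner_Integration.integral_sum) (rule int)
  also have "\<dots> = (\<Sum>z\<in>{- m..<m}. c z * (1 / real K))"
  proof (intro sum.cong refl)
    fix z
    have "measure lborel (?I z) = 1 / real K"
      using K by (subst measure_lborel_Ico) (auto simp: divide_right_mono add_divide_distrib)
    then show "(\<integral>x. c z * indicator (?I z) x \<partial>lborel) = c z * (1 / real K)" by simp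
  qed
  finally show "(\<integral>x. c \<lfloor>real K * x\<rfloor> \<partial>lborel) = (\<Sum>z\<in>{- m..<m}. c z) / real K"
    by (simp add: sum_divide_distrib)
qed

text \<open>The step function \<open>\<psi>'\<close> is within 76 / K of the normal density in L1;
  76 is twice 38 because the bounding Gaussian has standard deviation 2. The exact scaling U
  involves pi, so \<open>grid_mean\<close> divides by the integer total weight instead. The case of
  a constant integrand shows that this costs another 76 / K.\<close>

lemma grid_mean_close:
  fixes G :: "int \<Rightarrow> real"
  assumes K: "1 \<le> K" and G: "\<And>z. \<bar>G z\<bar> \<le> 1"
  shows "\<bar>(\<integral>x. G \<lfloor>real K * x\<rfloor> \<partial>std_normal) - grid_mean K G\<bar> \<le> 152 / real K"
proof -
  define N where "N = 2 * K\<^sup>2"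
  define D where "D = sqrt (2 * pi)"
  have D: "0 < D" by (simp add: D_def)
  define \<psi> where "\<psi> z = max 0 (1 - (of_int z / real K)\<^sup>2 / 2 / real N) ^ N / D" for z :: int
  define R where "R = int N"
  have RK: "(of_int z / real K)\<^sup>2 / 2 / real N = (of_int z)\<^sup>2 / (of_int R)\<^sup>2" for z
    using K by (simp add: R_def N_def power2_eq_square)
  have N0: "0 < N" using K by (simp add: N_def)
  have \<psi>0: "\<psi> z = 0" if "z \<notin> {- R..<R}" for z
  proof -
    have "R\<^sup>2 \<le> z\<^sup>2" using that R_def
      by (auto simp: abs_le_square_iff[symmetric])
    then have "(of_int R)\<^sup>2 \<le> ((of_int z)\<^sup>2 :: real)" by (metis of_int_le_iff of_int_power)
    then have "1 \<le> (of_int z)\<^sup>2 / ((of_int R)\<^sup>2 :: real)" using N0 by (simp add: R_def)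
    then have "max 0 (1 - (of_int z / real K)\<^sup>2 / 2 / real N) = 0" unfolding RK by simp
    then show ?thesis using N0 by (simp add: \<psi>_def)
  qed
  have weight: "\<psi> (noise_value K d) = real (noise_weight K d) / (D * (of_int R)\<^sup>2 ^ N)" if d: "d < 4 * K\<^sup>2" for d
  proof -
    \<comment> \<open>With R = \<open>2 * K\<^sup>2\<close> the base of the power is 1 - (d - R)^2 /
      R^2 = d * (2 * R - d) / R^2, which is where the integer weights come from.\<close>
    have "R\<^sup>2 - (noise_value K d)\<^sup>2 = int (d * (4 * K\<^sup>2 - d))"
      using d by (simp add: R_def N_def noise_value_def power2_eq_square of_nat_diff algebra_simps)
    from arg_cong[OF this, of "of_int :: int \<Rightarrow> real"]
    have eq: "(of_int R)\<^sup>2 - (of_int (noise_value K d))\<^sup>2 = real (d * (4 * K\<^sup>2 - d))"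
      by (simp only: of_int_diff of_int_power of_int_of_nat_eq)
    have "(of_int R)\<^sup>2 \<noteq> (0 :: real)" using N0 by (simp add: R_def)
    then have "(1 :: real) - (of_int (noise_value K d))\<^sup>2 / (of_int R)\<^sup>2 = ((of_int R)\<^sup>2 - (of_int (noise_value K d))\<^sup>2) / (of_int R)\<^sup>2"
      by (simp add: diff_divide_distrib)
    also note eq
    finally have "(1 :: real) - (of_int (noise_value K d))\<^sup>2 / (of_int R)\<^sup>2 = real (d * (4 * K\<^sup>2 - d)) / (of_int R)\<^sup>2" .
    moreover have "max 0 (real (d * (4 * K\<^sup>2 - d)) / (of_int R)\<^sup>2) = real (d * (4 * K\<^sup>2 - d)) / (of_int R)\<^sup>2"
      by (intro max_absorb2 divide_nonneg_nonneg) auto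
    ultimately show ?thesis
      unfolding \<psi>_def RK noise_weight_def N_def[symmetric] by (simp only: power_divide of_nat_power divide_divide_eq_left mult.commute)
  qed
  define \<psi>' where "\<psi>' x = \<psi> \<lfloor>real K * x\<rfloor>" for x
  have [measurable]: "\<psi>' \<in> borel_measurable borel" unfolding \<psi>'_def by measurable
  have [measurable]: "(\<lambda>x. G \<lfloor>real K * x\<rfloor>) \<in> borel_measurable borel" by measurable
  define U where "U = 1 / (D * (of_int R)\<^sup>2 ^ N * real K)"
  have sumU: "integrable lborel (\<lambda>x. \<psi>' x * F \<lfloor>real K * x\<rfloor>)"
    "(\<integral>x. \<psi>' x * F \<lfloor>real K * x\<rfloor> \<partial>lborel) = U * (\<Sum>d<4 * K\<^sup>2. real (noise_weight K d) * F (noise_value K d))" for F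
  proof -
    have z: "\<And>z. z \<notin> {- R..<R} \<Longrightarrow> \<psi> z * F z = 0" using \<psi>0 by simp
    show "integrable lborel (\<lambda>x. \<psi>' x * F \<lfloor>real K * x\<rfloor>)"
      unfolding \<psi>'_def using integral_floor_step(1)[OF K z] .
    have "(\<integral>x. \<psi>' x * F \<lfloor>real K * x\<rfloor> \<partial>lborel) = (\<Sum>z\<in>{- R..<R}. \<psi> z * F z) / real K"
      unfolding \<psi>'_def using integral_floor_step(2)[OF K z] .
    also have "(\<Sum>z\<in>{- R..<R}. \<psi> z * F z) = (\<Sum>d<4 * K\<^sup>2. \<psi> (noise_value K d) * F (noise_value K d))"
    proof -
      have B: "4 * K\<^sup>2 = 2 * N" and nv: "noise_value K d = int d - int N" for d
        by (auto simp: noise_value_def N_def)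
      show ?thesis
        unfolding B
        by (intro sum.reindex_bij_witness[where i = "noise_value K" and j = "\<lambda>z. nat (z + R)"])
          (auto simp: R_def nv)
    qed
    also have "\<dots> = (\<Sum>d<4 * K\<^sup>2. real (noise_weight K d) * F (noise_value K d)) / (D * (of_int R)\<^sup>2 ^ N)"
      unfolding sum_divide_distrib by (intro sum.cong refl) (simp add: weight)
    finally show "(\<integral>x. \<psi>' x * F \<lfloor>real K * x\<rfloor> \<partial>lborel) = U * (\<Sum>d<4 * K\<^sup>2. real (noise_weight K d) * F (noise_value K d))"
      by (simp add: U_def)
  qed
  have U: "0 < U" using D N0 K by (simp add: U_def R_def)
  have ptw: "\<bar>std_normal_density x - \<psi>' x\<bar> \<le> 76 / real K * normal_density 0 2 x" for x
  proof -
    define y where "y = of_int \<lfloor>real K * x\<rfloor> / real K"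
    have fl: "0 \<le> real K * x - of_int \<lfloor>real K * x\<rfloor>" "real K * x - of_int \<lfloor>real K * x\<rfloor> \<le> 1" by linarith+
    have "x - y = (real K * x - of_int \<lfloor>real K * x\<rfloor>) / real K"
      using K by (simp add: y_def diff_divide_distrib)
    then have xy: "0 \<le> x - y" "x - y \<le> 1 / real K"
      using divide_nonneg_nonneg[OF fl(1), of "real K"] divide_right_mono[OF fl(2), of "real K"] by simp_all
    have "std_normal_density x - \<psi>' x = (exp (- x\<^sup>2 / 2) - max 0 (1 - y\<^sup>2 / 2 / real (2 * K\<^sup>2)) ^ (2 * K\<^sup>2)) / D"
      by (simp add: std_normal_density_def \<psi>'_def \<psi>_def y_def D_def N_def diff_divide_distrib)
    also have "\<bar>\<dots>\<bar> \<le> 38 / real K * exp (- x\<^sup>2 / 8) / D"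
      unfolding abs_divide abs_of_pos[OF D]
      by (rule divide_right_mono[OF density_error[OF K xy] less_imp_le[OF D]])
    also have "\<dots> = 76 / real K * normal_density 0 2 x"
    proof -
      have "sqrt (2 * pi * 2\<^sup>2) = 2 * D" unfolding D_def real_sqrt_mult by simp
      then show ?thesis using D by (simp add: normal_density_def)
    qed
    finally show ?thesis .
  qed
  have close: "\<bar>(\<integral>x. F \<lfloor>real K * x\<rfloor> \<partial>std_normal) - U * (\<Sum>d<4 * K\<^sup>2. real (noise_weight K d) * F (noise_value K d))\<bar> \<le> 76 / real K"
    if F: "\<And>z. \<bar>F z\<bar> \<le> 1" for F :: "int \<Rightarrow> real"
  proof -
    have [measurable]: "(\<lambda>x. F \<lfloor>real K * x\<rfloor>) \<in> borel_measurable borel" by measurable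
    have i1: "integrable lborel (\<lambda>x. std_normal_density x * F \<lfloor>real K * x\<rfloor>)"
    proof (rule Bochner_Integration.integrable_bound[OF integrable_normal_density[of 1 0]])
      show "AE x in lborel. norm (std_normal_density x * F \<lfloor>real K * x\<rfloor>) \<le> norm (normal_density 0 1 x)"
        using F by (intro AE_I2) (auto simp: abs_mult mult_left_le)
    qed auto
    have "(\<integral>x. F \<lfloor>real K * x\<rfloor> \<partial>std_normal) = (\<integral>x. std_normal_density x * F \<lfloor>real K * x\<rfloor> \<partial>lborel)"
      by (subst integral_density) auto
    then have "(\<integral>x. F \<lfloor>real K * x\<rfloor> \<partial>std_normal) - U * (\<Sum>d<4 * K\<^sup>2. real (noise_weight K d) * F (noise_value K d))
      = (\<integral>x. std_normal_density x * F \<lfloor>real K * x\<rfloor> - \<psi>' x * F \<lfloor>real K * x\<rfloor> \<partial>lborel)"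
      using Bochner_Integration.integral_diff[OF i1 sumU(1)[of F]] sumU(2)[of F] by simp
    also have "\<bar>\<dots>\<bar> \<le> (\<integral>x. 76 / real K * normal_density 0 2 x \<partial>lborel)"
    proof (rule order_trans[OF integral_abs_bound integral_mono])
      show "integrable lborel (\<lambda>x. \<bar>std_normal_density x * F \<lfloor>real K * x\<rfloor> - \<psi>' x * F \<lfloor>real K * x\<rfloor>\<bar>)"
        using i1 sumU(1) by (intro integrable_abs Bochner_Integration.integrable_diff)
      show "\<bar>std_normal_density x * F \<lfloor>real K * x\<rfloor> - \<psi>' x * F \<lfloor>real K * x\<rfloor>\<bar> \<le> 76 / real K * normal_density 0 2 x" for x
        using mult_mono[OF ptw F[of "\<lfloor>real K * x\<rfloor>"]]
        by (simp add: left_diff_distrib[symmetric] abs_mult)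
    qed simp
    also have "\<dots> = 76 / real K" by simp
    finally show ?thesis .
  qed
  define S where "S = real (noise_total K)"
  define V where "V = (\<Sum>d<4 * K\<^sup>2. real (noise_weight K d) * G (noise_value K d))"
  have S: "0 < S" using noise_total_pos[OF K] by (simp add: S_def)
  have V: "\<bar>V\<bar> \<le> S"
  proof -
    have "\<bar>V\<bar> \<le> (\<Sum>d<4 * K\<^sup>2. \<bar>real (noise_weight K d) * G (noise_value K d)\<bar>)" unfolding V_def by (rule sum_abs)
    also have "\<dots> \<le> (\<Sum>d<4 * K\<^sup>2. real (noise_weight K d))"
      using G by (intro sum_mono) (simp add: abs_mult mult_left_le)
    finally show ?thesis by (simp add: S_def noise_total_def)
  qed
  have "\<bar>1 - U * S\<bar> \<le> 76 / real K"
    using close[of "\<lambda>_. 1"] prob_space.prob_space[OF prob_space_std_normal]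
    by (simp add: S_def noise_total_def)
  moreover have "U * V - V / S = (U * S - 1) * (V / S)" using S by (simp add: field_simps)
  then have "\<bar>U * V - V / S\<bar> = \<bar>1 - U * S\<bar> * \<bar>V / S\<bar>" by (simp add: abs_mult abs_minus_commute)
  moreover have "\<bar>V / S\<bar> \<le> 1" using V S by (simp add: abs_divide)
  ultimately have "\<bar>U * V - V / S\<bar> \<le> 76 / real K"
    by (metis abs_ge_zero mult_left_le order_trans)
  moreover have "grid_mean K G = V / S" by (simp add: grid_mean_def V_def S_def)
  moreover have "\<bar>(\<integral>x. G \<lfloor>real K * x\<rfloor> \<partial>std_normal) - U * V\<bar> \<le> 76 / real K"
    unfolding V_def by (rule close) (rule G)
  moreover have "76 / real K + 76 / real K = 152 / real K" by simp
  ultimately show ?thesis by linarith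
qed

text \<open>One number s codes a whole noise vector by its digits in base
  \<open>4 * K\<^sup>2\<close>, so an expectation over m coordinates becomes a single finite
  sum.\<close>

definition grid_noise :: "nat \<Rightarrow> nat \<Rightarrow> nat \<Rightarrow> nat \<Rightarrow> int" where
  "grid_noise K m s = (\<lambda>k\<in>{..<m}. noise_value K (s div (4 * K\<^sup>2) ^ k mod (4 * K\<^sup>2)))"

definition grid_weight :: "nat \<Rightarrow> nat \<Rightarrow> nat \<Rightarrow> nat" where
  "grid_weight K m s = (\<Prod>k<m. noise_weight K (s div (4 * K\<^sup>2) ^ k mod (4 * K\<^sup>2)))"

definition grid_expectation :: "nat \<Rightarrow> nat \<Rightarrow> ((nat \<Rightarrow> int) \<Rightarrow> real) \<Rightarrow> real" where
  "grid_expectation K m G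
     = (\<Sum>s<(4 * K\<^sup>2) ^ m. real (grid_weight K m s) * G (grid_noise K m s)) / real (noise_total K) ^ m"

lemma grid_expectation_Suc:
  "grid_expectation K (Suc m) G
    = (\<Sum>d<4 * K\<^sup>2. real (noise_weight K d) * grid_expectation K m (\<lambda>z. G (z(m := noise_value K d)))) / real (noise_total K)"
proof -
  let ?B = "4 * K\<^sup>2"
  let ?f = "\<lambda>s. real (grid_weight K (Suc m) s) * G (grid_noise K (Suc m) s)"
  have "(\<Sum>s<?B ^ Suc m. ?f s) = (\<Sum>d<?B. sum ?f {d * ?B ^ m..<d * ?B ^ m + ?B ^ m})"
    by (simp add: sum.nat_group)
  also have "\<dots> = (\<Sum>d<?B. \<Sum>s<?B ^ m. ?f (s + d * ?B ^ m))"
  proof (rule sum.cong[OF refl])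
    fix d
    have "sum ?f {0 + d * ?B ^ m..<?B ^ m + d * ?B ^ m} = (\<Sum>s=0..<?B ^ m. ?f (s + d * ?B ^ m))"
      by (rule sum.shift_bounds_nat_ivl)
    then show "sum ?f {d * ?B ^ m..<d * ?B ^ m + ?B ^ m} = (\<Sum>s<?B ^ m. ?f (s + d * ?B ^ m))"
      by (simp only: add_0 atLeast0LessThan add.commute[of "?B ^ m" "d * ?B ^ m"])
  qed
  also have "\<dots> = (\<Sum>d<?B. \<Sum>s<?B ^ m. real (noise_weight K d) *
      (real (grid_weight K m s) * G ((grid_noise K m s)(m := noise_value K d))))"
  proof (intro sum.cong refl)
    fix d s assume "d \<in> {..<?B}" "s \<in> {..<?B ^ m}"
    then have top: "(s + d * ?B ^ m) div ?B ^ m mod ?B = d" by (intro top_digit) auto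
    have low: "(s + d * ?B ^ m) div ?B ^ k mod ?B = s div ?B ^ k mod ?B" if "k < m" for k
      using that by (rule low_digit)
    have "grid_weight K (Suc m) (s + d * ?B ^ m) = grid_weight K m s * noise_weight K d"
      unfolding grid_weight_def prod.lessThan_Suc top
      by (intro arg_cong2[where f = "(*)"] refl prod.cong arg_cong[where f = "noise_weight K"]) (rule low, simp)
    moreover have "grid_noise K (Suc m) (s + d * ?B ^ m) = (grid_noise K m s)(m := noise_value K d)"
    proof -
      have "(\<lambda>k\<in>{..<Suc m}. noise_value K (X div B ^ k mod B))
          = (\<lambda>k\<in>{..<m}. noise_value K (s div B ^ k mod B))(m := noise_value K d)"
        if "\<And>k. k < m \<Longrightarrow> X div B ^ k mod B = s div B ^ k mod B" "X div B ^ m mod B = d" for X B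
        using that by (intro ext) (auto simp: restrict_def less_Suc_eq)
      from this[OF low top] show ?thesis unfolding grid_noise_def .
    qed
    ultimately show "?f (s + d * ?B ^ m) = real (noise_weight K d) *
      (real (grid_weight K m s) * G ((grid_noise K m s)(m := noise_value K d)))" by simp
  qed
  finally show ?thesis
    by (simp add: grid_expectation_def sum_distrib_left sum_divide_distrib mult.commute mult.left_commute)
qed

text \<open>The coordinates are discretized one at a time. Each costs 152 / K, because the integrand
  that remains is still bounded by 1.\<close>

lemma grid_expectation_close:
  fixes G :: "(nat \<Rightarrow> int) \<Rightarrow> real"
  assumes K: "1 \<le> K" and G: "\<And>z. \<bar>G z\<bar> \<le> 1"
  shows "\<bar>(\<integral>e. G (\<lambda>k\<in>{..<m}. \<lfloor>real K * e k\<rfloor>) \<partial>std_noise {..<m}) - grid_expectation K m G\<bar>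
    \<le> real m * (152 / real K)"
  using G
proof (induction m arbitrary: G)
  case 0
  have "(\<integral>e. G (\<lambda>k\<in>{}. \<lfloor>real K * e k\<rfloor>) \<partial>std_noise {}) = G (\<lambda>_. undefined)"
    using prob_space.prob_space[OF prob_space_std_noise[of "{} :: nat set"]] by (simp add: restrict_def)
  then show ?case by (simp add: grid_expectation_def grid_weight_def grid_noise_def restrict_def)
next
  case (Suc m)
  interpret P: product_sigma_finite "\<lambda>_. std_normal"
    by (simp add: product_sigma_finite_def prob_space_std_normal prob_space_imp_sigma_finite)
  let ?fl = "\<lambda>m e. \<lambda>k\<in>{..<m}. \<lfloor>real K * e k\<rfloor>"
  let ?V = "\<lambda>d. noise_value K d"
  let ?W = "\<lambda>d. real (noise_weight K d)"
  let ?S = "real (noise_total K)"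
  have S: "0 < ?S" using noise_total_pos[OF K] by simp
  have fm: "finite_measure (std_noise I)" for I :: "nat set"
    using prob_space_std_noise by (rule prob_space.finite_measure)
  have int: "integrable (std_noise {..<m}) (\<lambda>e. F (?fl m e))" if "\<And>z. \<bar>F z\<bar> \<le> 1" for F :: "(nat \<Rightarrow> int) \<Rightarrow> real" and m
  proof (rule finite_measure.integrable_const_bound[OF fm, of _ 1])
    have "(\<lambda>e. F (?fl m e)) \<in> borel_measurable (PiM {..<m} (\<lambda>_. borel))"
      by (rule measurable_grid) simp
    then show "(\<lambda>e. F (?fl m e)) \<in> borel_measurable (std_noise {..<m})" by measurable
  qed (use that in auto)
  have "(\<integral>e. G (?fl (Suc m) e) \<partial>std_noise {..<Suc m})
      = (\<integral>e. \<integral>y. G (?fl (Suc m) (e(m := y))) \<partial>std_normal \<partial>std_noise {..<m})"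
    unfolding std_noise_def lessThan_Suc
    by (rule P.product_integral_insert)
      (use int[of G "Suc m"] Suc.prems in \<open>auto simp: std_noise_def lessThan_Suc\<close>)
  also have "\<dots> = (\<integral>e. \<integral>y. G ((?fl m e)(m := \<lfloor>real K * y\<rfloor>)) \<partial>std_normal \<partial>std_noise {..<m})"
  proof -
    have "?fl (Suc m) (e(m := y)) = (?fl m e)(m := \<lfloor>real K * y\<rfloor>)" for e y
      by (rule ext) (auto simp: restrict_def less_Suc_eq)
    then show ?thesis by simp
  qed
  finally have lhs: "(\<integral>e. G (?fl (Suc m) e) \<partial>std_noise {..<Suc m})
      = (\<integral>e. \<integral>y. G ((?fl m e)(m := \<lfloor>real K * y\<rfloor>)) \<partial>std_normal \<partial>std_noise {..<m})" .
  have inner: "\<bar>(\<integral>y. G (z(m := \<lfloor>real K * y\<rfloor>)) \<partial>std_normal) - grid_mean K (\<lambda>v. G (z(m := v)))\<bar> \<le> 152 / real K" for z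
    by (rule grid_mean_close[OF K]) (rule Suc.prems)
  have gm1: "\<bar>grid_mean K F\<bar> \<le> 1" if "\<And>z. \<bar>F z\<bar> \<le> 1" for F
  proof -
    have "\<bar>\<Sum>d<4 * K\<^sup>2. ?W d * F (?V d)\<bar> \<le> (\<Sum>d<4 * K\<^sup>2. \<bar>?W d * F (?V d)\<bar>)" by (rule sum_abs)
    also have "\<dots> \<le> (\<Sum>d<4 * K\<^sup>2. ?W d)"
      using that by (intro sum_mono) (simp add: abs_mult mult_left_le)
    also have "\<dots> = ?S" by (simp add: noise_total_def)
    finally show ?thesis using S by (simp add: grid_mean_def abs_divide)
  qed
  have in1: "\<bar>\<integral>y. G (z(m := \<lfloor>real K * y\<rfloor>)) \<partial>std_normal\<bar> \<le> 1" for z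
  proof -
    have [measurable]: "(\<lambda>y. G (z(m := \<lfloor>real K * y\<rfloor>))) \<in> borel_measurable borel" by measurable
    have "integrable std_normal (\<lambda>y. G (z(m := \<lfloor>real K * y\<rfloor>)))"
      by (rule finite_measure.integrable_const_bound[OF prob_space.finite_measure[OF prob_space_std_normal], of _ 1])
        (use Suc.prems in auto)
    then have "\<bar>\<integral>y. G (z(m := \<lfloor>real K * y\<rfloor>)) \<partial>std_normal\<bar> \<le> (\<integral>y. 1 \<partial>std_normal)"
      by (intro order_trans[OF integral_abs_bound integral_mono])
        (use Suc.prems prob_space.finite_measure[OF prob_space_std_normal] in \<open>auto intro: finite_measure.integrable_const\<close>)
    then show ?thesis using prob_space.prob_space[OF prob_space_std_normal] by simp
  qed
  have i1: "integrable (std_noise {..<m}) (\<lambda>e. \<integral>y. G ((?fl m e)(m := \<lfloor>real K * y\<rfloor>)) \<partial>std_normal)"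
    by (rule int) (rule in1)
  have i2: "integrable (std_noise {..<m}) (\<lambda>e. grid_mean K (\<lambda>v. G ((?fl m e)(m := v))))"
    by (rule int) (rule gm1, rule Suc.prems)
  have "\<bar>(\<integral>e. G (?fl (Suc m) e) \<partial>std_noise {..<Suc m})
      - (\<integral>e. grid_mean K (\<lambda>v. G ((?fl m e)(m := v))) \<partial>std_noise {..<m})\<bar> \<le> (\<integral>e. 152 / real K \<partial>std_noise {..<m})"
    unfolding lhs Bochner_Integration.integral_diff[OF i1 i2, symmetric]
    by (rule order_trans[OF integral_abs_bound integral_mono],
        rule integrable_abs[OF Bochner_Integration.integrable_diff[OF i1 i2]],
        rule finite_measure.integrable_const[OF fm], rule inner)
  also have "\<dots> = 152 / real K" using prob_space.prob_space[OF prob_space_std_noise[of "{..<m}"]] by simp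
  finally have step1: "\<bar>(\<integral>e. G (?fl (Suc m) e) \<partial>std_noise {..<Suc m})
      - (\<integral>e. grid_mean K (\<lambda>v. G ((?fl m e)(m := v))) \<partial>std_noise {..<m})\<bar> \<le> 152 / real K" .
  have "(\<integral>e. grid_mean K (\<lambda>v. G ((?fl m e)(m := v))) \<partial>std_noise {..<m})
      = (\<Sum>d<4 * K\<^sup>2. ?W d * (\<integral>e. G ((?fl m e)(m := ?V d)) \<partial>std_noise {..<m})) / ?S"
  proof -
    have "integrable (std_noise {..<m}) (\<lambda>e. G ((?fl m e)(m := ?V d)))" for d
      by (rule int[of "\<lambda>z. G (z(m := ?V d))"]) (rule Suc.prems)
    then have "(\<integral>e. (\<Sum>d<4 * K\<^sup>2. ?W d * G ((?fl m e)(m := ?V d))) \<partial>std_noise {..<m})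
        = (\<Sum>d<4 * K\<^sup>2. \<integral>e. ?W d * G ((?fl m e)(m := ?V d)) \<partial>std_noise {..<m})"
      by (intro Bochner_Integration.integral_sum integrable_mult_right)
    then show ?thesis
      unfolding grid_mean_def integral_divide_zero by (simp only: integral_mult_right_zero)
  qed
  moreover have "grid_expectation K (Suc m) G
      = (\<Sum>d<4 * K\<^sup>2. ?W d * grid_expectation K m (\<lambda>z. G (z(m := ?V d)))) / ?S"
    by (rule grid_expectation_Suc)
  ultimately have "(\<integral>e. grid_mean K (\<lambda>v. G ((?fl m e)(m := v))) \<partial>std_noise {..<m}) - grid_expectation K (Suc m) G
      = (\<Sum>d<4 * K\<^sup>2. ?W d * ((\<integral>e. G ((?fl m e)(m := ?V d)) \<partial>std_noise {..<m})
            - grid_expectation K m (\<lambda>z. G (z(m := ?V d))))) / ?S"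
    by (simp add: sum_subtractf right_diff_distrib diff_divide_distrib)
  also have "\<bar>\<dots>\<bar> \<le> (\<Sum>d<4 * K\<^sup>2. ?W d * (real m * (152 / real K))) / ?S"
  proof -
    have weighted: "\<bar>\<Sum>d<4 * K\<^sup>2. ?W d * \<delta> d\<bar> \<le> (\<Sum>d<4 * K\<^sup>2. ?W d * r)" if "\<And>d. \<bar>\<delta> d\<bar> \<le> r" for \<delta> r
      by (rule order_trans[OF sum_abs]) (intro sum_mono, simp add: abs_mult mult_left_mono that)
    have IH: "\<bar>(\<integral>e. G ((?fl m e)(m := ?V d)) \<partial>std_noise {..<m})
            - grid_expectation K m (\<lambda>z. G (z(m := ?V d)))\<bar> \<le> real m * (152 / real K)" for d
      by (rule Suc.IH[of "\<lambda>z. G (z(m := ?V d))"]) (rule Suc.prems)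
    show ?thesis
      unfolding abs_divide abs_of_pos[OF S]
      by (intro divide_right_mono less_imp_le[OF S]) (rule weighted, rule IH)
  qed
  also have "\<dots> = real m * (152 / real K)"
  proof -
    have "(\<Sum>d<4 * K\<^sup>2. ?W d * r) / ?S = r" for r
      using S by (simp add: sum_distrib_right[symmetric] noise_total_def)
    then show ?thesis .
  qed
  finally have "\<bar>(\<integral>e. grid_mean K (\<lambda>v. G ((?fl m e)(m := v))) \<partial>std_noise {..<m}) - grid_expectation K (Suc m) G\<bar>
      \<le> real m * (152 / real K)" .
  moreover have "real (Suc m) * (152 / real K) = 152 / real K + real m * (152 / real K)"
    by (simp add: distrib_right[symmetric] add_divide_distrib algebra_simps)
  ultimately show ?case using step1 by linarith
qed

section \<open>The algorithm\<close>

text \<open>All quantities are integers that represent multiples of 1/K. A real constant r enters only through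
  a function f with f k = k r + O(1), so every position is computed with error O(1/K), uniformly over
  the unbounded space of observations.\<close>

locale grid_game = contracting_game +
  fixes \<Omega> :: "(nat \<Rightarrow> nat) set" and fa fb fe fk fl fr ft :: "nat \<Rightarrow> nat" and C :: real
  assumes rec: "recursive_in \<Omega> fa" "recursive_in \<Omega> fb" "recursive_in \<Omega> fe" "recursive_in \<Omega> fk"
      "recursive_in \<Omega> fl" "recursive_in \<Omega> fr" "recursive_in \<Omega> ft"
    and apx: "\<And>z. \<bar>of_int (odd_extension fa z) - of_int z * \<alpha>\<bar> \<le> C"
      "\<And>z. \<bar>of_int (odd_extension fb z) - of_int z * \<beta>\<bar> \<le> C"
      "\<And>z. \<bar>of_int (odd_extension fe z) - of_int z * \<eta>\<bar> \<le> C"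
      "\<And>z. \<bar>of_int (odd_extension fk z) - of_int z * \<kappa>\<bar> \<le> C"
      "\<And>z. \<bar>of_int (odd_extension fl z) - of_int z * (1 - \<kappa>)\<bar> \<le> C"
      "\<And>z. \<bar>of_int (odd_extension fr z) - of_int z * \<rho>\<bar> \<le> C"
      "\<And>z. \<bar>of_int (odd_extension ft z) - of_int z * \<tau>\<bar> \<le> C"
begin

definition mean_int :: "(nat \<Rightarrow> int) \<Rightarrow> int" where
  "mean_int z = odd_extension fa (z 0) + (\<Sum>p=1..<n. odd_extension fb (z p))"

definition private_int :: "(nat \<Rightarrow> int) \<Rightarrow> (nat \<Rightarrow> int) \<Rightarrow> nat \<Rightarrow> int" where
  "private_int z e q = odd_extension fk (mean_int z + odd_extension fe (e 0))
     + odd_extension fl (z q) + odd_extension fr (e q)"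

definition peer_int :: "nat \<Rightarrow> (nat \<Rightarrow> int) \<Rightarrow> (nat \<Rightarrow> int) \<Rightarrow> nat \<Rightarrow> int" where
  "peer_int p z e q = (if q = 0 then private_int z e p
     else (if q = p then z 0 else private_int z e q) + odd_extension ft (e (n + q)))"

definition scaled :: "nat \<Rightarrow> (nat \<Rightarrow> int) \<Rightarrow> nat \<Rightarrow> real" where
  "scaled K z q = of_int (z q) / real K"

text \<open>Error of one coordinate of \<open>peer_int\<close> in units of 1/K. It involves at most
  n + 5 applications of \<open>odd_extension\<close>, n of them in \<open>mean_int\<close>, each
  with error C; rounding the noise to the grid adds \<eta>, \<rho> and \<tau>.\<close>

definition err :: real where "err = (real n + 5) * C + \<eta> + \<rho> + \<tau>"

lemma C_nonneg: "0 \<le> C"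
  using apx(1)[of 0] by linarith

lemma err_nonneg: "0 \<le> err"
  using C_nonneg constants_pos tau_pos by (simp add: err_def)

lemma mean_int_close:
  assumes K: "1 \<le> K"
  shows "\<bar>of_int (mean_int z) - real K * posterior_mean (scaled K z)\<bar> \<le> real n * C"
proof -
  have K0: "real K * (of_int x / real K) = of_int x" for x using K by simp
  have "of_int (mean_int z) - real K * posterior_mean (scaled K z)
    = (of_int (odd_extension fa (z 0)) - of_int (z 0) * \<alpha>)
      + (\<Sum>p=1..<n. of_int (odd_extension fb (z p)) - of_int (z p) * \<beta>)"
  proof -
    have "real K * posterior_mean (scaled K z)
        = \<alpha> * (real K * (of_int (z 0) / real K)) + \<beta> * (\<Sum>p=1..<n. real K * (of_int (z p) / real K))"
      by (simp only: posterior_mean_def scaled_def distrib_left sum_distrib_left mult.left_commute)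
    then show ?thesis
      by (simp only: K0) (simp add: mean_int_def sum_subtractf sum_distrib_left mult.commute)
  qed
  also have "\<bar>\<dots>\<bar> \<le> C + (\<Sum>p=1..<n. C)"
    by (intro order_trans[OF abs_triangle_ineq] add_mono apx order_trans[OF sum_abs] sum_mono)
  also have "\<dots> = real n * C" using n_ge by (simp add: of_nat_diff algebra_simps)
  finally show ?thesis .
qed

lemma peer_int_close:
  assumes K: "1 \<le> K" and p: "p < n" and q: "q < n"
  shows "\<bar>scaled K (peer_int p z (\<lambda>k\<in>{..<2 * n}. \<lfloor>real K * e k\<rfloor>)) q - peer_obs p (scaled K z) e q\<bar> \<le> err / real K"
proof -
  define d where "d = (\<lambda>k\<in>{..<2 * n}. \<lfloor>real K * e k\<rfloor>)"
  have d: "\<bar>of_int (d k) - real K * e k\<bar> \<le> 1" if "k < 2 * n" for k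
    using that by (simp add: d_def) linarith
  have near: "\<bar>of_int (odd_extension f z) - r * x\<bar> \<le> C + r * b"
    if "\<And>z. \<bar>of_int (odd_extension f z) - of_int z * r\<bar> \<le> C" "\<bar>of_int z - x\<bar> \<le> b" "0 \<le> r"
    for f z r x b
  proof -
    have "\<bar>of_int z * r - r * x\<bar> \<le> r * b"
    proof -
      have "of_int z * r - r * x = r * (of_int z - x)" by (simp add: algebra_simps)
      then have "\<bar>of_int z * r - r * x\<bar> = r * \<bar>of_int z - x\<bar>" using that(3) by (simp only: abs_mult abs_of_nonneg)
      then show ?thesis using mult_left_mono[OF that(2,3)] by simp
    qed
    then show ?thesis using that(1)[of z] by linarith
  qed
  let ?m = "posterior_mean (scaled K z)"
  have sc: "real K * scaled K w q = of_int (w q)" for w q using K by (simp add: scaled_def)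
  have "\<bar>of_int (odd_extension fe (d 0)) - \<eta> * (real K * e 0)\<bar> \<le> C + \<eta> * 1"
    using n_ge constants_pos by (intro near apx d) auto
  then have th: "\<bar>of_int (mean_int z + odd_extension fe (d 0)) - (real K * ?m + \<eta> * (real K * e 0))\<bar> \<le> real n * C + (C + \<eta>)"
    using mean_int_close[OF K, of z] by simp
  have priv: "\<bar>of_int (private_int z d k) - real K * private_of (scaled K z) e k\<bar> \<le> err - C - \<tau>" if k: "k < n" for k
  proof -
    have 1: "\<bar>of_int (odd_extension fk (mean_int z + odd_extension fe (d 0))) - \<kappa> * (real K * ?m + \<eta> * (real K * e 0))\<bar>
        \<le> C + \<kappa> * (real n * C + (C + \<eta>))"
      using constants_pos by (intro near apx th) auto
    have "\<kappa> * (real n * C + (C + \<eta>)) \<le> real n * C + (C + \<eta>)"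
      using constants_pos C_nonneg by (intro mult_left_le_one_le) auto
    moreover have "\<bar>of_int (odd_extension fr (d k)) - \<rho> * (real K * e k)\<bar> \<le> C + \<rho> * 1"
      using k constants_pos by (intro near apx d) auto
    moreover have "real K * private_of (scaled K z) e k
        = \<kappa> * (real K * ?m + \<eta> * (real K * e 0)) + (1 - \<kappa>) * (real K * scaled K z k) + \<rho> * (real K * e k)"
      by (simp add: private_of_def algebra_simps)
    moreover have "\<bar>of_int (odd_extension fl (z k)) - (1 - \<kappa>) * of_int (z k)\<bar> \<le> C"
      using apx(5)[of "z k"] by (simp add: mult.commute)
    moreover have "err - C - \<tau> = (C + (real n * C + (C + \<eta>))) + C + (C + \<rho>)"
      by (simp add: err_def algebra_simps)
    ultimately show ?thesis using 1 unfolding private_int_def sc by (simp only: of_int_add)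
  qed
  have ct: "0 \<le> C + \<tau>" using C_nonneg tau_pos by simp
  have ft: "\<bar>of_int (odd_extension ft (d (n + q))) - \<tau> * (real K * e (n + q))\<bar> \<le> C + \<tau> * 1"
    using q tau_pos by (intro near apx d) auto
  have "\<bar>of_int (peer_int p z d q) - real K * peer_obs p (scaled K z) e q\<bar> \<le> err"
  proof (cases "q = 0")
    case True
    then show ?thesis using priv[OF p] ct by (simp add: peer_int_def peer_obs_def)
  next
    case False
    define x where "x = (if q = p then of_int (z 0) else of_int (private_int z d q) :: real)"
    define y where "y = (if q = p then real K * scaled K z 0 else real K * private_of (scaled K z) e q)"
    have "0 \<le> err - C - \<tau>" using C_nonneg constants_pos by (simp add: err_def algebra_simps)
    then have "\<bar>x - y\<bar> \<le> err - C - \<tau>" using priv[OF q] by (simp add: x_def y_def sc)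
    moreover have "of_int (peer_int p z d q) = x + of_int (odd_extension ft (d (n + q)))"
      using False by (simp add: peer_int_def x_def)
    moreover have "real K * peer_obs p (scaled K z) e q = y + \<tau> * (real K * e (n + q))"
      using False by (simp add: peer_obs_def y_def algebra_simps)
    ultimately show ?thesis using ft by linarith
  qed
  from divide_right_mono[OF this, of "real K"]
  have "\<bar>(of_int (peer_int p z d q) - real K * peer_obs p (scaled K z) e q) / real K\<bar> \<le> err / real K"
    by (simp add: abs_divide)
  then show ?thesis using K by (simp add: d_def scaled_def diff_divide_distrib)
qed

lemma peer_int_cong:
  assumes "\<And>q. q < n \<Longrightarrow> z q = z' q" "p < n" "q < n"
  shows "peer_int p z e q = peer_int p z' e q"
proof -
  have "mean_int z = mean_int z'" using assms n_ge by (simp add: mean_int_def)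
  then show ?thesis using assms n_ge by (auto simp: peer_int_def private_int_def)
qed

text \<open>A branch index s codes both the noise (its lowest 2n digits) and the peer.\<close>

definition child :: "nat \<Rightarrow> nat \<Rightarrow> nat \<Rightarrow> nat" where
  "child K x s = vec_encode n (\<lambda>q. \<Sum>p=1..<n. if Suc (s div (4 * K\<^sup>2) ^ (2 * n)) = p
     then peer_int p (vec_decode x) (grid_noise K (2 * n) s) q else 0)"

text \<open>The condition 0 \<le> \<open>level_value\<close>, multiplied by K and by the total
  weight, becomes an inequality of natural numbers with the expected actions on one side. Those are
  nonnegative, so both truncations to naturals preserve it.\<close>

definition threshold :: "nat \<Rightarrow> nat \<Rightarrow> nat" where
  "threshold K x = nat (mean_int (vec_decode x)) * noise_total K ^ (2 * n) - K * noise_total K ^ (2 * n)"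

definition bit :: "nat \<Rightarrow> nat \<Rightarrow> nat \<Rightarrow> nat" where
  "bit K = tree_bit (threshold K) (\<lambda>s. K * grid_weight K (2 * n) s) (child K) ((n - 1) * (4 * K\<^sup>2) ^ (2 * n))"

definition branches :: "nat \<Rightarrow> nat \<Rightarrow> nat \<Rightarrow> nat" where
  "branches K l x = (\<Sum>s<(n - 1) * (4 * K\<^sup>2) ^ (2 * n). K * grid_weight K (2 * n) s * bit K l (child K x s))"

text \<open>Discrete counterpart of \<open>gain\<close>, applied to the decisions of height l; its
  sign is the decision of height l + 1.\<close>

definition level_value :: "nat \<Rightarrow> nat \<Rightarrow> (nat \<Rightarrow> int) \<Rightarrow> real" where
  "level_value K l z = 1 + (\<Sum>p=1..<n. grid_expectation K (2 * n) (\<lambda>e. real (bit K l (vec_encode n (peer_int p z e)))))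
     - of_int (mean_int z) / real K"

lemma vec_encode_cong: "(\<And>q. q < n \<Longrightarrow> z q = z' q) \<Longrightarrow> vec_encode n z = vec_encode n z'"
  unfolding vec_encode_def by (intro arg_cong[where f = list_encode] map_cong) auto

lemma branches_eq:
  assumes K: "1 \<le> K"
  shows "real (branches K l (vec_encode n z))
    = real K * real (noise_total K) ^ (2 * n)
        * (\<Sum>p=1..<n. grid_expectation K (2 * n) (\<lambda>e. real (bit K l (vec_encode n (peer_int p z e)))))"
proof -
  let ?B = "4 * K\<^sup>2"
  let ?D = "?B ^ (2 * n)"
  let ?S = "real (noise_total K)"
  let ?f = "\<lambda>s. K * grid_weight K (2 * n) s * bit K l (child K (vec_encode n z) s)"
  let ?g = "\<lambda>p s. K * (grid_weight K (2 * n) s * bit K l (vec_encode n (peer_int p z (grid_noise K (2 * n) s))))"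
  have S: "0 < ?S" using noise_total_pos[OF K] by simp
  have D: "0 < ?D" using K by simp
  have low: "grid_noise K (2 * n) (s + d * ?D) = grid_noise K (2 * n) s"
    "grid_weight K (2 * n) (s + d * ?D) = grid_weight K (2 * n) s" for s d
  proof -
    have l: "(s + d * ?D) div ?B ^ k mod ?B = s div ?B ^ k mod ?B" if "k < 2 * n" for k
      using that by (rule low_digit)
    show "grid_noise K (2 * n) (s + d * ?D) = grid_noise K (2 * n) s"
      unfolding grid_noise_def by (intro restrict_ext arg_cong[where f = "noise_value K"]) (rule l, simp)
    show "grid_weight K (2 * n) (s + d * ?D) = grid_weight K (2 * n) s"
      unfolding grid_weight_def by (intro prod.cong refl arg_cong[where f = "noise_weight K"]) (rule l, simp)
  qed
  have "branches K l (vec_encode n z) = (\<Sum>d<n - 1. sum ?f {d * ?D..<d * ?D + ?D})"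
    unfolding branches_def by (rule sum.nat_group[symmetric])
  also have "\<dots> = (\<Sum>d<n - 1. \<Sum>s<?D. ?g (Suc d) s)"
  proof (rule sum.cong[OF refl])
    fix d assume d: "d \<in> {..<n - 1}"
    have "sum ?f {0 + d * ?D..<?D + d * ?D} = (\<Sum>s=0..<?D. ?f (s + d * ?D))"
      by (rule sum.shift_bounds_nat_ivl)
    also have "\<dots> = (\<Sum>s<?D. ?g (Suc d) s)"
      unfolding atLeast0LessThan
    proof (rule sum.cong[OF refl])
      fix s assume s: "s \<in> {..<?D}"
      then have "(s + d * ?D) div ?D = d" using D by simp
      then have "child K (vec_encode n z) (s + d * ?D)
          = vec_encode n (\<lambda>q. \<Sum>p=1..<n. if Suc d = p
              then peer_int p (vec_decode (vec_encode n z)) (grid_noise K (2 * n) s) q else 0)"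
        unfolding child_def low by simp
      also have "\<dots> = vec_encode n (peer_int (Suc d) z (grid_noise K (2 * n) s))"
      proof (rule vec_encode_cong)
        fix q assume q: "q < n"
        have "(\<Sum>p=1..<n. if Suc d = p then peer_int p (vec_decode (vec_encode n z)) (grid_noise K (2 * n) s) q else 0)
            = peer_int (Suc d) (vec_decode (vec_encode n z)) (grid_noise K (2 * n) s) q"
          using d by (subst sum.delta') auto
        also have "\<dots> = peer_int (Suc d) z (grid_noise K (2 * n) s) q"
          using d q by (intro peer_int_cong) (auto simp: vec_decode_encode)
        finally show "(\<Sum>p=1..<n. if Suc d = p then peer_int p (vec_decode (vec_encode n z)) (grid_noise K (2 * n) s) q else 0)
            = peer_int (Suc d) z (grid_noise K (2 * n) s) q" .
      qed
      finally show "?f (s + d * ?D) = ?g (Suc d) s" unfolding low by simp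
    qed
    finally show "sum ?f {d * ?D..<d * ?D + ?D} = (\<Sum>s<?D. ?g (Suc d) s)"
      by (simp only: add_0 add.commute[of "?D" "d * ?D"])
  qed
  also have "\<dots> = (\<Sum>p=1..<n. \<Sum>s<?D. ?g p s)"
    by (rule sum.reindex_bij_witness[where i = "\<lambda>p. p - 1" and j = Suc]) auto
  finally have "real (branches K l (vec_encode n z)) = (\<Sum>p=1..<n. real (\<Sum>s<?D. ?g p s))"
    by (simp only: of_nat_sum)
  also have "\<dots> = (\<Sum>p=1..<n. real K * (?S ^ (2 * n)
      * grid_expectation K (2 * n) (\<lambda>e. real (bit K l (vec_encode n (peer_int p z e))))))"
  proof (rule sum.cong[OF refl])
    fix p
    have "?S ^ (2 * n) * grid_expectation K (2 * n) G = (\<Sum>s<?D. real (grid_weight K (2 * n) s) * G (grid_noise K (2 * n) s))" for G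
      using S by (simp add: grid_expectation_def)
    then show "real (\<Sum>s<?D. ?g p s) = real K * (?S ^ (2 * n)
      * grid_expectation K (2 * n) (\<lambda>e. real (bit K l (vec_encode n (peer_int p z e)))))"
      by (simp only: of_nat_sum of_nat_mult sum_distrib_left)
  qed
  finally show ?thesis by (simp only: sum_distrib_left mult.assoc)
qed

lemma mean_int_decode: "mean_int (vec_decode (vec_encode n z)) = mean_int z"
  using n_ge by (simp add: mean_int_def vec_decode_encode)

lemma bit_Suc:
  assumes K: "1 \<le> K"
  shows "bit K (Suc l) (vec_encode n z) = (if 0 \<le> level_value K l z then 1 else 0)"
proof -
  let ?S = "real (noise_total K) ^ (2 * n)"
  let ?E = "\<Sum>p=1..<n. grid_expectation K (2 * n) (\<lambda>e. real (bit K l (vec_encode n (peer_int p z e))))"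
  define m where "m = mean_int z"
  have S: "0 < ?S" using noise_total_pos[OF K] by simp
  have K0: "0 < real K" using K by simp
  have "bit K (Suc l) (vec_encode n z) = (if threshold K (vec_encode n z) \<le> branches K l (vec_encode n z) then 1 else 0)"
    unfolding bit_def branches_def by (simp add: mult.assoc)
  moreover have "threshold K (vec_encode n z) \<le> branches K l (vec_encode n z) \<longleftrightarrow> 0 \<le> level_value K l z"
  proof -
    have "threshold K (vec_encode n z) \<le> branches K l (vec_encode n z)
      \<longleftrightarrow> nat m * noise_total K ^ (2 * n) \<le> K * noise_total K ^ (2 * n) + branches K l (vec_encode n z)"
      unfolding threshold_def mean_int_decode m_def by auto
    also have "\<dots> \<longleftrightarrow> real (nat m * noise_total K ^ (2 * n)) \<le> real (K * noise_total K ^ (2 * n) + branches K l (vec_encode n z))"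
      by (simp only: of_nat_le_iff)
    also have "\<dots> \<longleftrightarrow> real (nat m) * ?S \<le> real K * (1 + ?E) * ?S"
      by (simp only: of_nat_mult of_nat_add of_nat_power branches_eq[OF K]) (simp add: algebra_simps)
    also have "\<dots> \<longleftrightarrow> real (nat m) \<le> real K * (1 + ?E)" using S by (rule mult_le_cancel_right_pos)
    \<comment> \<open>For negative m both inequalities hold, since the right-hand side is
      nonnegative.\<close>
    also have "\<dots> \<longleftrightarrow> of_int m \<le> real K * (1 + ?E)"
    proof -
      have "0 \<le> ?E"
        unfolding grid_expectation_def by (intro sum_nonneg divide_nonneg_nonneg) auto
      then have "0 \<le> real K * (1 + ?E)" using K0 by simp
      then show ?thesis by (cases "0 \<le> m") (auto intro: order_trans[of _ 0])
    qed
    also have "\<dots> \<longleftrightarrow> of_int m / real K \<le> 1 + ?E"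
      using K0 by (simp add: pos_divide_le_eq mult.commute)
    also have "\<dots> \<longleftrightarrow> 0 \<le> level_value K l z" by (simp add: level_value_def m_def)
    finally show ?thesis .
  qed
  ultimately show ?thesis by simp
qed

text \<open>Error added by one level in units of 1/K: 9/10 * (10 * err) from displaced peer
  observations, then the discretized expectations of n - 1 peers over 2 * n coordinates, then the
  posterior mean.\<close>

definition step_err :: real where
  "step_err = 9 * err + (real n - 1) * (real (2 * n) * 152) + real n * C"

text \<open>P is the decision rule of the current height and E its accuracy. A wrong decision
  implies that h is small, so \<open>peer_prob_close\<close> passes E on with factor 9/10;
  discretization adds O(1/K).\<close>

lemma level_value_step:
  assumes K: "1 \<le> K" and h: "admissible h" "\<And>u. gain h u = h u"
    and P: "\<And>z. bit K l (vec_encode n z) = (if P z then 1 else 0)"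
    and E: "0 \<le> E" "\<And>z v. (0 \<le> h v) \<noteq> P z \<Longrightarrow> (\<And>q. q < n \<Longrightarrow> \<bar>scaled K z q - v q\<bar> \<le> err / real K) \<Longrightarrow> \<bar>h v\<bar> \<le> E + 10 * err / real K"
  shows "\<bar>level_value K l z - h (scaled K z)\<bar> \<le> 9 / 10 * E + step_err / real K"
proof -
  have L: "sup_lipschitz 10 h" and st: "steep h" using h(1) by (auto simp: admissible_def)
  have K0: "0 < real K" using K by simp
  let ?fl = "\<lambda>e. \<lambda>k\<in>{..<2 * n}. \<lfloor>real K * e k\<rfloor>"
  let ?G = "\<lambda>p e. real (bit K l (vec_encode n (peer_int p z e)))"
  let ?I = "\<lambda>p. \<integral>e. ?G p (?fl e) \<partial>noise_space"
  have "\<bar>peer_prob h p (scaled K z) - ?I p\<bar> \<le> \<gamma> * (E + 10 * err / real K)" if p: "p \<in> {1..<n}" for p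
  proof -
    have eq: "?G p (?fl e) = of_bool (P (peer_int p z (?fl e)))" for e by (simp add: P)
    have m: "(\<lambda>e. of_bool (P (peer_int p z (?fl e))) :: real) \<in> borel_measurable (PiM {..<2 * n} (\<lambda>_. borel))"
      by (rule measurable_grid) simp
    have "Measurable.pred (PiM {..<2 * n} (\<lambda>_. borel)) (\<lambda>e. (of_bool (P (peer_int p z (?fl e))) :: real) = 1)"
      using m by measurable
    then have pr: "Measurable.pred (PiM {..<2 * n} (\<lambda>_. borel)) (\<lambda>e. P (peer_int p z (?fl e)))" by simp
    show ?thesis
      unfolding eq
    proof (rule peer_prob_close[OF st L p _ pr])
      show "0 \<le> E + 10 * err / real K" using E(1) err_nonneg by simp
      fix e assume "(0 \<le> h (peer_obs p (scaled K z) e)) \<noteq> P (peer_int p z (?fl e))"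
      then show "\<bar>h (peer_obs p (scaled K z) e)\<bar> \<le> E + 10 * err / real K"
        by (rule E(2)) (use p in \<open>auto intro!: peer_int_close[OF K]\<close>)
    qed
  qed
  then have 1: "\<bar>(\<Sum>p=1..<n. peer_prob h p (scaled K z)) - (\<Sum>p=1..<n. ?I p)\<bar> \<le> 9 / 10 * (E + 10 * err / real K)"
    using E(1) err_nonneg by (intro sum_gamma_le) auto
  have b1: "\<bar>?G p e\<bar> \<le> 1" for p e by (simp add: P)
  have 2: "\<bar>(\<Sum>p=1..<n. ?I p) - (\<Sum>p=1..<n. grid_expectation K (2 * n) (?G p))\<bar> \<le> (real n - 1) * (real (2 * n) * (152 / real K))"
  proof -
    have "\<bar>(\<Sum>p=1..<n. ?I p) - (\<Sum>p=1..<n. grid_expectation K (2 * n) (?G p))\<bar>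
        \<le> (\<Sum>p=1..<n. \<bar>?I p - grid_expectation K (2 * n) (?G p)\<bar>)"
      unfolding sum_subtractf[symmetric] by (rule sum_abs)
    also have "\<dots> \<le> (\<Sum>p=1..<n. real (2 * n) * (152 / real K))"
      by (intro sum_mono grid_expectation_close[OF K] b1)
    finally show ?thesis using n_ge by (simp add: of_nat_diff)
  qed
  have 3: "\<bar>of_int (mean_int z) / real K - posterior_mean (scaled K z)\<bar> \<le> real n * C / real K"
  proof -
    have "\<bar>of_int (mean_int z) - real K * posterior_mean (scaled K z)\<bar> / real K \<le> real n * C / real K"
      using mean_int_close[OF K] by (intro divide_right_mono) auto
    moreover have "of_int (mean_int z) / real K - posterior_mean (scaled K z)
        = (of_int (mean_int z) - real K * posterior_mean (scaled K z)) / real K"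
      using K by (simp add: diff_divide_distrib)
    ultimately show ?thesis by (simp only: abs_divide abs_of_nat)
  qed
  have "h (scaled K z) = 1 + (\<Sum>p=1..<n. peer_prob h p (scaled K z)) - posterior_mean (scaled K z)"
    using h(2)[of "scaled K z"] by (simp add: gain_def)
  then have "\<bar>level_value K l z - h (scaled K z)\<bar>
      \<le> 9 / 10 * (E + 10 * err / real K) + (real n - 1) * (real (2 * n) * (152 / real K)) + real n * C / real K"
    using 1 2 3 unfolding level_value_def by linarith
  also have "\<dots> = 9 / 10 * E + step_err / real K"
    by (simp add: step_err_def add_divide_distrib diff_divide_distrib algebra_simps)
  finally show ?thesis .
qed

text \<open>10 * step_err / K is the fixed point of the recursion E to 9/10 * E + step_err / K, so
  the errors of all levels together stay O(1/K). The initial error stems from treating all peers as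
  safe and decays geometrically.\<close>

lemma level_value_close:
  assumes K: "1 \<le> K" and h: "admissible h" "\<And>u. gain h u = h u"
  shows "\<bar>level_value K l z - h (scaled K z)\<bar> \<le> (9 / 10) ^ l * (real n + real n * C) + 10 * step_err / real K"
proof (induction l arbitrary: z)
  case 0
  have K0: "1 \<le> real K" using K by simp
  have se: "0 \<le> step_err" using err_nonneg C_nonneg n_ge by (simp add: step_err_def)
  have "bit K 0 x = 0" for x by (simp add: bit_def)
  then have lv: "level_value K 0 z = 1 - of_int (mean_int z) / real K"
    by (simp add: level_value_def grid_expectation_def)
  have pp: "0 \<le> peer_prob h p u" "peer_prob h p u \<le> 1" for p u
    unfolding peer_prob_def by (rule integral_of_bool_bounds)+
  have "0 \<le> (\<Sum>p=1..<n. peer_prob h p (scaled K z))" by (intro sum_nonneg pp)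
  moreover have "(\<Sum>p=1..<n. peer_prob h p (scaled K z)) \<le> (\<Sum>p=1..<n. 1)" by (intro sum_mono pp)
  moreover have "h (scaled K z) = 1 + (\<Sum>p=1..<n. peer_prob h p (scaled K z)) - posterior_mean (scaled K z)"
    using h(2)[of "scaled K z"] by (simp add: gain_def)
  moreover have "\<bar>of_int (mean_int z) / real K - posterior_mean (scaled K z)\<bar> \<le> real n * C"
  proof -
    have "of_int (mean_int z) / real K - posterior_mean (scaled K z)
        = (of_int (mean_int z) - real K * posterior_mean (scaled K z)) / real K"
      using K by (simp add: diff_divide_distrib)
    also have "\<bar>\<dots>\<bar> \<le> \<bar>of_int (mean_int z) - real K * posterior_mean (scaled K z)\<bar> / 1"
      unfolding abs_divide using K0 by (intro divide_left_mono) auto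
    finally show ?thesis using mean_int_close[OF K, of z] by simp
  qed
  moreover have "0 \<le> 10 * step_err / real K" using se by simp
  ultimately show ?case using n_ge unfolding lv power_0 mult_1_left by (simp add: of_nat_diff)
next
  case (Suc l)
  have L: "sup_lipschitz 10 h" using h(1) by (simp add: admissible_def)
  have se: "0 \<le> step_err" using err_nonneg C_nonneg n_ge by (simp add: step_err_def)
  define E where "E = (9 / 10) ^ l * (real n + real n * C) + 10 * step_err / real K"
  have "\<bar>level_value K (Suc l) z - h (scaled K z)\<bar> \<le> 9 / 10 * E + step_err / real K"
  proof (rule level_value_step[OF K h])
    show "bit K (Suc l) (vec_encode n z) = (if 0 \<le> level_value K l z then 1 else 0)" for z
      by (rule bit_Suc[OF K])
    show "0 \<le> E" using C_nonneg se by (simp add: E_def)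
    fix z v assume sgn: "(0 \<le> h v) \<noteq> (0 \<le> level_value K l z)"
      and zv: "\<And>q. q < n \<Longrightarrow> \<bar>scaled K z q - v q\<bar> \<le> err / real K"
    have "\<bar>h (scaled K z) - h v\<bar> \<le> 10 * (err / real K)"
      using zv by (intro sup_lipschitzD[OF L])
    moreover have "\<bar>level_value K l z - h (scaled K z)\<bar> \<le> E" unfolding E_def by (rule Suc.IH)
    ultimately show "\<bar>h v\<bar> \<le> E + 10 * err / real K" using sgn by auto
  qed
  also have "\<dots> = (9 / 10) ^ Suc l * (real n + real n * C) + 10 * step_err / real K"
    by (simp add: E_def algebra_simps)
  finally show ?case .
qed

section \<open>Recursiveness of the discretized iteration\<close>

lemma recursive_mean_int:
  assumes "\<And>q. recursive_int_in \<Omega> (\<lambda>x. z x q)"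
  shows "recursive_int_in \<Omega> (\<lambda>x. mean_int (z x))"
  unfolding mean_int_def
  by (intro recursive_int_in_add recursive_int_in_sum recursive_int_in_odd_extension rec assms)

lemma recursive_peer_int:
  assumes "\<And>q. recursive_int_in \<Omega> (\<lambda>x. z x q)" "\<And>q. recursive_int_in \<Omega> (\<lambda>x. e x q)"
  shows "recursive_int_in \<Omega> (\<lambda>x. peer_int p (z x) (e x) q)"
proof -
  have priv: "recursive_int_in \<Omega> (\<lambda>x. private_int (z x) (e x) q)" for q
    unfolding private_int_def
    by (intro recursive_int_in_add recursive_int_in_odd_extension rec recursive_mean_int assms)
  show ?thesis
    unfolding peer_int_def
    by (cases "q = 0"; cases "q = p")
      (auto intro!: recursive_int_in_add recursive_int_in_odd_extension rec priv assms)
qed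

lemma recursive_noise_weight:
  assumes "recursive_in \<Omega> K" "recursive_in \<Omega> d"
  shows "recursive_in \<Omega> (\<lambda>x. noise_weight (K x) (d x))"
  unfolding noise_weight_def by (intro rec_intros assms)

lemma recursive_noise_total:
  assumes "recursive_in \<Omega> K"
  shows "recursive_in \<Omega> (\<lambda>x. noise_total (K x))"
  unfolding noise_total_def
  by (intro rec_intros recursive_noise_weight composition[OF assms] assms)

lemma recursive_grid_weight:
  assumes "recursive_in \<Omega> K" "recursive_in \<Omega> s"
  shows "recursive_in \<Omega> (\<lambda>x. grid_weight (K x) m (s x))"
  unfolding grid_weight_def
  by (intro rec_intros recursive_noise_weight composition[OF assms(1)] composition[OF assms(2)] assms)

lemma recursive_grid_noise:
  assumes "recursive_in \<Omega> K" "recursive_in \<Omega> s"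
  shows "recursive_int_in \<Omega> (\<lambda>x. grid_noise (K x) m (s x) k)"
proof (cases "k < m")
  case True
  have "recursive_int_in \<Omega> (\<lambda>x. noise_value (K x) (s x div (4 * (K x)\<^sup>2) ^ k mod (4 * (K x)\<^sup>2)))"
    unfolding noise_value_def by (intro rec_intros assms)
  then show ?thesis using True by (simp add: grid_noise_def)
next
  case False
  then show ?thesis by (simp add: grid_noise_def recursive_int_in_def recursive_in_const)
qed

text \<open>The sum over p in \<open>child\<close> acts as a finite case distinction, so
  recursiveness of \<open>peer_int p\<close> is required for fixed p only.\<close>

lemma recursive_child:
  assumes "recursive_in \<Omega> K" "recursive_in \<Omega> x" "recursive_in \<Omega> s"
  shows "recursive_in \<Omega> (\<lambda>y. child (K y) (x y) (s y))"
  unfolding child_def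
  by (intro recursive_in_vec_encode recursive_int_in_sum recursive_int_in_if decidable_in_eq
      recursive_peer_int recursive_grid_noise recursive_int_in_vec_decode
      recursive_in_Suc recursive_in_div recursive_in_power recursive_in_mult recursive_in_const assms)
    (simp add: recursive_int_in_def recursive_in_const)

lemma recursive_threshold:
  assumes "recursive_in \<Omega> K" "recursive_in \<Omega> x"
  shows "recursive_in \<Omega> (\<lambda>y. threshold (K y) (x y))"
  unfolding threshold_def
  by (intro recursive_in_diff recursive_in_mult recursive_in_power recursive_in_const recursive_in_nat
      recursive_noise_total recursive_mean_int recursive_int_in_vec_decode assms)

lemma recursive_bit:
  assumes "recursive_in \<Omega> K" "recursive_in \<Omega> l" "recursive_in \<Omega> x"
  shows "recursive_in \<Omega> (\<lambda>y. bit (K y) (l y) (x y))"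
proof -
  have "recursive_in \<Omega> (\<lambda>y. bit (pfst y) (pfst (psnd y)) (psnd (psnd y)))"
    unfolding bit_def
    by (rule recursive_in_tree_bit)
      (intro rec_intros recursive_threshold recursive_child recursive_grid_weight)+
  then show ?thesis by (rule recursive_in_app3) (rule assms)+
qed

lemma recursive_branches:
  assumes "recursive_in \<Omega> K" "recursive_in \<Omega> l" "recursive_in \<Omega> x"
  shows "recursive_in \<Omega> (\<lambda>y. branches (K y) (l y) (x y))"
  unfolding branches_def
  by (intro rec_intros recursive_bit recursive_child recursive_grid_weight
      composition[OF assms(1)] composition[OF assms(2)] composition[OF assms(3)] assms)

text \<open>K times the level value of height K, with the expectation part rounded down. Mesh and
  depth are tied to the same K, since (9/10)^K is O(1/K).\<close>

definition numerator :: "nat \<Rightarrow> nat \<Rightarrow> int" where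
  "numerator K x = int K + int (branches K K x div noise_total K ^ (2 * n)) - mean_int (vec_decode x)"

text \<open>Works with c guard digits, that is on the mesh 1 / 2 ^ (k + c), and then rounds to the
  nearest multiple of 1 / 2 ^ k; adding 2 ^ (c - 1) turns floor division into rounding. Entry 0 of
  the input is k, hence the shift by one for the coordinates.\<close>

definition algorithm :: "nat \<Rightarrow> nat \<Rightarrow> nat" where
  "algorithm c x = int_encode
     ((numerator (2 ^ (list_entry 0 x + c)) (vec_encode n (\<lambda>q. int_decode (list_entry (Suc q) x))) + int (2 ^ (c - 1)))
        div int (2 ^ c))"

lemma recursive_algorithm: "recursive_in \<Omega> (algorithm c)"
proof -
  have "recursive_in \<Omega> (\<lambda>x. algorithm c x)"
    unfolding algorithm_def numerator_def
    by (intro rec_intros recursive_branches recursive_noise_total recursive_mean_int) auto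
  then show ?thesis .
qed

lemma numerator_close:
  assumes K: "1 \<le> K" and h: "admissible h" "\<And>u. gain h u = h u"
  shows "\<bar>of_int (numerator K (vec_encode n z)) / real K - h (scaled K z)\<bar>
    \<le> (1 + 9 * (real n + real n * C) + 10 * step_err) / real K"
proof -
  let ?S = "noise_total K ^ (2 * n)"
  let ?E = "\<Sum>p=1..<n. grid_expectation K (2 * n) (\<lambda>e. real (bit K K (vec_encode n (peer_int p z e))))"
  have K0: "0 < real K" using K by simp
  have S: "0 < ?S" using noise_total_pos[OF K] by simp
  have "real (branches K K (vec_encode n z) div ?S) = of_int \<lfloor>real (branches K K (vec_encode n z)) / real ?S\<rfloor>"
    by (simp only: floor_divide_of_nat_eq of_int_of_nat_eq)
  moreover have "real (branches K K (vec_encode n z)) / real ?S = real K * ?E"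
    using noise_total_pos[OF K] unfolding branches_eq[OF K] by simp
  ultimately have fl: "\<bar>real (branches K K (vec_encode n z) div ?S) - real K * ?E\<bar> \<le> 1"
    by (simp only:) linarith
  have "real K * level_value K K z = real K + real K * ?E - of_int (mean_int z)"
    using K by (simp add: level_value_def algebra_simps)
  then have "\<bar>of_int (numerator K (vec_encode n z)) - real K * level_value K K z\<bar> \<le> 1"
    using fl unfolding numerator_def mean_int_decode by (simp only: of_int_add of_int_diff of_int_of_nat_eq)
  then have "\<bar>of_int (numerator K (vec_encode n z)) - real K * level_value K K z\<bar> / real K \<le> 1 / real K"
    by (rule divide_right_mono) simp
  moreover have "(of_int (numerator K (vec_encode n z)) - real K * level_value K K z) / real K
      = of_int (numerator K (vec_encode n z)) / real K - level_value K K z"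
    using K by (simp add: diff_divide_distrib)
  ultimately have 1: "\<bar>of_int (numerator K (vec_encode n z)) / real K - level_value K K z\<bar> \<le> 1 / real K"
    by (metis abs_divide abs_of_nat)
  \<comment> \<open>Bernoulli for (1 + 1/9)^K.\<close>
  have pw: "(9 / 10) ^ K \<le> 9 / real K"
  proof -
    have "real K / 9 \<le> (10 / 9) ^ K"
      using Bernoulli_inequality[of "1 / 9 :: real" K] by simp
    then have "1 / (10 / 9) ^ K \<le> 1 / (real K / 9)" using K0 by (intro divide_left_mono) auto
    then show ?thesis by (simp add: power_divide)
  qed
  have "0 \<le> real n + real n * C" using C_nonneg by simp
  from mult_right_mono[OF pw this]
  have "\<bar>level_value K K z - h (scaled K z)\<bar> \<le> 9 / real K * (real n + real n * C) + 10 * step_err / real K"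
    using level_value_close[OF K h, of K z] by linarith
  with 1 have "\<bar>of_int (numerator K (vec_encode n z)) / real K - h (scaled K z)\<bar>
      \<le> 1 / real K + (9 / real K * (real n + real n * C) + 10 * step_err / real K)" by linarith
  also have "\<dots> = (1 + 9 * (real n + real n * C) + 10 * step_err) / real K"
    by (simp add: add_divide_distrib)
  finally show ?thesis .
qed

lemma approximable:
  assumes h: "admissible h" "\<And>u. gain h u = h u"
  shows "\<exists>F P. recursive_in \<Omega> F \<and> recursive_in \<Omega> P \<and>
    (\<forall>k. \<forall>u\<in>Rn n. \<bar>finite_precision_eval n F (P k) k u - h u\<bar> \<le> 1 / 2 ^ k)"
proof -
  \<comment> \<open>D is the constant of \<open>numerator_close\<close> plus 10 for rounding u to
    the grid. By the choice of c these errors use at most half of 1 / 2 ^ k; the final rounding uses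
    the other half.\<close>
  define D where "D = 11 + 9 * (real n + real n * C) + 10 * step_err"
  obtain c where c0: "2 * D < 2 ^ c" using real_arch_pow[of 2 "2 * D"] by auto
  \<comment> \<open>This excludes c = 0, for which 2 ^ (c - 1) would not be half of 2 ^ c.\<close>
  have "11 \<le> D"
    using C_nonneg err_nonneg n_ge by (simp add: D_def step_err_def)
  then have c: "2 * D \<le> 2 ^ c" "1 \<le> c" using c0 by (simp, cases c) auto
  have L: "sup_lipschitz 10 h" using h(1) by (simp add: admissible_def)
  have "\<bar>finite_precision_eval n (algorithm c) (k + c) k u - h u\<bar> \<le> 1 / 2 ^ k" for k u
  proof -
    define K :: nat where "K = 2 ^ (k + c)"
    define z where "z q = \<lfloor>2 ^ (k + c) * u q\<rfloor>" for q
    have K: "1 \<le> K" by (simp add: K_def)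
    have rK: "real K = 2 ^ k * 2 ^ c" by (simp add: K_def power_add)
    define N where "N = numerator K (vec_encode n z)"
    let ?x = "list_encode (k # map (\<lambda>q. int_encode \<lfloor>2 ^ (k + c) * u q\<rfloor>) [0..<n])"
    have "list_entry 0 ?x = k" by (subst list_entry_list_encode) auto
    moreover have "vec_encode n (\<lambda>q. int_decode (list_entry (Suc q) ?x)) = vec_encode n z"
      by (intro vec_encode_cong, subst list_entry_list_encode) (auto simp: z_def)
    ultimately have "finite_precision_eval n (algorithm c) (k + c) k u
        = of_int ((N + int (2 ^ (c - 1))) div int (2 ^ c)) / 2 ^ k"
      unfolding finite_precision_eval_def algorithm_def by (simp only: int_encode_inverse N_def K_def)
    moreover have "\<bar>of_int ((N + int (2 ^ (c - 1))) div int (2 ^ c)) - of_int N / 2 ^ c\<bar> \<le> (1 / 2 :: real)"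
    proof -
      have two: "2 ^ c = (2 * 2 ^ (c - 1) :: real)" using c(2) by (cases c) auto
      have "of_int ((N + int (2 ^ (c - 1))) div int (2 ^ c)) = (of_int \<lfloor>(of_int N + 2 ^ (c - 1)) / 2 ^ c :: real\<rfloor> :: real)"
        using floor_divide_of_int_eq[of "N + int (2 ^ (c - 1))" "int (2 ^ c)", where 'a = real] by simp
      moreover have "(of_int N + 2 ^ (c - 1)) / 2 ^ c = of_int N / 2 ^ c + (1 / 2 :: real)"
        by (simp add: add_divide_distrib two)
      ultimately show ?thesis by (simp only:) linarith
    qed
    then have "\<bar>of_int ((N + int (2 ^ (c - 1))) div int (2 ^ c)) - of_int N / 2 ^ c\<bar> / 2 ^ k \<le> (1 / 2 :: real) / 2 ^ k"
      by (rule divide_right_mono) simp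
    moreover have "\<bar>of_int ((N + int (2 ^ (c - 1))) div int (2 ^ c)) - of_int N / 2 ^ c\<bar> / 2 ^ k
        = (\<bar>of_int ((N + int (2 ^ (c - 1))) div int (2 ^ c)) / 2 ^ k - of_int N / real K\<bar> :: real)"
    proof -
      have "of_int ((N + int (2 ^ (c - 1))) div int (2 ^ c)) / 2 ^ k - of_int N / real K
          = (of_int ((N + int (2 ^ (c - 1))) div int (2 ^ c)) - of_int N / 2 ^ c) / (2 ^ k :: real)"
        by (simp add: diff_divide_distrib rK mult.commute)
      then show ?thesis by (simp only: abs_divide) simp
    qed
    ultimately have 1: "\<bar>finite_precision_eval n (algorithm c) (k + c) k u - of_int N / real K\<bar> \<le> 1 / 2 / 2 ^ k"
      by simp
    have 2: "\<bar>of_int N / real K - h (scaled K z)\<bar> \<le> (D - 10) / real K"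
      using numerator_close[OF K h, of z] by (simp add: N_def D_def add.assoc)
    have 3: "\<bar>h (scaled K z) - h u\<bar> \<le> 10 * (1 / real K)"
    proof (rule sup_lipschitzD[OF L])
      fix q
      have "\<bar>of_int (z q) - real K * u q\<bar> \<le> 1" unfolding z_def K_def by simp linarith
      then have "\<bar>of_int (z q) - real K * u q\<bar> / real K \<le> 1 / real K" by (rule divide_right_mono) simp
      moreover have "(of_int (z q) - real K * u q) / real K = scaled K z q - u q"
        using K by (simp add: scaled_def diff_divide_distrib)
      ultimately show "\<bar>scaled K z q - u q\<bar> \<le> 1 / real K" by (metis abs_divide abs_of_nat)
    qed
    have "(D - 10) / real K + 10 * (1 / real K) = D / 2 ^ c / 2 ^ k"
      by (simp add: rK add_divide_distrib[symmetric] mult.commute)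
    also have "\<dots> \<le> 1 / 2 / 2 ^ k"
      using c(1) by (intro divide_right_mono) (auto simp: pos_divide_le_eq)
    finally have "\<bar>finite_precision_eval n (algorithm c) (k + c) k u - h u\<bar> \<le> 1 / 2 / 2 ^ k + 1 / 2 / 2 ^ k"
      using 1 2 3 by linarith
    then show ?thesis by simp
  qed
  moreover have "recursive_in \<Omega> (\<lambda>k. k + c)" by (intro rec_intros)
  ultimately show ?thesis using recursive_algorithm[of c] by blast
qed

end

section \<open>Computability of the constants of the game\<close>

lemma computable_real_of_nat: "computable_real \<Omega> (real m)"
  unfolding computable_real_def
  by (rule exI[of _ "\<lambda>k. k * m"]) (auto intro!: rec_intros approximatesI[where C = 0])

context global_game
begin

lemma computable_constants:
  assumes "binary_oracle \<sigma> \<in> \<Omega>" "binary_oracle \<tau> \<in> \<Omega>"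
  shows "computable_real \<Omega> \<alpha>" "computable_real \<Omega> \<beta>" "computable_real \<Omega> \<eta>" "computable_real \<Omega> \<kappa>"
    "computable_real \<Omega> (1 - \<kappa>)" "computable_real \<Omega> \<rho>" "computable_real \<Omega> \<tau>"
proof -
  have s: "computable_real \<Omega> \<sigma>" and t: "computable_real \<Omega> \<tau>"
    using assms sigma_pos tau_pos by (auto intro: computable_real_binary_oracle)
  have s2: "computable_real \<Omega> (\<sigma>\<^sup>2)" and t2: "computable_real \<Omega> (\<tau>\<^sup>2)"
    unfolding power2_eq_square by (intro computable_real_mult s t)+
  have v: "computable_real \<Omega> (\<sigma>\<^sup>2 + \<tau>\<^sup>2)" by (intro computable_real_add s2 t2)
  have pos: "0 < \<sigma>\<^sup>2" "0 < \<sigma>\<^sup>2 + \<tau>\<^sup>2" using sigma_pos tau_pos by (auto simp: add_pos_pos)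
  have n1: "real n - 1 = real (n - 1)" using n_ge by (simp add: of_nat_diff)
  have "0 < 1 / \<sigma>\<^sup>2 + (real n - 1) / (\<sigma>\<^sup>2 + \<tau>\<^sup>2)"
    using pos n_ge by (intro add_pos_nonneg) auto
  then have e: "computable_real \<Omega> (eta2 \<sigma> \<tau> n)"
    unfolding eta2_def n1
    by (intro computable_real_inverse computable_real_add computable_real_divide computable_real_of_nat s2 v pos)
  show "computable_real \<Omega> \<alpha>" "computable_real \<Omega> \<beta>"
    unfolding \<alpha>_def \<beta>_def coeff_a_def coeff_b_def by (intro computable_real_divide e s2 v pos)+
  show "computable_real \<Omega> \<eta>"
    unfolding \<eta>_def using eta2_pos by (intro computable_real_sqrt e) simp
  show "computable_real \<Omega> \<kappa>"
    unfolding \<kappa>_def by (intro computable_real_divide t2 v pos)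
  \<comment> \<open>Approximations are valued in the naturals, so the difference is rewritten as a
    quotient of positive reals.\<close>
  have "1 - \<kappa> = \<sigma>\<^sup>2 / (\<sigma>\<^sup>2 + \<tau>\<^sup>2)" using sigma_pos by (simp add: \<kappa>_def diff_eq_eq add_divide_distrib[symmetric])
  then show "computable_real \<Omega> (1 - \<kappa>)" by (simp only:) (intro computable_real_divide s2 v pos)
  show "computable_real \<Omega> \<rho>"
    unfolding \<rho>_def using pos(2) by (intro computable_real_divide computable_real_mult computable_real_sqrt s t v) auto
  show "computable_real \<Omega> \<tau>" by (rule t)
qed

end

text \<open>The bound is stated for all larger C' so that the seven constants can share one
  C.\<close>

lemma computable_real_odd_extension:
  assumes "computable_real \<Omega> r"
  shows "\<exists>f C. recursive_in \<Omega> f \<and> (\<forall>C'\<ge>C. \<forall>z. \<bar>of_int (odd_extension f z) - of_int z * r\<bar> \<le> C')"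
  using assms odd_extension_approximates unfolding computable_real_def by (meson order_trans)

context contracting_game
begin

lemma numerically_approximable_fixpoint:
  assumes h: "admissible h" "\<And>u. gain h u = h u"
  shows "numerically_approximable n \<sigma> \<tau> h"
proof -
  define \<Omega> where "\<Omega> = {binary_oracle \<sigma>, binary_oracle \<tau>}"
  have "binary_oracle \<sigma> \<in> \<Omega>" "binary_oracle \<tau> \<in> \<Omega>" by (auto simp: \<Omega>_def)
  note comp = computable_constants[OF this]
  obtain fa Ca where a: "recursive_in \<Omega> fa" "\<forall>C'\<ge>Ca. \<forall>z. \<bar>of_int (odd_extension fa z) - of_int z * \<alpha>\<bar> \<le> C'"
    using computable_real_odd_extension[OF comp(1)] by blast
  obtain fb Cb where b: "recursive_in \<Omega> fb" "\<forall>C'\<ge>Cb. \<forall>z. \<bar>of_int (odd_extension fb z) - of_int z * \<beta>\<bar> \<le> C'"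
    using computable_real_odd_extension[OF comp(2)] by blast
  obtain fe Ce where e: "recursive_in \<Omega> fe" "\<forall>C'\<ge>Ce. \<forall>z. \<bar>of_int (odd_extension fe z) - of_int z * \<eta>\<bar> \<le> C'"
    using computable_real_odd_extension[OF comp(3)] by blast
  obtain fk Ck where k: "recursive_in \<Omega> fk" "\<forall>C'\<ge>Ck. \<forall>z. \<bar>of_int (odd_extension fk z) - of_int z * \<kappa>\<bar> \<le> C'"
    using computable_real_odd_extension[OF comp(4)] by blast
  obtain fl Cl where l: "recursive_in \<Omega> fl" "\<forall>C'\<ge>Cl. \<forall>z. \<bar>of_int (odd_extension fl z) - of_int z * (1 - \<kappa>)\<bar> \<le> C'"
    using computable_real_odd_extension[OF comp(5)] by blast
  obtain fr Cr where r: "recursive_in \<Omega> fr" "\<forall>C'\<ge>Cr. \<forall>z. \<bar>of_int (odd_extension fr z) - of_int z * \<rho>\<bar> \<le> C'"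
    using computable_real_odd_extension[OF comp(6)] by blast
  obtain ft Ct where t: "recursive_in \<Omega> ft" "\<forall>C'\<ge>Ct. \<forall>z. \<bar>of_int (odd_extension ft z) - of_int z * \<tau>\<bar> \<le> C'"
    using computable_real_odd_extension[OF comp(7)] by blast
  define C where "C = Max {Ca, Cb, Ce, Ck, Cl, Cr, Ct}"
  have C: "Ca \<le> C" "Cb \<le> C" "Ce \<le> C" "Ck \<le> C" "Cl \<le> C" "Cr \<le> C" "Ct \<le> C"
    unfolding C_def by (intro Max_ge; simp)+
  interpret grid_game n \<sigma> \<tau> \<Omega> fa fb fe fk fl fr ft C
    by unfold_locales (simp_all add: a b e k l r t C)
  show ?thesis
    using approximable[OF h] unfolding numerically_approximable_def \<Omega>_def .
qed

end

theorem theorem10: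
  fixes n :: nat and \<sigma> \<tau> :: real
  assumes "n \<ge> 2" and "\<sigma> > 0" and "\<tau> > 0"
    and "coeff_w \<sigma> \<tau> n < \<tau>"
  shows "\<exists>h :: (nat \<Rightarrow> real) \<Rightarrow> real.
           continuous_threshold_function n h \<and>
           bayesian_nash_equilibrium n \<sigma> \<tau> (\<lambda>i. threshold_strategy h) \<and>
           numerically_approximable n \<sigma> \<tau> h"
proof -
  interpret contracting_game n \<sigma> \<tau> by unfold_locales (use assms in auto)
  obtain h where h: "admissible h" "\<And>u. gain h u = h u" by (rule gain_fixpoint) blast
  then have "sup_lipschitz 10 h" "steep h" "exchangeable h" by (auto simp: admissible_def)
  then show ?thesis
    using steep_continuous_threshold_function threshold_equilibrium h
      numerically_approximable_fixpoint[OF h] by blast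
qed

end
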